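(* Let $\alpha\in(0,1)$, $T>0$, $r\ge1$. Let $0=t_0<t_1<\dots<t_N=T$ be a temporal mesh such that either $N=M$ and the mesh is quasi-graded with parameter $r$, or the mesh includes a submesh $\{t'_j\}_{j=0}^M$ of $[0,T]$ which is quasi-graded with parameter $r$ and has the same first mesh interval ($t_1'=t_1$). Given $p\in\{2,\infty\}$, suppose that $u$ is the unique solution of $$D_t^\alpha u+\mathcal Lu=f(x,t)\ \text{ in }\Omega\times(0,T],\qquad u=0\ \text{ on }\partial\Omega\times(0,T],\qquad u(x,0)=u_0(x)\ \text{ for } x\in\Omega,$$ where $$\mathcal Lu:=\sum_{k=1}^d\bigl\{-\partial_{x_k}(a_k(x,t)\,\partial_{x_k}u)+b_k(x,t)\,\partial_{x_k}u\bigr\}+c(x,t)\,u$$ with $c-p^{-1}\sum_{k=1}^d\partial_{x_k}b_k\ge0$ (for $p=\infty$, $p^{-1}:=0$), and suppose that $\|\partial_t^lu(\cdot,t)\|_{L_p(\Omega)}\lesssim1+t^{\alpha-l}$ for $l=1,2$ and $t\in(0,T]$. Let $\{U^m\}_{m=0}^N$ be defined by the L1 semidiscretization in time $$\delta_t^\alpha U^m+\mathcal LU^m=f(\cdot,t_m)\ \text{ in }\Omega,\quad U^m=0\ \text{ on }\partial\Omega\quad\forall m=1,\dots,N;\qquad U^0=u_0$$ (with the coefficients of $\mathcal L$ evaluated at $t=t_m$). Then $$\|u(\cdot,t_m)-U^m\|_{L_p(\Omega)}\lesssim\mathcal E^m\quad\forall m=1,\dots,N,\qquad \mathcal E^m:=\begin{cases}M^{-r}\,t_m^{\alpha-1}&\text{if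 }1\le r<2-\alpha,\\ M^{\alpha-2}\,t_m^{\alpha-1}\,[1+\ln(t_m/t_1)]&\text{if } r=2-\alpha,\\ M^{\alpha-2}\,t_m^{\alpha-(2-\alpha)/r}&\text{if } r>2-\alpha.\end{cases}$$
   Context: Standing setting: $\Omega\subset\mathbb{R}^d$, $d\in\{1,2,3\}$, is a bounded Lipschitz domain; the coefficients $a_k,b_k,c$ are sufficiently smooth (in $C(\bar\Omega)$ for each $t$), and $a_k>0$ in $\bar\Omega$. It is assumed that the initial-boundary value problem has a unique solution $u$. Caputo derivative: $D_t^\alpha u(\cdot,t):=\frac1{\Gamma(1-\alpha)}\int_0^t(t-s)^{-\alpha}\,\partial_su(\cdot,s)\,ds$ for $0<t\le T$. L1 operator on the mesh $\{t_j\}_{j=0}^N$: for $m=1,\dots,N$, $$\delta_t^\alpha U^m:=\frac1{\Gamma(1-\alpha)}\sum_{j=1}^m\frac{U^j-U^{j-1}}{t_j-t_{j-1}}\int_{t_{j-1}}^{t_j}(t_m-s)^{-\alpha}\,ds.$$ A mesh $0=t_0<\dots<t_M=T$ is quasi-graded with parameter $r\ge1$ if, with $\tau:=t_1$, $$\tau\simeq M^{-r},\qquad t_j\simeq\tau j^r,\qquad \tau_j:=t_j-t_{j-1}\simeq\tau^{1/r}t_j^{1-1/r}\qquad\forall j=1,\dots,M.$$ Notation: $a\lesssim b$ means $a\le Cb$ with a generic constant $C>0$ that does not depend on the numbers of mesh intervals or on mesh indices (it may depend on $\Omega,T,u_0,f$, on other fixed data such as $\alpha,r$ and the coefficients of $\mathcal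 L$, and on the constants implicit in the hypotheses); $a\simeq b$ means $a\lesssim b$ and $b\lesssim a$. *)

theory Defs
  imports "HOL-Probability.Probability"
begin

section \<open>Domains, partial derivatives and \<open>L\<^sub>p\<close> norms\<close>

text \<open>
  Near each boundary point a Lipschitz domain lies strictly above a Lipschitz graph over the
  hyperplane orthogonal to some unit vector \<open>\<nu>\<close>.  In dimension one this hyperplane is \<open>{0}\<close>.
\<close>

definition lipschitz_domain :: "(real ^ 'd) set \<Rightarrow> bool" where
  "lipschitz_domain \<Omega> \<longleftrightarrow> open \<Omega> \<and> connected \<Omega> \<and> \<Omega> \<noteq> {} \<and>
     (\<forall>z\<in>frontier \<Omega>. \<exists>\<nu> g L \<epsilon>. norm \<nu> = 1 \<and> \<epsilon> > 0 \<and> L-lipschitz_on {y. y \<bullet> \<nu> = 0} (g :: real ^ 'd \<Rightarrow> real) \<and>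
        (\<forall>y\<in>ball z \<epsilon>. y \<in> \<Omega> \<longleftrightarrow> y \<bullet> \<nu> > g (y - (y \<bullet> \<nu>) *\<^sub>R \<nu>)))"

definition pd :: "'d \<Rightarrow> (real ^ 'd \<Rightarrow> real) \<Rightarrow> real ^ 'd \<Rightarrow> real" where
  "pd k g x = deriv (\<lambda>h. g (x + h *\<^sub>R axis k 1)) 0"

text \<open>The space \<open>C\<^sup>n(\<Omega>)\<close>, for open \<open>\<Omega>\<close>.\<close>

primrec Ck_on :: "nat \<Rightarrow> (real ^ 'd) set \<Rightarrow> (real ^ 'd \<Rightarrow> real) \<Rightarrow> bool" where
  "Ck_on 0 \<Omega> g \<longleftrightarrow> continuous_on \<Omega> g"
| "Ck_on (Suc n) \<Omega> g \<longleftrightarrow> continuous_on \<Omega> g \<and>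
     (\<forall>k. (\<forall>x\<in>\<Omega>. (\<lambda>h. g (x + h *\<^sub>R axis k 1)) differentiable (at 0)) \<and> Ck_on n \<Omega> (pd k g))"

text \<open>
  The value \<open>\<infinity>\<close> for non-measurable functions makes every finite bound on the norm
  include measurability.
\<close>

definition Lp_norm :: "ennreal \<Rightarrow> (real ^ 'd) set \<Rightarrow> (real ^ 'd \<Rightarrow> real) \<Rightarrow> ennreal" where
  "Lp_norm p \<Omega> g =
    (if g \<notin> borel_measurable (lebesgue_on \<Omega>) then \<infinity>
     else if p = \<infinity> then esssup (lebesgue_on \<Omega>) (\<lambda>x. ennreal \<bar>g x\<bar>)
     else (let I = \<integral>\<^sup>+ x. ennreal (\<bar>g x\<bar> powr enn2real p) \<partial>lebesgue_on \<Omega>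
           in if I = \<infinity> then \<infinity> else ennreal (enn2real I powr (1 / enn2real p))))"


section \<open>The subdiffusion problem\<close>

text \<open>Differentiation in time on \<open>[0,T]\<close>, one-sided at the end points.\<close>

definition dt :: "real \<Rightarrow> (real \<Rightarrow> real) \<Rightarrow> real \<Rightarrow> real" where
  "dt T g t = vector_derivative g (at t within {0..T})"

definition caputo :: "real \<Rightarrow> real \<Rightarrow> (real \<Rightarrow> real) \<Rightarrow> real \<Rightarrow> real" where
  "caputo T \<alpha> g t =
     1 / Gamma (1 - \<alpha>) * (LINT s:{0<..<t}|lborel. (t - s) powr (-\<alpha>) * dt T g s)"

definition ell_op ::
  "('d::finite \<Rightarrow> real ^ 'd \<Rightarrow> real \<Rightarrow> real) \<Rightarrow> ('d \<Rightarrow> real ^ 'd \<Rightarrow> real \<Rightarrow> real) \<Rightarrow>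
   (real ^ 'd \<Rightarrow> real \<Rightarrow> real) \<Rightarrow> real \<Rightarrow> (real ^ 'd \<Rightarrow> real) \<Rightarrow> real ^ 'd \<Rightarrow> real" where
  "ell_op a b c t v x =
     (\<Sum>k\<in>UNIV. - pd k (\<lambda>y. a k y t * pd k v y) x + b k x t * pd k v x) + c x t * v x"

text \<open>
  Coefficients are continuous on the closure for each time, and have in addition the interior
  smoothness that the operator and the condition on \<open>c - p\<^sup>-\<^sup>1 \<Sum>\<^sub>k \<partial>\<^sub>k b\<^sub>k\<close> presuppose; for
  \<open>p = \<infinity>\<close> the latter involves no derivative of \<open>b\<close>.  No regularity in time is imposed.
\<close>

definition admissible_coeffs ::
  "ennreal \<Rightarrow> real \<Rightarrow> (real ^ 'd) set \<Rightarrow>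
   ('d::finite \<Rightarrow> real ^ 'd \<Rightarrow> real \<Rightarrow> real) \<Rightarrow> ('d \<Rightarrow> real ^ 'd \<Rightarrow> real \<Rightarrow> real) \<Rightarrow>
   (real ^ 'd \<Rightarrow> real \<Rightarrow> real) \<Rightarrow> bool" where
  "admissible_coeffs p T \<Omega> a b c \<longleftrightarrow> (\<forall>t\<in>{0<..T}.
     (\<forall>k. continuous_on (closure \<Omega>) (\<lambda>x. a k x t) \<and> Ck_on 1 \<Omega> (\<lambda>x. a k x t) \<and>
          (\<forall>x\<in>closure \<Omega>. a k x t > 0) \<and>
          continuous_on (closure \<Omega>) (\<lambda>x. b k x t) \<and>
          (p \<noteq> \<infinity> \<longrightarrow> Ck_on 1 \<Omega> (\<lambda>x. b k x t))) \<and>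
     continuous_on (closure \<Omega>) (\<lambda>x. c x t) \<and>
     (\<forall>x\<in>\<Omega>. c x t - enn2real (1 / p) * (\<Sum>k\<in>UNIV. pd k (\<lambda>y. b k y t) x) \<ge> 0))"

text \<open>
  Solutions are classical: continuous up to the boundary and the initial time, \<open>C\<^sup>2\<close> in space, and
  differentiable in time with an existing (absolutely convergent) Caputo integral.
\<close>

definition classical_solution ::
  "real \<Rightarrow> real \<Rightarrow> (real ^ 'd) set \<Rightarrow>
   ('d::finite \<Rightarrow> real ^ 'd \<Rightarrow> real \<Rightarrow> real) \<Rightarrow> ('d \<Rightarrow> real ^ 'd \<Rightarrow> real \<Rightarrow> real) \<Rightarrow>
   (real ^ 'd \<Rightarrow> real \<Rightarrow> real) \<Rightarrow> (real ^ 'd \<Rightarrow> real \<Rightarrow> real) \<Rightarrow> (real ^ 'd \<Rightarrow> real) \<Rightarrow>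
   (real ^ 'd \<Rightarrow> real \<Rightarrow> real) \<Rightarrow> bool" where
  "classical_solution T \<alpha> \<Omega> a b c f u0 u \<longleftrightarrow>
     continuous_on (closure \<Omega> \<times> {0..T}) (\<lambda>(x, t). u x t) \<and>
     (\<forall>t\<in>{0<..T}. Ck_on 2 \<Omega> (\<lambda>x. u x t)) \<and>
     (\<forall>x\<in>\<Omega>. \<forall>t\<in>{0<..T}. u x differentiable (at t within {0..T}) \<and>
        set_integrable lborel {0<..<t} (\<lambda>s. (t - s) powr (-\<alpha>) * dt T (u x) s)) \<and>
     (\<forall>x\<in>\<Omega>. \<forall>t\<in>{0<..T}. caputo T \<alpha> (u x) t + ell_op a b c t (\<lambda>y. u y t) x = f x t) \<and>
     (\<forall>x\<in>frontier \<Omega>. \<forall>t\<in>{0<..T}. u x t = 0) \<and>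
     (\<forall>x\<in>\<Omega>. u x 0 = u0 x)"

definition unique_classical_solution ::
  "real \<Rightarrow> real \<Rightarrow> (real ^ 'd) set \<Rightarrow>
   ('d::finite \<Rightarrow> real ^ 'd \<Rightarrow> real \<Rightarrow> real) \<Rightarrow> ('d \<Rightarrow> real ^ 'd \<Rightarrow> real \<Rightarrow> real) \<Rightarrow>
   (real ^ 'd \<Rightarrow> real \<Rightarrow> real) \<Rightarrow> (real ^ 'd \<Rightarrow> real \<Rightarrow> real) \<Rightarrow> (real ^ 'd \<Rightarrow> real) \<Rightarrow>
   (real ^ 'd \<Rightarrow> real \<Rightarrow> real) \<Rightarrow> bool" where
  "unique_classical_solution T \<alpha> \<Omega> a b c f u0 u \<longleftrightarrow>
     classical_solution T \<alpha> \<Omega> a b c f u0 u \<and>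
     (\<forall>v. classical_solution T \<alpha> \<Omega> a b c f u0 v \<longrightarrow> (\<forall>x\<in>closure \<Omega>. \<forall>t\<in>{0..T}. v x t = u x t))"

definition time_derivs_bounded ::
  "ennreal \<Rightarrow> real \<Rightarrow> real \<Rightarrow> (real ^ 'd) set \<Rightarrow> (real ^ 'd \<Rightarrow> real \<Rightarrow> real) \<Rightarrow> bool" where
  "time_derivs_bounded p T \<alpha> \<Omega> u \<longleftrightarrow>
     (\<forall>x\<in>\<Omega>. \<forall>t\<in>{0<..T}. u x differentiable (at t within {0..T}) \<and>
        dt T (u x) differentiable (at t within {0..T})) \<and>
     (\<exists>C. \<forall>l\<in>{1, 2}. \<forall>t\<in>{0<..T}.
        Lp_norm p \<Omega> (\<lambda>x. (dt T ^^ l) (u x) t) \<le> ennreal (C * (1 + t powr (\<alpha> - real l))))"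


section \<open>Temporal meshes and the L1 semidiscretization\<close>

definition temporal_mesh :: "real \<Rightarrow> nat \<Rightarrow> (nat \<Rightarrow> real) \<Rightarrow> bool" where
  "temporal_mesh T N t \<longleftrightarrow> N \<ge> 1 \<and> t 0 = 0 \<and> t N = T \<and> (\<forall>j<N. t j < t (Suc j))"

definition equiv_up_to :: "real \<Rightarrow> real \<Rightarrow> real \<Rightarrow> bool" where
  "equiv_up_to K x y \<longleftrightarrow> x \<le> K * y \<and> y \<le> K * x"

text \<open>\<open>K\<close> is the constant implicit in the equivalences; uniformity in \<open>M\<close> is expressed by fixing \<open>K\<close>.\<close>

definition quasi_graded :: "real \<Rightarrow> real \<Rightarrow> real \<Rightarrow> nat \<Rightarrow> (nat \<Rightarrow> real) \<Rightarrow> bool" where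
  "quasi_graded K r T M t \<longleftrightarrow> temporal_mesh T M t \<and>
     equiv_up_to K (t 1) (real M powr (-r)) \<and>
     (\<forall>j\<in>{1..M}. equiv_up_to K (t j) (t 1 * real j powr r) \<and>
        equiv_up_to K (t j - t (j - 1)) (t 1 powr (1 / r) * t j powr (1 - 1 / r)))"

definition L1_op :: "real \<Rightarrow> (nat \<Rightarrow> real) \<Rightarrow> (nat \<Rightarrow> real) \<Rightarrow> nat \<Rightarrow> real" where
  "L1_op \<alpha> t V m = 1 / Gamma (1 - \<alpha>) *
     (\<Sum>j = 1..m. (V j - V (j - 1)) / (t j - t (j - 1)) *
        (LINT s:{t (j - 1)<..<t j}|lborel. (t m - s) powr (-\<alpha>)))"

definition L1_semidiscrete_solution ::
  "real \<Rightarrow> (real ^ 'd) set \<Rightarrow>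
   ('d::finite \<Rightarrow> real ^ 'd \<Rightarrow> real \<Rightarrow> real) \<Rightarrow> ('d \<Rightarrow> real ^ 'd \<Rightarrow> real \<Rightarrow> real) \<Rightarrow>
   (real ^ 'd \<Rightarrow> real \<Rightarrow> real) \<Rightarrow> (real ^ 'd \<Rightarrow> real \<Rightarrow> real) \<Rightarrow> (real ^ 'd \<Rightarrow> real) \<Rightarrow>
   nat \<Rightarrow> (nat \<Rightarrow> real) \<Rightarrow> (nat \<Rightarrow> real ^ 'd \<Rightarrow> real) \<Rightarrow> bool" where
  "L1_semidiscrete_solution \<alpha> \<Omega> a b c f u0 N t U \<longleftrightarrow>
     (\<forall>m\<in>{1..N}. continuous_on (closure \<Omega>) (U m) \<and> Ck_on 2 \<Omega> (U m) \<and>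
        (\<forall>x\<in>\<Omega>. L1_op \<alpha> t (\<lambda>j. U j x) m + ell_op a b c (t m) (U m) x = f x (t m)) \<and>
        (\<forall>x\<in>frontier \<Omega>. U m x = 0)) \<and>
     (\<forall>x\<in>\<Omega>. U 0 x = u0 x)"

definition error_bound :: "real \<Rightarrow> real \<Rightarrow> nat \<Rightarrow> (nat \<Rightarrow> real) \<Rightarrow> nat \<Rightarrow> real" where
  "error_bound \<alpha> r M t m =
    (if r < 2 - \<alpha> then real M powr (-r) * t m powr (\<alpha> - 1)
     else if r = 2 - \<alpha> then real M powr (\<alpha> - 2) * t m powr (\<alpha> - 1) * (1 + ln (t m / t 1))
     else real M powr (\<alpha> - 2) * t m powr (\<alpha> - (2 - \<alpha>) / r))"

end

theory Submission
  imports Defs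
begin

text \<open>
  Testing the error equation at time \<open>t\<^sub>m\<close> (maximum principle for \<open>p = \<infinity>\<close>, energy for \<open>p = 2\<close>)
  bounds the \<open>L\<^sub>p\<close> norms of the errors by any nonnegative mesh function whose L1 operator dominates
  the truncation error, because the L1 operator has an M-matrix.  With \<open>\<tau> = t\<^sub>1\<close>, the truncation error
  is \<open>O((\<tau> / t\<^sub>m)\<^sup>\<theta>)\<close> for every \<open>\<theta> \<le> (2 - \<alpha>) / r\<close> with \<open>\<theta> < 1 + \<alpha>\<close>, since the mean-value error of the
  kernel on each interval is controlled both by the integral and by the increment of the kernel.

  The barrier is a superposition over mesh points \<open>q\<close>, with weights given by the quadrature of
  \<open>q powr - \<theta>\<close>, of the functions \<open>min (s * q powr (\<alpha> - 2)) (s powr (\<alpha> - 1))\<close>.  The Caputo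
  derivative of each of them is explicit and bounded below by \<open>q\<^sup>\<alpha> * t powr (- \<alpha> - 1)\<close> up to a constant factor; the
  discretization error of the whole superposition is absorbed by starting it at \<open>q \<ge> P * \<tau>\<close> with \<open>P\<close>
  large.  The three regimes of the error bound are those of \<open>\<integral> q powr - \<theta>\<close> for \<open>\<theta> > 1\<close>, \<open>\<theta> = 1\<close>,
  \<open>\<theta> < 1\<close>.  Only an upper bound on the steps enters, hence the case of a quasi-graded submesh.
\<close>

section \<open>Graded meshes and the L1 kernel\<close>

text \<open>The power \<open>s powr (\<alpha> - 1)\<close> is annihilated for s > 0 by the
  Riemann-Liouville derivative of order \<alpha>. Replacing it below \<open>q\<close> by a straight
  line through the origin makes it vanish at 0 and leaves a positive Caputo derivative: the leading
  terms cancel, and a remainder of size \<open>q powr \<alpha> * s powr (- \<alpha> - 1)\<close>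
  survives. Integrated against \<open>q powr - \<theta>\<close> over q < s, this returns
  \<open>s powr - \<theta>\<close> up to a constant, provided that \<theta> < 1 + \<alpha>. The
  obstacle is the L1 error of the barrier itself on a mesh without lower step bounds. It is bounded
  by one quantity, of size \<open>(1 / s) * (\<tau> / s) powr \<nu>\<close>, for all
  \<open>q\<close>. Summed against the weights of the points q >= P * \<tau>, it acquires the small
  factor \<open>P powr - \<nu>\<close>, which requires \<theta> < 1 + \<nu>. Hence \<theta> is
  capped at 1 + \<nu> / 2. The rate does not suffer: above 1 the size of the barrier depends on
  \<theta> only through a constant, and the cap never changes the side of 1 on which \<theta>
  lies.\<close>

lemma powr_ratio_bounds:
  fixes x y e L :: real
  assumes "0 < x" "0 < y" "L \<ge> 1" "x \<le> L * y" "y \<le> L * x"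
  shows "x powr e \<le> L powr \<bar>e\<bar> * y powr e"
proof (cases "e \<ge> 0")
  case True
  have "x powr e \<le> (L * y) powr e" using assms True by (intro powr_mono2) auto
  then show ?thesis using assms True by (simp add: powr_mult)
next
  case False
  have "(L * x) powr e \<le> y powr e" using assms False by (intro powr_mono2') auto
  then have "L powr e * x powr e \<le> y powr e" using assms by (simp add: powr_mult)
  then have "L powr (-e) * (L powr e * x powr e) \<le> L powr (-e) * y powr e"
    by (intro mult_left_mono) auto
  moreover have "L powr (-e) * L powr e = 1" using assms by (simp flip: powr_add)
  ultimately show ?thesis using False by (simp add: mult.assoc[symmetric])
qed

text \<open>All points of \<open>[x, y]\<close> lie within a factor \<open>L\<close> of each other,
  so the mean value theorem compares the exact increment with the one-point quadrature at any
  \<open>z\<close>. Both directions serve to trade mesh sums for integrals and back. The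
  antiderivative is abstract so that \<open>ln\<close> covers \<open>e = -1\<close>.\<close>

lemma powr_antiderivative_bounds:
  fixes x y z e L :: real and F :: "real \<Rightarrow> real"
  assumes xy: "0 < x" "x \<le> y" "y \<le> L * x" and L: "L \<ge> 1" and z: "x \<le> z" "z \<le> y"
    and F: "\<And>s. x \<le> s \<Longrightarrow> s \<le> y \<Longrightarrow> (F has_real_derivative s powr e) (at s)"
  shows "(y - x) * z powr e \<le> L powr \<bar>e\<bar> * (F y - F x)"
    and "F y - F x \<le> L powr \<bar>e\<bar> * ((y - x) * z powr e)"
proof -
  have "\<exists>\<xi>. x \<le> \<xi> \<and> \<xi> \<le> y \<and> F y - F x = (y - x) * \<xi> powr e"
  proof (cases "x = y")
    case False
    with xy have "x < y" by simp
    from MVT2[OF this F] show ?thesis by (metis less_imp_le)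
  qed (use z in auto)
  then obtain \<xi> where \<xi>: "x \<le> \<xi>" "\<xi> \<le> y" "F y - F x = (y - x) * \<xi> powr e" by blast
  have Lx: "L * x \<le> L * \<xi>" "L * x \<le> L * z" using \<xi> z L by (auto intro: mult_left_mono)
  have "z powr e \<le> L powr \<bar>e\<bar> * \<xi> powr e" "\<xi> powr e \<le> L powr \<bar>e\<bar> * z powr e"
    using xy(1,3) z \<xi>(1,2) L order_trans[OF _ Lx(1)] order_trans[OF _ Lx(2)]
    by (auto intro!: powr_ratio_bounds elim: order_trans)
  then show "(y - x) * z powr e \<le> L powr \<bar>e\<bar> * (F y - F x)"
    and "F y - F x \<le> L powr \<bar>e\<bar> * ((y - x) * z powr e)"
    using xy unfolding \<xi>(3) by (metis diff_ge_0_iff_ge mult.left_commute mult_left_mono)+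
qed

lemma has_real_derivative_powr_div:
  fixes e s :: real
  assumes "e \<noteq> -1" "s > 0"
  shows "((\<lambda>s. s powr (e + 1) / (e + 1)) has_real_derivative s powr e) (at s)"
  using assms by (auto intro!: derivative_eq_intros)

lemma powr_diff_bounds:
  fixes x y z e L :: real
  assumes "0 < x" "x \<le> y" "y \<le> L * x" "L \<ge> 1" "x \<le> z" "z \<le> y" "e \<noteq> -1"
  shows "(y - x) * z powr e \<le> L powr \<bar>e\<bar> * (y powr (e + 1) / (e + 1) - x powr (e + 1) / (e + 1))"
    and "y powr (e + 1) / (e + 1) - x powr (e + 1) / (e + 1) \<le> L powr \<bar>e\<bar> * ((y - x) * z powr e)"
  using powr_antiderivative_bounds[OF assms(1-6), of "\<lambda>s. s powr (e + 1) / (e + 1)" e]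
    has_real_derivative_powr_div[OF assms(7)] assms(1) by auto

text \<open>The weighted arithmetic-geometric mean inequality for the numbers 1 and
  \<open>1 - x\<close> with weights \<alpha> and \<open>1 - \<alpha>\<close>.\<close>

lemma powr_bernoulli:
  fixes x \<alpha> :: real
  assumes "0 \<le> x" "x \<le> 1" "0 < \<alpha>" "\<alpha> < 1"
  shows "(1 - x) powr (1 - \<alpha>) \<le> 1 - (1 - \<alpha>) * x"
  using Youngs_inequality_0[of \<alpha> "1 - \<alpha>" 1 "1 - x"] assms
  by (cases "x = 1") (auto simp: algebra_simps)

text \<open>The step bound is the quasi-graded one,
  \<open>t 1 powr (1 / r) * t j powr (1 - 1 / r)\<close>, in homogeneous form: later estimates
  become powers of \<open>t 1 / t m\<close> times powers of \<open>t m\<close>. It refers to the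
  left end of the interval, which at once bounds the ratio of consecutive points by
  \<open>1 + c\<close>. The first step \<open>t 1\<close> is free and sets the scale.\<close>

locale fine_mesh =
  fixes \<alpha> r c :: real and N :: nat and t :: "nat \<Rightarrow> real"
  assumes \<alpha>: "0 < \<alpha>" "\<alpha> < 1" and r: "1 \<le> r" and c: "0 < c" and N: "1 \<le> N"
    and t_0: "t 0 = 0" and t_less_Suc: "j < N \<Longrightarrow> t j < t (Suc j)"
    and step_le: "1 \<le> j \<Longrightarrow> j < N \<Longrightarrow> t (Suc j) - t j \<le> c * (t j * (t 1 / t j) powr (1 / r))"
begin

lemma t_less: "i < j \<Longrightarrow> j \<le> N \<Longrightarrow> t i < t j"
proof (induction j)
  case (Suc j)
  then show ?case using t_less_Suc[of j] by (cases "i = j") (auto intro: less_trans)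
qed simp

lemma t_le: "i \<le> j \<Longrightarrow> j \<le> N \<Longrightarrow> t i \<le> t j"
  using t_less[of i j] by (cases "i = j") auto

lemma t_pos: "1 \<le> j \<Longrightarrow> j \<le> N \<Longrightarrow> 0 < t j"
  using t_less[of 0 j] t_0 by auto

lemma t_1_le: "1 \<le> j \<Longrightarrow> j \<le> N \<Longrightarrow> t 1 \<le> t j"
  by (rule t_le)

lemma t_1_pos: "0 < t 1" using t_pos[of 1] N by simp

lemma t_Suc_le:
  assumes "1 \<le> j" "j < N" shows "t (Suc j) \<le> (1 + c) * t j"
proof -
  have "(t 1 / t j) powr (1 / r) \<le> 1"
    using t_1_le[of j] t_1_pos assms r by (intro powr_le1) auto
  then have "t j * (t 1 / t j) powr (1 / r) \<le> t j * 1"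
    using t_pos[of j] assms by (intro mult_left_mono) auto
  then have "c * (t j * (t 1 / t j) powr (1 / r)) \<le> c * t j"
    using c by simp
  with step_le[OF assms] show ?thesis by (simp add: algebra_simps)
qed

definition ker_int :: "nat \<Rightarrow> nat \<Rightarrow> real" where
  "ker_int m j = ((t m - t j) powr (1 - \<alpha>) - (t m - t (Suc j)) powr (1 - \<alpha>)) / (1 - \<alpha>)"

definition ker_avg :: "nat \<Rightarrow> nat \<Rightarrow> real" where
  "ker_avg m j = ker_int m j / (t (Suc j) - t j)"

text \<open>An upper bound for the integral, over interval \<open>j\<close>, of the positive part of
  \<open>ker_avg m j\<close> minus the kernel. Away from the singularity the increment of the kernel
  is the better bound. On the last interval the kernel blows up, while
  \<open>0 powr (-\<alpha>)\<close> is 0 by convention, hence the case distinction.\<close>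

definition ker_osc :: "nat \<Rightarrow> nat \<Rightarrow> real" where
  "ker_osc m j = (if Suc j < m then min (ker_int m j)
      ((t (Suc j) - t j) * ((t m - t (Suc j)) powr (-\<alpha>) - (t m - t j) powr (-\<alpha>))) else ker_int m j)"

lemma ker_int_pos: "j < m \<Longrightarrow> m \<le> N \<Longrightarrow> 0 < ker_int m j"
  unfolding ker_int_def using \<alpha> t_less_Suc[of j] t_le[of "Suc j" m]
  by (intro divide_pos_pos) (auto intro!: powr_less_mono2)

lemma ker_osc_pos:
  assumes "j < m" "m \<le> N" shows "0 < ker_osc m j"
proof (cases "Suc j < m")
  case True
  have "t j < t (Suc j)" "t (Suc j) < t m" using t_less_Suc[of j] t_less[of "Suc j" m] assms True by auto
  then have "(t m - t j) powr (-\<alpha>) < (t m - t (Suc j)) powr (-\<alpha>)"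
    using \<alpha> by (intro powr_less_mono2_neg) auto
  then show ?thesis using True t_less_Suc[of j] ker_int_pos[of j m] assms
    by (auto simp: ker_osc_def)
qed (use ker_int_pos[of j m] assms in \<open>auto simp: ker_osc_def\<close>)

lemma ker_osc_nonneg: "j < m \<Longrightarrow> m \<le> N \<Longrightarrow> 0 \<le> ker_osc m j"
  using ker_osc_pos by (simp add: less_imp_le)

text \<open>Far from \<open>t m\<close> the increments of the kernel telescope; near
  \<open>t m\<close> the integrals of the kernel do. The potential \<open>\<Phi>\<close> does both
  at once: its two parts are nondecreasing in \<open>s\<close>, the first is frozen within distance
  \<open>H\<close> of \<open>t m\<close>, the second beyond distance \<open>2 * H\<close>.\<close>

lemma sum_ker_osc_le:
  assumes m: "1 \<le> m" "m \<le> N" and H: "0 < H" "\<And>j. 1 \<le> j \<Longrightarrow> j < m \<Longrightarrow> t (Suc j) - t j \<le> H"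
  shows "(\<Sum>j\<in>{1..<m}. ker_osc m j) \<le> (1 + 2 / (1 - \<alpha>)) * H powr (1 - \<alpha>)"
proof -
  define \<Phi> where "\<Phi> s = H * (max (t m - s) H) powr (-\<alpha>) - (min (t m - s) (2 * H)) powr (1 - \<alpha>) / (1 - \<alpha>)" for s
  have term_le: "ker_osc m j \<le> \<Phi> (t (Suc j)) - \<Phi> (t j)" if j: "1 \<le> j" "j < m" for j
  proof -
    have tj: "t j < t (Suc j)" "t (Suc j) \<le> t m" "t (Suc j) - t j \<le> H"
      using t_less_Suc[of j] t_le[of "Suc j" m] H(2)[of j] j m by auto
    have m1: "(max (t m - t j) H) powr (-\<alpha>) \<le> (max (t m - t (Suc j)) H) powr (-\<alpha>)"
      using tj H \<alpha> by (intro powr_mono2') auto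
    have m2: "(min (t m - t (Suc j)) (2 * H)) powr (1 - \<alpha>) / (1 - \<alpha>)
       \<le> (min (t m - t j) (2 * H)) powr (1 - \<alpha>) / (1 - \<alpha>)"
      using tj H \<alpha> by (intro divide_right_mono powr_mono2) auto
    show ?thesis
    proof (cases "t (Suc j) \<le> t m - H")
      case True
      then have "Suc j < m" using H j by (cases "Suc j = m") auto
      then have "ker_osc m j \<le> (t (Suc j) - t j) * ((t m - t (Suc j)) powr (-\<alpha>) - (t m - t j) powr (-\<alpha>))"
        by (simp add: ker_osc_def)
      also have "\<dots> \<le> H * ((t m - t (Suc j)) powr (-\<alpha>) - (t m - t j) powr (-\<alpha>))"
        using tj H True \<alpha> by (intro mult_right_mono) (auto intro!: powr_mono2')
      also have "\<dots> = H * ((max (t m - t (Suc j)) H) powr (-\<alpha>) - (max (t m - t j) H) powr (-\<alpha>))"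
        using True tj by (simp add: max_absorb1)
      finally show ?thesis using m2 by (simp add: \<Phi>_def algebra_simps)
    next
      \<comment> \<open>The right end is within \<open>H\<close> of \<open>t m\<close> and the step
        is at most \<open>H\<close>, so the cut-off at \<open>2 * H\<close> is inactive at both
        ends.\<close>
      case False
      have "ker_osc m j \<le> ker_int m j" by (simp add: ker_osc_def)
      also have "\<dots> = (min (t m - t j) (2 * H)) powr (1 - \<alpha>) / (1 - \<alpha>) -
         (min (t m - t (Suc j)) (2 * H)) powr (1 - \<alpha>) / (1 - \<alpha>)"
        using False tj H by (simp add: ker_int_def min_def diff_divide_distrib)
      moreover have "H * (max (t m - t j) H) powr (-\<alpha>) \<le> H * (max (t m - t (Suc j)) H) powr (-\<alpha>)"
        using m1 H by simp
      ultimately show ?thesis by (simp add: \<Phi>_def)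
    qed
  qed
  have "(\<Sum>j\<in>{1..<m}. ker_osc m j) \<le> (\<Sum>j\<in>{1..<m}. \<Phi> (t (Suc j)) - \<Phi> (t j))"
    using term_le by (intro sum_mono) auto
  also have "\<dots> = \<Phi> (t m) - \<Phi> (t 1)"
    using m by (subst sum_Suc_diff'[of 1 m "\<lambda>j. \<Phi> (t j)"]) auto
  also have "\<dots> \<le> H * H powr (-\<alpha>) + (2 * H) powr (1 - \<alpha>) / (1 - \<alpha>)"
  proof -
    have "(min (t m - t 1) (2 * H)) powr (1 - \<alpha>) / (1 - \<alpha>) \<le> (2 * H) powr (1 - \<alpha>) / (1 - \<alpha>)"
      using t_1_le[of m] m H \<alpha> by (intro divide_right_mono powr_mono2) auto
    moreover have "0 \<le> H * (max (t m - t 1) H) powr (-\<alpha>)" using H by simp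
    moreover have "\<Phi> (t m) = H * H powr (-\<alpha>)" using H(1) \<alpha> by (simp add: \<Phi>_def)
    ultimately show ?thesis unfolding \<Phi>_def[of "t 1"] by linarith
  qed
  also have "\<dots> \<le> H powr (1 - \<alpha>) + (2 * H powr (1 - \<alpha>)) / (1 - \<alpha>)"
  proof -
    have "H * H powr (-\<alpha>) = H powr (1 - \<alpha>)" using H by (simp add: powr_diff powr_minus divide_simps)
    moreover have "(2 * H) powr (1 - \<alpha>) = 2 powr (1 - \<alpha>) * H powr (1 - \<alpha>)" using H by (simp add: powr_mult)
    moreover have "(2::real) powr (1 - \<alpha>) \<le> 2 powr 1" using \<alpha> by (intro powr_mono) auto
    ultimately show ?thesis using \<alpha> by (auto intro!: divide_right_mono mult_right_mono)
  qed
  finally show ?thesis by (simp add: algebra_simps)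
qed

end

lemma (in fine_mesh) ker_osc_far:
  assumes j: "1 \<le> j" "j < m" "m \<le> N" "t (Suc j) \<le> t m / 2"
  shows "ker_osc m j \<le> (t (Suc j) - t j)\<^sup>2 * (\<alpha> * (t m / 2) powr (-\<alpha> - 1))"
proof -
  have tm: "0 < t m" using t_pos[of m] j by auto
  have tj: "t j < t (Suc j)" using t_less_Suc[of j] j by auto
  have "Suc j < m" using j tm by (cases "Suc j = m") auto
  then have "ker_osc m j \<le> (t (Suc j) - t j) * ((t m - t (Suc j)) powr (-\<alpha>) - (t m - t j) powr (-\<alpha>))"
    by (simp add: ker_osc_def)
  also have "(t m - t (Suc j)) powr (-\<alpha>) - (t m - t j) powr (-\<alpha>) \<le> (t (Suc j) - t j) * (\<alpha> * (t m / 2) powr (-\<alpha> - 1))"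
  proof -
    have "\<exists>\<xi>>t j. \<xi> < t (Suc j) \<and> (t m - t (Suc j)) powr (-\<alpha>) - (t m - t j) powr (-\<alpha>)
        = (t (Suc j) - t j) * (\<alpha> * (t m - \<xi>) powr (-\<alpha> - 1))"
      by (rule MVT2[where f = "\<lambda>s. (t m - s) powr (-\<alpha>)"])
        (use j tm tj in \<open>auto intro!: derivative_eq_intros\<close>)
    then obtain \<xi> where \<xi>: "t j < \<xi>" "\<xi> < t (Suc j)"
      "(t m - t (Suc j)) powr (-\<alpha>) - (t m - t j) powr (-\<alpha>) = (t (Suc j) - t j) * (\<alpha> * (t m - \<xi>) powr (-\<alpha> - 1))"
      by blast
    have "(t m - \<xi>) powr (-\<alpha> - 1) \<le> (t m / 2) powr (-\<alpha> - 1)"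
      using \<xi> j tm \<alpha> by (intro powr_mono2') auto
    then show ?thesis unfolding \<xi>(3) using tj \<alpha> by (intro mult_left_mono) auto
  qed
  finally show ?thesis using tj by (simp add: power2_eq_square mult.assoc)
qed

text \<open>As r >= 1, the power \<open>s powr (1 - 1 / r)\<close> is nondecreasing, so the bound at
  \<open>t m\<close> can serve as the uniform step size in \<open>sum_ker_osc_le\<close>.\<close>

lemma (in fine_mesh) step_le_global:
  assumes "1 \<le> j" "j < m" "m \<le> N"
  shows "t (Suc j) - t j \<le> c * (t m * (t 1 / t m) powr (1 / r))"
proof -
  have tj: "0 < t j" "t j \<le> t m" "0 < t 1" using t_pos[of j] t_le[of j m] t_1_pos assms by auto
  have eq: "s * (t 1 / s) powr (1 / r) = t 1 powr (1 / r) * s powr (1 - 1 / r)" if "0 < s" for s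
    using that tj by (simp add: powr_divide powr_diff)
  have "t j powr (1 - 1 / r) \<le> t m powr (1 - 1 / r)"
    using tj r by (intro powr_mono2) auto
  then have "c * (t j * (t 1 / t j) powr (1 / r)) \<le> c * (t m * (t 1 / t m) powr (1 / r))"
    using tj c eq[of "t j"] eq[of "t m"] by (auto intro!: mult_left_mono)
  then show ?thesis using step_le[of j] assms by auto
qed

text \<open>Used with \<mu> = \<alpha> for the truncation error and with \<mu> = \<alpha> - 1 for
  the discretization error of the barriers. Intervals ending beyond \<open>t m / 2\<close> see a
  weight comparable to its value at \<open>t m\<close>, and the global step bound produces the
  exponent \<open>(2 - \<alpha>) / r\<close>. On the others \<open>ker_osc\<close> is quadratic in
  the step, which would even allow \<open>2 / r\<close>; there the sum is compared with the integral
  of \<open>s powr (\<mu> - \<nu>)\<close>, which is controlled by its upper limit because \<nu> <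
  \<mu> + 1.\<close>

lemma sum_ker_osc_weighted:
  fixes \<alpha> r c \<mu> \<nu> :: real
  assumes \<nu>: "0 \<le> \<nu>" "\<nu> \<le> (2 - \<alpha>) / r" "\<nu> < \<mu> + 1" and \<alpha>: "0 < \<alpha>" "\<alpha> < 1" and r: "1 \<le> r" and c: "0 < c"
  shows "\<exists>C>0. \<forall>N t m. fine_mesh \<alpha> r c N t \<longrightarrow> m \<in> {1..N} \<longrightarrow>
    (\<Sum>j\<in>{1..<m}. (t (Suc j) - t j) * t j powr (\<mu> - 2) * fine_mesh.ker_osc \<alpha> t m j)
      \<le> C * (t m powr (\<mu> - \<alpha>) * (t 1 / t m) powr \<nu>)"
proof -
  define D1 where "D1 = (2 * (1 + c)) powr \<bar>\<mu> - 2\<bar> * c * ((1 + 2 / (1 - \<alpha>)) * c powr (1 - \<alpha>))"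
  define D2 where "D2 = c\<^sup>2 * \<alpha> * 2 powr (\<alpha> + 1) * (1 + c) powr \<bar>\<mu> - \<nu>\<bar> / (\<mu> - \<nu> + 1)"
  have D: "0 \<le> D1" "0 \<le> D2" using assms by (auto simp: D1_def D2_def)
  show ?thesis
  proof (intro exI[of _ "D1 + D2 + 1"] conjI allI impI)
    show "0 < D1 + D2 + 1" using D by simp
    fix N t m assume "fine_mesh \<alpha> r c N t" and m: "m \<in> {1..N}"
    then interpret fine_mesh \<alpha> r c N t by simp
    have t1: "0 < t 1" by (rule t_1_pos)
    have tm: "0 < t m" "t 1 \<le> t m" using t_pos[of m] t_1_le[of m] m by auto
    define x where "x = t 1 / t m"
    have x: "0 < x" "x \<le> 1" using t1 tm by (auto simp: x_def)
    define H where "H = t m * x powr (1 / r)"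
    have H: "0 < H" using tm x by (simp add: H_def)
    define near where "near j = (2 * (1 + c)) powr \<bar>\<mu> - 2\<bar> * t m powr (\<mu> - 2) * (c * H) * ker_osc m j" for j
    define far where "far j = c\<^sup>2 * \<alpha> * 2 powr (\<alpha> + 1) * (1 + c) powr \<bar>\<mu> - \<nu>\<bar> * t m powr (-\<alpha> - 1) * t 1 powr \<nu>
         * (t (Suc j) powr (\<mu> - \<nu> + 1) / (\<mu> - \<nu> + 1) - t j powr (\<mu> - \<nu> + 1) / (\<mu> - \<nu> + 1))" for j
    have term_le: "(t (Suc j) - t j) * t j powr (\<mu> - 2) * ker_osc m j \<le> near j + far j" if j: "j \<in> {1..<m}" for j
    proof -
      have tj: "0 < t j" "t j < t (Suc j)" "t (Suc j) \<le> (1 + c) * t j" "t 1 \<le> t j" "t j \<le> t m"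
        using t_pos[of j] t_less_Suc[of j] t_Suc_le[of j] t_1_le[of j] t_le[of j m] j m by auto
      have ko: "0 \<le> ker_osc m j" using ker_osc_nonneg[of j m] j m by auto
      have hH: "t (Suc j) - t j \<le> c * H" using step_le_global[of j m] j m by (auto simp: H_def x_def)
      have near0: "0 \<le> near j" using ko c H by (simp add: near_def)
      have "t j powr (\<mu> - \<nu> + 1) \<le> t (Suc j) powr (\<mu> - \<nu> + 1)"
        using tj \<nu> by (intro powr_mono2) auto
      then have far0: "0 \<le> far j"
        using \<alpha> \<nu> by (auto simp: far_def intro!: mult_nonneg_nonneg divide_right_mono)
      show ?thesis
      proof (cases "t (Suc j) \<le> t m / 2")
        case True
        have "ker_osc m j \<le> (t (Suc j) - t j)\<^sup>2 * (\<alpha> * (t m / 2) powr (-\<alpha> - 1))"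
          using ker_osc_far[of j m] True j m by auto
        also have "\<dots> \<le> (c * (t j * (t 1 / t j) powr (1 / r)))\<^sup>2 * (\<alpha> * (t m / 2) powr (-\<alpha> - 1))"
          using step_le[of j] tj j m \<alpha> by (intro mult_right_mono power_mono) auto
        also have "(c * (t j * (t 1 / t j) powr (1 / r)))\<^sup>2 = c\<^sup>2 * (t j)\<^sup>2 * (t 1 / t j) powr (2 / r)"
          by (simp add: power_mult_distrib) (simp add: power2_eq_square flip: powr_add add_divide_distrib)
        also have "\<dots> * (\<alpha> * (t m / 2) powr (-\<alpha> - 1)) \<le> c\<^sup>2 * (t j)\<^sup>2 * (t 1 / t j) powr \<nu> * (\<alpha> * (t m / 2) powr (-\<alpha> - 1))"
        proof -
          have "\<nu> \<le> 2 / r" using \<nu>(2) \<alpha> r by (smt (verit) divide_right_mono)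
          then have "(t 1 / t j) powr (2 / r) \<le> (t 1 / t j) powr \<nu>"
            using t1 tj by (intro powr_mono') auto
          then show ?thesis using \<alpha> c by (intro mult_right_mono mult_left_mono) auto
        qed
        finally have "ker_osc m j \<le> c\<^sup>2 * (t j)\<^sup>2 * (t 1 / t j) powr \<nu> * (\<alpha> * (t m / 2) powr (-\<alpha> - 1))" .
        then have "(t (Suc j) - t j) * t j powr (\<mu> - 2) * ker_osc m j \<le>
           (t (Suc j) - t j) * t j powr (\<mu> - 2) * (c\<^sup>2 * (t j)\<^sup>2 * (t 1 / t j) powr \<nu> * (\<alpha> * (t m / 2) powr (-\<alpha> - 1)))"
          using tj by (intro mult_left_mono) auto
        also have "\<dots> = c\<^sup>2 * \<alpha> * (t m / 2) powr (-\<alpha> - 1) * t 1 powr \<nu> * ((t (Suc j) - t j) * t j powr (\<mu> - \<nu>))"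
        proof -
          have "t j powr (\<mu> - 2) * (t j)\<^sup>2 * (t 1 / t j) powr \<nu> = t 1 powr \<nu> * t j powr (\<mu> - \<nu>)"
            using tj t1 by (simp add: powr_divide powr_diff powr_numeral)
          note eq = this
          have "(t (Suc j) - t j) * t j powr (\<mu> - 2) * (c\<^sup>2 * (t j)\<^sup>2 * (t 1 / t j) powr \<nu> * (\<alpha> * (t m / 2) powr (-\<alpha> - 1)))
            = c\<^sup>2 * \<alpha> * (t m / 2) powr (-\<alpha> - 1) * (t (Suc j) - t j) * (t j powr (\<mu> - 2) * (t j)\<^sup>2 * (t 1 / t j) powr \<nu>)"
            by (simp only: mult_ac)
          then show ?thesis unfolding eq by (simp only: mult_ac)
        qed
        also have "(t m / 2) powr (-\<alpha> - 1) = 2 powr (\<alpha> + 1) * t m powr (-\<alpha> - 1)"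
        proof -
          have "(t m / 2) powr (-\<alpha> - 1) = t m powr (-\<alpha> - 1) / 2 powr (-(\<alpha> + 1))" using tm by (simp add: powr_divide)
          then show ?thesis by (simp only: powr_minus) (simp add: field_simps)
        qed
        also have "c\<^sup>2 * \<alpha> * (2 powr (\<alpha> + 1) * t m powr (-\<alpha> - 1)) * t 1 powr \<nu> * ((t (Suc j) - t j) * t j powr (\<mu> - \<nu>))
          \<le> c\<^sup>2 * \<alpha> * (2 powr (\<alpha> + 1) * t m powr (-\<alpha> - 1)) * t 1 powr \<nu> * ((1 + c) powr \<bar>\<mu> - \<nu>\<bar> *
             (t (Suc j) powr (\<mu> - \<nu> + 1) / (\<mu> - \<nu> + 1) - t j powr (\<mu> - \<nu> + 1) / (\<mu> - \<nu> + 1)))"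
          using powr_diff_bounds(1)[of "t j" "t (Suc j)" "1 + c" "t j" "\<mu> - \<nu>"] tj c \<alpha> \<nu>
          by (intro mult_left_mono) auto
        also have "\<dots> = far j" by (simp add: far_def mult_ac)
        finally show ?thesis using near0 by simp
      next
        case False
        then have "t m \<le> 2 * (1 + c) * t j" using tj by (simp add: algebra_simps)
        moreover have "t j \<le> 2 * (1 + c) * t m" using tj tm c by (smt (verit) mult_less_cancel_right2 mult_nonneg_nonneg)
        ultimately have "t j powr (\<mu> - 2) \<le> (2 * (1 + c)) powr \<bar>\<mu> - 2\<bar> * t m powr (\<mu> - 2)"
          using tj tm c by (intro powr_ratio_bounds) auto
        then have "(t (Suc j) - t j) * t j powr (\<mu> - 2) * ker_osc m j \<le>
           (c * H) * ((2 * (1 + c)) powr \<bar>\<mu> - 2\<bar> * t m powr (\<mu> - 2)) * ker_osc m j"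
          using hH ko c H by (intro mult_right_mono mult_mono) auto
        also have "\<dots> = near j" by (simp add: near_def mult_ac)
        finally show ?thesis using far0 by simp
      qed
    qed
    have "(\<Sum>j\<in>{1..<m}. (t (Suc j) - t j) * t j powr (\<mu> - 2) * ker_osc m j) \<le> sum near {1..<m} + sum far {1..<m}"
      unfolding sum.distrib[symmetric] by (intro sum_mono term_le)
    also have "sum near {1..<m} \<le> D1 * (t m powr (\<mu> - \<alpha>) * x powr \<nu>)"
    proof -
      have "sum near {1..<m} = (2 * (1 + c)) powr \<bar>\<mu> - 2\<bar> * t m powr (\<mu> - 2) * (c * H) * (\<Sum>j\<in>{1..<m}. ker_osc m j)"
        by (simp add: near_def sum_distrib_left)
      also have "\<dots> \<le> (2 * (1 + c)) powr \<bar>\<mu> - 2\<bar> * t m powr (\<mu> - 2) * (c * H) * ((1 + 2 / (1 - \<alpha>)) * (c * H) powr (1 - \<alpha>))"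
        using sum_ker_osc_le[of m "c * H"] step_le_global[of _ m] m c H
        by (intro mult_left_mono) (auto simp: H_def x_def)
      also have "\<dots> = D1 * (t m powr (\<mu> - 2) * (H * H powr (1 - \<alpha>)))"
        using c H by (simp add: D1_def powr_mult mult_ac)
      also have "H * H powr (1 - \<alpha>) = H powr (2 - \<alpha>)" using H by (simp add: powr_diff power2_eq_square)
      also have "\<dots> = t m powr (2 - \<alpha>) * x powr ((2 - \<alpha>) / r)"
        using tm x by (simp add: H_def powr_mult powr_powr)
      also have "t m powr (\<mu> - 2) * (t m powr (2 - \<alpha>) * x powr ((2 - \<alpha>) / r)) = t m powr (\<mu> - \<alpha>) * x powr ((2 - \<alpha>) / r)"
        by (simp flip: powr_add mult.assoc)
      also have "\<dots> \<le> t m powr (\<mu> - \<alpha>) * x powr \<nu>"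
        using x \<nu> by (intro mult_left_mono powr_mono') auto
      finally show ?thesis using D by (simp add: mult_left_mono)
    qed
    also have "sum far {1..<m} \<le> D2 * (t m powr (\<mu> - \<alpha>) * x powr \<nu>)"
    proof -
      define G where "G j = t j powr (\<mu> - \<nu> + 1) / (\<mu> - \<nu> + 1)" for j
      have "sum far {1..<m} = c\<^sup>2 * \<alpha> * 2 powr (\<alpha> + 1) * (1 + c) powr \<bar>\<mu> - \<nu>\<bar> * t m powr (-\<alpha> - 1) * t 1 powr \<nu> * (\<Sum>j\<in>{1..<m}. G (Suc j) - G j)"
        by (simp add: far_def sum_distrib_left G_def)
      also have "(\<Sum>j\<in>{1..<m}. G (Suc j) - G j) = G m - G 1" using m by (subst sum_Suc_diff') auto
      also have "c\<^sup>2 * \<alpha> * 2 powr (\<alpha> + 1) * (1 + c) powr \<bar>\<mu> - \<nu>\<bar> * t m powr (-\<alpha> - 1) * t 1 powr \<nu> * (G m - G 1)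
         \<le> c\<^sup>2 * \<alpha> * 2 powr (\<alpha> + 1) * (1 + c) powr \<bar>\<mu> - \<nu>\<bar> * t m powr (-\<alpha> - 1) * t 1 powr \<nu> * G m"
        using \<alpha> \<nu> by (intro mult_left_mono) (auto simp: G_def)
      also have "\<dots> = D2 * (t m powr (-\<alpha> - 1) * t m powr (\<mu> - \<nu> + 1) * t 1 powr \<nu>)"
        by (simp add: D2_def G_def)
      also have "t m powr (-\<alpha> - 1) * t m powr (\<mu> - \<nu> + 1) = t m powr (\<mu> - \<alpha>) / t m powr \<nu>"
        by (subst powr_add[symmetric], subst powr_diff[symmetric]) (simp add: algebra_simps)
      finally show ?thesis using tm t1 by (simp add: x_def powr_divide)
    qed
    also have "D1 * (t m powr (\<mu> - \<alpha>) * x powr \<nu>) + D2 * (t m powr (\<mu> - \<alpha>) * x powr \<nu>) \<le> (D1 + D2 + 1) * (t m powr (\<mu> - \<alpha>) * x powr \<nu>)"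
      by (simp add: distrib_right)
    finally show "(\<Sum>j\<in>{1..<m}. (t (Suc j) - t j) * t j powr (\<mu> - 2) * ker_osc m j) \<le> (D1 + D2 + 1) * (t m powr (\<mu> - \<alpha>) * (t 1 / t m) powr \<nu>)"
      by (simp add: x_def)
  qed
qed

section \<open>Discrete barrier functions\<close>

context fine_mesh
begin

text \<open>The branches meet at the mesh point \<open>t n\<close>, where both equal
  \<open>t n powr (\<alpha> - 1)\<close>. Every mesh interval therefore carries either a straight
  line or a pure power, never a kink in its interior.\<close>

definition barrier :: "nat \<Rightarrow> nat \<Rightarrow> real" where
  "barrier n j = (if j \<le> n then t j * t n powr (\<alpha> - 2) else t j powr (\<alpha> - 1))"

text \<open>The L1 operator without its factor \<open>1 / Gamma (1 - \<alpha>)\<close>, with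
  intervals numbered from 0; see \<open>L1_op_eq_L1_sum\<close>.\<close>

definition L1_sum :: "nat \<Rightarrow> (nat \<Rightarrow> real) \<Rightarrow> real" where
  "L1_sum m V = (\<Sum>j<m. (V (Suc j) - V j) * ker_avg m j)"

lemma sum_ker_int: "n \<le> m \<Longrightarrow> (\<Sum>j<n. ker_int m j) = (t m powr (1 - \<alpha>) - (t m - t n) powr (1 - \<alpha>)) / (1 - \<alpha>)"
  unfolding ker_int_def sum_divide_distrib[symmetric]
  using sum_lessThan_telescope'[of "\<lambda>j. (t m - t j) powr (1 - \<alpha>)" n] t_0 by simp

lemma mult_ker_avg: "j < m \<Longrightarrow> m \<le> N \<Longrightarrow> (t (Suc j) - t j) * ker_avg m j = ker_int m j"
  using t_less_Suc[of j] by (simp add: ker_avg_def)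

lemma ker_avg_pos: "j < m \<Longrightarrow> m \<le> N \<Longrightarrow> 0 < ker_avg m j"
  using t_less_Suc[of j] ker_int_pos[of j m] by (simp add: ker_avg_def)

text \<open>On the straight part all difference quotients coincide, so the kernel integrals
  telescope and no discretization error arises.\<close>

lemma sum_barrier_initial:
  assumes "n' \<le> n" "n' \<le> m" "m \<le> N"
  shows "(\<Sum>j<n'. (barrier n (Suc j) - barrier n j) * ker_avg m j) =
     t n powr (\<alpha> - 2) * ((t m powr (1 - \<alpha>) - (t m - t n') powr (1 - \<alpha>)) / (1 - \<alpha>))"
proof -
  have "(\<Sum>j<n'. (barrier n (Suc j) - barrier n j) * ker_avg m j) = (\<Sum>j<n'. t n powr (\<alpha> - 2) * ker_int m j)"
  proof (intro sum.cong refl)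
    fix j assume "j \<in> {..<n'}"
    then have "barrier n (Suc j) - barrier n j = (t (Suc j) - t j) * t n powr (\<alpha> - 2)" and "j < m" "m \<le> N"
      using assms by (auto simp: barrier_def left_diff_distrib)
    then show "(barrier n (Suc j) - barrier n j) * ker_avg m j = t n powr (\<alpha> - 2) * ker_int m j"
      using mult_ker_avg[of j m] by (simp add: mult_ac)
  qed
  then show ?thesis using sum_ker_int[of n' m] assms by (simp flip: sum_distrib_left)
qed

lemma L1_sum_barrier_le:
  assumes "1 \<le> m" "m \<le> n" "n \<le> N"
  shows "L1_sum m (barrier n) = t n powr (\<alpha> - 2) * (t m powr (1 - \<alpha>) / (1 - \<alpha>))"
  unfolding L1_sum_def using sum_barrier_initial[of m n m] assms by simp

lemma ker_avg_le:
  assumes "Suc j < m" "m \<le> N"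
  shows "ker_avg m j \<le> (t m - t (Suc j)) powr (-\<alpha>)"
proof -
  have tj: "t j < t (Suc j)" "t (Suc j) < t m" using t_less_Suc[of j] t_less[of "Suc j" m] assms by auto
  have "\<exists>\<xi>>t j. \<xi> < t (Suc j) \<and> - ((t m - t (Suc j)) powr (1 - \<alpha>)) / (1 - \<alpha>) - (- ((t m - t j) powr (1 - \<alpha>)) / (1 - \<alpha>))
        = (t (Suc j) - t j) * (t m - \<xi>) powr (-\<alpha>)"
    by (rule MVT2[where f = "\<lambda>s. - ((t m - s) powr (1 - \<alpha>)) / (1 - \<alpha>)"])
      (use tj \<alpha> in \<open>auto intro!: derivative_eq_intros\<close>)
  then obtain \<xi> where \<xi>: "t j < \<xi>" "\<xi> < t (Suc j)" "ker_int m j = (t (Suc j) - t j) * (t m - \<xi>) powr (-\<alpha>)"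
    by (auto simp: ker_int_def diff_divide_distrib)
  have "(t m - \<xi>) powr (-\<alpha>) \<le> (t m - t (Suc j)) powr (-\<alpha>)" using tj \<xi> \<alpha> by (intro powr_mono2') auto
  then show ?thesis using tj \<xi>(3) by (simp add: ker_avg_def)
qed

text \<open>This bound must include the last interval, whose right end is the singularity and
  defeats the mean value argument of \<open>ker_avg_le\<close>; \<open>powr_bernoulli\<close> covers
  that case as \<open>x = 1\<close>.\<close>

lemma ker_avg_ge:
  assumes "j < m" "m \<le> N"
  shows "(t m - t j) powr (-\<alpha>) \<le> ker_avg m j"
proof -
  have tj: "t j < t (Suc j)" "t (Suc j) \<le> t m" using t_less_Suc[of j] t_le[of "Suc j" m] assms by auto
  define x where "x = (t (Suc j) - t j) / (t m - t j)"
  have x: "0 \<le> x" "x \<le> 1" "t (Suc j) - t j = x * (t m - t j)" using tj by (auto simp: x_def)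
  have "t m - t (Suc j) = (1 - x) * (t m - t j)" using x(3) by (simp add: algebra_simps)
  then have "(t m - t (Suc j)) powr (1 - \<alpha>) = (t m - t j) powr (1 - \<alpha>) * (1 - x) powr (1 - \<alpha>)"
    using x tj by (simp add: powr_mult mult.commute)
  also have "\<dots> \<le> (t m - t j) powr (1 - \<alpha>) * (1 - (1 - \<alpha>) * x)"
    using powr_bernoulli[of x \<alpha>] x \<alpha> by (intro mult_left_mono) auto
  finally have "(t m - t j) powr (1 - \<alpha>) * x \<le> ker_int m j"
    using \<alpha> by (simp add: ker_int_def pos_le_divide_eq algebra_simps)
  moreover have "(t m - t j) powr (1 - \<alpha>) * x = (t m - t j) powr (-\<alpha>) * (t (Suc j) - t j)"
    using tj by (simp add: x_def powr_diff powr_minus divide_simps)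
  ultimately show ?thesis using tj by (simp add: ker_avg_def pos_le_divide_eq)
qed

text \<open>Only a one-sided bound is possible, since the kernel is unbounded above on the last
  interval. It suffices because the difference has mean zero.\<close>

lemma ker_avg_minus_kernel_le:
  assumes j: "j < m" "m \<le> N" and s: "t j \<le> s" "s < t (Suc j)"
  shows "ker_avg m j - (t m - s) powr (-\<alpha>) \<le> ker_osc m j / (t (Suc j) - t j)"
proof -
  define h where "h = t (Suc j) - t j"
  have tj: "0 < h" "t (Suc j) \<le> t m" using t_less_Suc[of j] t_le[of "Suc j" m] j by (auto simp: h_def)
  have ks: "0 \<le> (t m - s) powr (-\<alpha>)" by simp
  show ?thesis
  proof (cases "Suc j < m")
    case True
    have "(t m - t j) powr (-\<alpha>) \<le> (t m - s) powr (-\<alpha>)" using s tj \<alpha> by (intro powr_mono2') auto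
    with ker_avg_le[OF True] j have "ker_avg m j - (t m - s) powr (-\<alpha>) \<le> (t m - t (Suc j)) powr (-\<alpha>) - (t m - t j) powr (-\<alpha>)"
      by simp
    moreover have "ker_avg m j - (t m - s) powr (-\<alpha>) \<le> ker_int m j / h" using ks by (simp add: ker_avg_def h_def)
    ultimately show ?thesis using True tj unfolding h_def[symmetric]
      by (simp add: ker_osc_def min_def h_def[symmetric])
  next
    case False
    then show ?thesis using ks by (simp add: ker_osc_def ker_avg_def)
  qed
qed

text \<open>
  On an interval the barrier's slope varies by at most a multiple of the step, and the kernel
  minus its average integrates to zero; \<open>(t m - s) powr (1 - \<alpha>) * s powr (\<alpha> - 1) / t m\<close> is
  an antiderivative of the kernel times the slope of \<open>s powr (\<alpha> - 1)\<close>.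
\<close>

lemma L1_sum_power_interval:
  assumes j: "1 \<le> j" "j < m" "m \<le> N"
  defines "\<Psi> \<equiv> \<lambda>s. (t m - s) powr (1 - \<alpha>) * s powr (\<alpha> - 1) / t m"
  shows "\<Psi> (t (Suc j)) - \<Psi> (t j) - (1 - \<alpha>) * (2 - \<alpha>) * ((t (Suc j) - t j) * t j powr (\<alpha> - 3) * ker_osc m j)
    \<le> (t (Suc j) powr (\<alpha> - 1) - t j powr (\<alpha> - 1)) * ker_avg m j"
proof -
  have tj: "0 < t j" "t j < t (Suc j)" "t (Suc j) \<le> t m" "0 < t m"
    using t_pos[of j] t_less_Suc[of j] t_le[of "Suc j" m] t_pos[of m] j by auto
  define h where "h = t (Suc j) - t j"
  have h: "0 < h" using tj by (simp add: h_def)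
  define k where "k s = (t m - s) powr (-\<alpha>)" for s
  define A where "A = ker_avg m j"
  \<comment> \<open>The slope of \<open>s powr (\<alpha> - 1)\<close> at the right end. The slope
    increases, so \<open>p\<close> exceeds it on the whole interval; this is the sign for which the
    one-sided bound on \<open>A - k s\<close> is enough.\<close>
  define p where "p = (\<alpha> - 1) * t (Suc j) powr (\<alpha> - 2)"
  define osc where "osc = (1 - \<alpha>) * (2 - \<alpha>) * (h * t j powr (\<alpha> - 3))"
  define q where "q = ker_osc m j / h"
  have q: "0 \<le> q" using ker_osc_nonneg[of j m] j h by (simp add: q_def)
  have osc: "0 \<le> osc" using \<alpha> h by (simp add: osc_def)
  \<comment> \<open>An antiderivative of the kernel error times the slope error,
    \<open>(p - slope) * (A - k s)\<close>, minus its bound \<open>osc * q\<close>. Monotonicity of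
    \<open>G\<close> replaces integration. The bracket multiplied by \<open>p\<close> takes equal
    values at both ends, because \<open>A\<close> is the mean of the kernel.\<close>
  define G where "G s = \<Psi> s - s powr (\<alpha> - 1) * A - p * (- ((t m - s) powr (1 - \<alpha>)) / (1 - \<alpha>) - A * s) - osc * q * s" for s
  have "G (t (Suc j)) \<le> G (t j)"
  proof (rule DERIV_nonpos_imp_decreasing_open[of "t j" "t (Suc j)" G])
    show "t j \<le> t (Suc j)" using tj by simp
    have cont1: "continuous_on {t j..t (Suc j)} (\<lambda>s. (t m - s) powr (1 - \<alpha>))"
      using tj \<alpha> by (intro continuous_on_powr' continuous_on_diff continuous_on_const continuous_on_id) auto
    have cont2: "continuous_on {t j..t (Suc j)} (\<lambda>s. s powr (\<alpha> - 1))"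
      using tj by (intro continuous_on_powr continuous_on_const continuous_on_id) auto
    show "continuous_on {t j..t (Suc j)} G"
      unfolding G_def \<Psi>_def using \<alpha> tj
      by (intro cont1 cont2 continuous_on_diff continuous_on_mult continuous_on_divide continuous_on_minus
          continuous_on_const continuous_on_id) auto
    fix s assume s: "t j < s" "s < t (Suc j)"
    have s': "0 < s" "s < t m" using s tj by auto
    have der\<Psi>: "(\<Psi> has_real_derivative (\<alpha> - 1) * s powr (\<alpha> - 2) * k s) (at s)"
    proof -
      have e1: "s powr (\<alpha> - 1) = s * s powr (\<alpha> - 2)" using s' by (simp add: powr_diff power2_eq_square)
      have e2: "(t m - s) powr (1 - \<alpha>) = (t m - s) * k s" using s' by (simp add: k_def powr_diff powr_minus divide_simps)
      have "(\<Psi> has_real_derivative (- (1 - \<alpha>) * k s * s powr (\<alpha> - 1) + (t m - s) powr (1 - \<alpha>) * ((\<alpha> - 1) * s powr (\<alpha> - 2))) / t m) (at s)"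
        unfolding \<Psi>_def k_def using s' by (intro DERIV_cdivide) (auto intro!: derivative_eq_intros simp: algebra_simps)
      also have "(- (1 - \<alpha>) * k s * s powr (\<alpha> - 1) + (t m - s) powr (1 - \<alpha>) * ((\<alpha> - 1) * s powr (\<alpha> - 2))) / t m
        = (\<alpha> - 1) * s powr (\<alpha> - 2) * k s"
        unfolding e1 e2 using tj by (simp add: divide_simps) (simp add: algebra_simps)
      finally show ?thesis .
    qed
    have der\<kappa>: "((\<lambda>s. - ((t m - s) powr (1 - \<alpha>)) / (1 - \<alpha>)) has_real_derivative k s) (at s)"
      unfolding k_def using s' \<alpha> by (auto intro!: derivative_eq_intros)
    have der\<psi>: "((\<lambda>s. s powr (\<alpha> - 1)) has_real_derivative (\<alpha> - 1) * s powr (\<alpha> - 2)) (at s)"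
      using s' by (auto intro!: derivative_eq_intros)
    have "(G has_real_derivative (\<alpha> - 1) * s powr (\<alpha> - 2) * k s - (\<alpha> - 1) * s powr (\<alpha> - 2) * A - p * (k s - A) - osc * q) (at s)"
      unfolding G_def
      by (rule DERIV_cong[OF DERIV_diff[OF DERIV_diff[OF DERIV_diff[OF der\<Psi> DERIV_cmult_right[OF der\<psi>]]
            DERIV_cmult[OF DERIV_diff[OF der\<kappa> DERIV_cmult[OF DERIV_ident]]]] DERIV_cmult[OF DERIV_ident]]]) simp
    also have "(\<alpha> - 1) * s powr (\<alpha> - 2) * k s - (\<alpha> - 1) * s powr (\<alpha> - 2) * A - p * (k s - A) - osc * q =
       (p - (\<alpha> - 1) * s powr (\<alpha> - 2)) * (A - k s) - osc * q"
      by (simp add: algebra_simps)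
    finally have derG: "(G has_real_derivative (p - (\<alpha> - 1) * s powr (\<alpha> - 2)) * (A - k s) - osc * q) (at s)" .
    have slope: "0 \<le> p - (\<alpha> - 1) * s powr (\<alpha> - 2)" "p - (\<alpha> - 1) * s powr (\<alpha> - 2) \<le> osc"
    proof -
      have p_eq: "p - (\<alpha> - 1) * s powr (\<alpha> - 2) = (1 - \<alpha>) * (s powr (\<alpha> - 2) - t (Suc j) powr (\<alpha> - 2))"
        by (simp add: p_def algebra_simps)
      have "t (Suc j) powr (\<alpha> - 2) \<le> s powr (\<alpha> - 2)" using s s' \<alpha> by (intro powr_mono2') auto
      then show "0 \<le> p - (\<alpha> - 1) * s powr (\<alpha> - 2)" using \<alpha> by (simp add: p_eq)
      have "\<exists>\<xi>>s. \<xi> < t (Suc j) \<and> t (Suc j) powr (\<alpha> - 2) - s powr (\<alpha> - 2) = (t (Suc j) - s) * ((\<alpha> - 2) * \<xi> powr (\<alpha> - 3))"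
        by (rule MVT2[where f = "\<lambda>s. s powr (\<alpha> - 2)"]) (use s s' in \<open>auto intro!: derivative_eq_intros\<close>)
      then obtain \<xi> where \<xi>: "s < \<xi>" "t (Suc j) powr (\<alpha> - 2) - s powr (\<alpha> - 2) = (t (Suc j) - s) * ((\<alpha> - 2) * \<xi> powr (\<alpha> - 3))" by blast
      have "s powr (\<alpha> - 2) - t (Suc j) powr (\<alpha> - 2) = (2 - \<alpha>) * ((t (Suc j) - s) * \<xi> powr (\<alpha> - 3))"
        using \<xi>(2) by (simp add: algebra_simps)
      also have "\<dots> \<le> (2 - \<alpha>) * (h * t j powr (\<alpha> - 3))"
        using s \<xi> tj \<alpha> by (intro mult_left_mono mult_mono powr_mono2') (auto simp: h_def)
      finally show "p - (\<alpha> - 1) * s powr (\<alpha> - 2) \<le> osc"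
        using \<alpha> unfolding p_eq osc_def mult.assoc[of "1 - \<alpha>"] by (intro mult_left_mono) auto
    qed
    have Ak: "A - k s \<le> q"
      using ker_avg_minus_kernel_le[of j m s] j s by (simp add: A_def k_def q_def h_def)
    have "(p - (\<alpha> - 1) * s powr (\<alpha> - 2)) * (A - k s) \<le> osc * q"
    proof (cases "0 \<le> A - k s")
      case True
      then show ?thesis using slope Ak osc by (intro mult_mono) auto
    next
      case False
      then have "(p - (\<alpha> - 1) * s powr (\<alpha> - 2)) * (A - k s) \<le> 0" using slope by (intro mult_nonneg_nonpos) auto
      also have "0 \<le> osc * q" using osc q by simp
      finally show ?thesis .
    qed
    then show "\<exists>y. (G has_real_derivative y) (at s) \<and> y \<le> 0" using derG by force
  qed
  moreover have "- ((t m - t (Suc j)) powr (1 - \<alpha>)) / (1 - \<alpha>) - A * t (Suc j) = - ((t m - t j) powr (1 - \<alpha>)) / (1 - \<alpha>) - A * t j"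
    using mult_ker_avg[of j m] j unfolding A_def[symmetric] ker_int_def diff_divide_distrib by (simp add: algebra_simps)
  moreover have "osc * q * t (Suc j) - osc * q * t j = (1 - \<alpha>) * (2 - \<alpha>) * (h * t j powr (\<alpha> - 3) * ker_osc m j)"
    using h by (simp add: osc_def q_def h_def right_diff_distrib[symmetric])
  ultimately show ?thesis
    unfolding G_def A_def[symmetric] h_def[symmetric] by (simp add: left_diff_distrib)
qed

text \<open>The straight part contributes at least
  \<open>t n powr (\<alpha> - 1) * t m powr (-\<alpha>)\<close>. The power part contributes minus
  the same quantity times \<open>(1 - x) powr (1 - \<alpha>)\<close>, up to the error sum, with
  \<open>x = t n / t m\<close>. The leading terms cancel, and by \<open>powr_bernoulli\<close> a
  fraction \<open>(1 - \<alpha>) * x\<close> remains.\<close>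

lemma L1_sum_barrier_gt:
  assumes n: "1 \<le> n" "n < m" "m \<le> N"
  shows "(1 - \<alpha>) * (t n powr \<alpha> * t m powr (-\<alpha> - 1)) -
      (1 - \<alpha>) * (2 - \<alpha>) * (\<Sum>j\<in>{1..<m}. (t (Suc j) - t j) * t j powr (\<alpha> - 3) * ker_osc m j) \<le> L1_sum m (barrier n)"
proof -
  have tn: "0 < t n" "t n < t m" using t_pos[of n] t_less[of n m] n by auto
  define x where "x = t n / t m"
  have x: "0 < x" "x < 1" "t n = x * t m" using tn by (auto simp: x_def)
  define \<Psi> where "\<Psi> s = (t m - s) powr (1 - \<alpha>) * s powr (\<alpha> - 1) / t m" for s
  define err where "err j = (1 - \<alpha>) * (2 - \<alpha>) * ((t (Suc j) - t j) * t j powr (\<alpha> - 3) * ker_osc m j)" for j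
  have errnn: "0 \<le> err j" if "j < m" for j
    using that t_less_Suc[of j] ker_osc_nonneg[of j m] n \<alpha> by (auto simp: err_def intro!: mult_nonneg_nonneg)
  have e: "(t m - t n) powr (1 - \<alpha>) = t m powr (1 - \<alpha>) * (1 - x) powr (1 - \<alpha>)"
    using x tn by (simp add: algebra_simps flip: powr_mult)
  have bern: "(1 - x) powr (1 - \<alpha>) \<le> 1 - (1 - \<alpha>) * x" using powr_bernoulli[of x \<alpha>] x \<alpha> by simp
  have split: "L1_sum m (barrier n) = (\<Sum>j<n. (barrier n (Suc j) - barrier n j) * ker_avg m j)
      + (\<Sum>j\<in>{n..<m}. (barrier n (Suc j) - barrier n j) * ker_avg m j)"
    unfolding L1_sum_def using n by (subst sum.union_disjoint[symmetric]) (auto intro!: sum.cong)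
  have first: "t n powr (\<alpha> - 1) * t m powr (-\<alpha>) \<le> (\<Sum>j<n. (barrier n (Suc j) - barrier n j) * ker_avg m j)"
  proof -
    have "t m powr (1 - \<alpha>) * ((1 - \<alpha>) * x) \<le> t m powr (1 - \<alpha>) * (1 - (1 - x) powr (1 - \<alpha>))"
      using bern by (intro mult_left_mono) auto
    then have "t m powr (1 - \<alpha>) * x \<le> (t m powr (1 - \<alpha>) - (t m - t n) powr (1 - \<alpha>)) / (1 - \<alpha>)"
      unfolding e using \<alpha> by (simp add: pos_le_divide_eq algebra_simps)
    then have "t n powr (\<alpha> - 2) * (t m powr (1 - \<alpha>) * x) \<le>
       t n powr (\<alpha> - 2) * ((t m powr (1 - \<alpha>) - (t m - t n) powr (1 - \<alpha>)) / (1 - \<alpha>))"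
      by (rule mult_left_mono) simp
    moreover have "t n powr (\<alpha> - 2) * (t m powr (1 - \<alpha>) * x) = t n powr (\<alpha> - 1) * t m powr (-\<alpha>)"
      using tn by (simp add: x_def powr_diff powr_minus power2_eq_square divide_simps)
    ultimately show ?thesis using sum_barrier_initial[of n n m] n by simp
  qed
  have second: "\<Psi> (t m) - \<Psi> (t n) - sum err {n..<m} \<le> (\<Sum>j\<in>{n..<m}. (barrier n (Suc j) - barrier n j) * ker_avg m j)"
  proof -
    have "\<Psi> (t m) - \<Psi> (t n) = (\<Sum>j\<in>{n..<m}. \<Psi> (t (Suc j)) - \<Psi> (t j))"
      using n by (subst sum_Suc_diff') auto
    then have "\<Psi> (t m) - \<Psi> (t n) - sum err {n..<m} = (\<Sum>j\<in>{n..<m}. \<Psi> (t (Suc j)) - \<Psi> (t j) - err j)"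
      by (simp add: sum_subtractf)
    also have "\<dots> \<le> (\<Sum>j\<in>{n..<m}. (barrier n (Suc j) - barrier n j) * ker_avg m j)"
    proof (rule sum_mono)
      fix j assume j: "j \<in> {n..<m}"
      have "barrier n j = t j powr (\<alpha> - 1)" "barrier n (Suc j) = t (Suc j) powr (\<alpha> - 1)"
        using j tn by (auto simp: barrier_def powr_diff power2_eq_square)
      then show "\<Psi> (t (Suc j)) - \<Psi> (t j) - err j \<le> (barrier n (Suc j) - barrier n j) * ker_avg m j"
        using L1_sum_power_interval[of j m] j n by (simp add: \<Psi>_def err_def)
    qed
    finally show ?thesis .
  qed
  have \<Psi>n: "\<Psi> (t n) \<le> t n powr (\<alpha> - 1) * t m powr (-\<alpha>) * (1 - (1 - \<alpha>) * x)"
  proof -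
    have "\<Psi> (t n) = t n powr (\<alpha> - 1) * t m powr (-\<alpha>) * (1 - x) powr (1 - \<alpha>)"
      unfolding \<Psi>_def e using tn by (simp add: powr_diff powr_minus divide_simps)
    then show ?thesis using bern by (simp add: mult_left_mono)
  qed
  have "t n powr (\<alpha> - 1) * t m powr (-\<alpha>) * ((1 - \<alpha>) * x) = (1 - \<alpha>) * (t n powr \<alpha> * t m powr (-\<alpha> - 1))"
    using tn by (simp add: x_def powr_diff powr_minus divide_simps)
  moreover have "\<Psi> (t m) = 0" using \<alpha> by (simp add: \<Psi>_def)
  \<comment> \<open>The error sum is enlarged to all \<open>j\<close> from 1 on, so that its bound
    is the same for every barrier and can be taken out of the superposition.\<close>
  moreover have "sum err {n..<m} \<le> sum err {1..<m}"
    using n errnn by (intro sum_mono2) auto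
  moreover have "sum err {1..<m} = (1 - \<alpha>) * (2 - \<alpha>) * (\<Sum>j\<in>{1..<m}. (t (Suc j) - t j) * t j powr (\<alpha> - 3) * ker_osc m j)"
    by (simp add: err_def sum_distrib_left)
  moreover have "\<Psi> (t n) \<le> t n powr (\<alpha> - 1) * t m powr (-\<alpha>) - t n powr (\<alpha> - 1) * t m powr (-\<alpha>) * ((1 - \<alpha>) * x)"
    using \<Psi>n by (simp add: right_diff_distrib)
  ultimately show ?thesis using split first second by linarith
qed

end

text \<open>With \<open>x = t 1 / t m\<close>, this is the growth of
  \<open>t 1 powr (\<theta> - 1)\<close> times the integral of \<open>q powr - \<theta>\<close> from
  \<open>t 1\<close> to \<open>t m\<close>: bounded, logarithmic, or a power.\<close>

definition log_power :: "real \<Rightarrow> real \<Rightarrow> real" where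
  "log_power \<theta> x = (if \<theta> > 1 then 1 else if \<theta> = 1 then 1 - ln x else x powr (\<theta> - 1))"

lemma log_power_ge:
  assumes "0 < x" "x \<le> 1"
  shows "1 \<le> log_power \<theta> x" "x powr (\<theta> - 1) \<le> log_power \<theta> x"
proof -
  have "1 \<le> x powr (\<theta> - 1)" if "\<theta> < 1" using powr_mono'[of "\<theta> - 1" 0 x] assms that by simp
  then show "1 \<le> log_power \<theta> x" using assms by (auto simp: log_power_def)
  show "x powr (\<theta> - 1) \<le> log_power \<theta> x" using assms by (auto simp: log_power_def intro!: powr_le1)
qed

section \<open>Superpositions of barriers: their size and their L1 operator\<close>

context fine_mesh
begin

text \<open>Right-endpoint quadrature of \<open>q powr - \<theta>\<close> times the barrier
  switching at \<open>q\<close>. The first term belongs to the interval from 0 to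
  \<open>t n0\<close>, of length \<open>t n0\<close>, on which the weight is frozen at
  \<open>t n0 powr - \<theta>\<close>. The factor \<open>t 1 powr \<theta>\<close> normalizes the
  result to a multiple of \<open>(t 1 / t m) powr \<theta>\<close>.\<close>

definition comb_barrier :: "real \<Rightarrow> nat \<Rightarrow> nat \<Rightarrow> real" where
  "comb_barrier \<theta> n0 j = t 1 powr \<theta> * (t n0 powr (1 - \<theta>) * barrier n0 j +
     (\<Sum>i\<in>{n0..<N}. (t (Suc i) - t i) * t (Suc i) powr (-\<theta>) * barrier (Suc i) j))"

lemma L1_sum_cmult: "L1_sum m (\<lambda>j. a * V j) = a * L1_sum m V"
  by (simp add: L1_sum_def sum_distrib_left right_diff_distrib[symmetric] mult.assoc)

lemma L1_sum_add: "L1_sum m (\<lambda>j. V j + W j) = L1_sum m V + L1_sum m W"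
  by (simp add: L1_sum_def sum.distrib[symmetric] algebra_simps)

lemma L1_sum_sum: "finite I \<Longrightarrow> L1_sum m (\<lambda>j. \<Sum>i\<in>I. V i j) = (\<Sum>i\<in>I. L1_sum m (V i))"
proof (induction I rule: finite_induct)
  case empty
  then show ?case by (simp add: L1_sum_def)
next
  case (insert i I)
  then show ?case by (simp add: L1_sum_add)
qed

lemma L1_sum_comb_barrier:
  "L1_sum m (comb_barrier \<theta> n0) = t 1 powr \<theta> * (t n0 powr (1 - \<theta>) * L1_sum m (barrier n0) +
     (\<Sum>i\<in>{n0..<N}. (t (Suc i) - t i) * t (Suc i) powr (-\<theta>) * L1_sum m (barrier (Suc i))))"
  unfolding comb_barrier_def L1_sum_cmult L1_sum_add by (simp add: L1_sum_sum L1_sum_cmult)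

lemma barrier_le_power:
  assumes "1 \<le> m" "m \<le> N" "1 \<le> n" "n \<le> N"
  shows "barrier n m \<le> t m powr (\<alpha> - 1)"
proof (cases "m \<le> n")
  case True
  have "t n powr (\<alpha> - 2) \<le> t m powr (\<alpha> - 2)"
    using t_pos[of m] t_le[of m n] \<alpha> assms True by (intro powr_mono2') auto
  then have "t m * t n powr (\<alpha> - 2) \<le> t m * t m powr (\<alpha> - 2)"
    using t_pos[of m] assms by (intro mult_left_mono) auto
  also have "t m * t m powr (\<alpha> - 2) = t m powr (\<alpha> - 1)"
    using t_pos[of m] assms by (simp add: powr_diff power2_eq_square)
  finally show ?thesis using True by (simp add: barrier_def)
qed (simp add: barrier_def)

lemma barrier_pos: "1 \<le> m \<Longrightarrow> m \<le> N \<Longrightarrow> 1 \<le> n \<Longrightarrow> n \<le> N \<Longrightarrow> 0 < barrier n m"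
  using t_pos[of m] t_pos[of n] by (auto simp: barrier_def)

lemma comb_barrier_pos:
  assumes "1 \<le> m" "m \<le> N" "1 \<le> n0" "n0 \<le> N"
  shows "0 < comb_barrier \<theta> n0 m"
  unfolding comb_barrier_def using t_1_pos t_pos[of n0] barrier_pos[of m] assms
  by (intro mult_pos_pos add_pos_nonneg sum_nonneg mult_nonneg_nonneg) (auto simp: less_imp_le t_less_Suc)

lemma comb_barrier_0: "comb_barrier \<theta> n0 0 = 0"
  by (simp add: comb_barrier_def barrier_def t_0)

text \<open>The three summands of the constant belong to the initial term, to switch points up to
  \<open>t m\<close>, and to those beyond. Up to \<open>t m\<close> each barrier is at most
  \<open>t m powr (\<alpha> - 1)\<close> and the weights sum to \<open>log_power\<close>. Beyond
  \<open>t m\<close> the barriers are straight at \<open>t m\<close>, and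
  \<open>q powr (\<alpha> - 2 - \<theta>)\<close> has a convergent tail.\<close>

lemma comb_barrier_le:
  assumes m: "1 \<le> m" "m \<le> N" and n0: "1 \<le> n0" "n0 \<le> N" "t n0 \<le> P * t 1" and P: "1 \<le> P" and \<theta>: "0 < \<theta>"
  shows "comb_barrier \<theta> n0 m \<le> (P powr \<bar>1 - \<theta>\<bar> + (1 + c) powr \<theta> * (if \<theta> = 1 then 1 else 1 / \<bar>1 - \<theta>\<bar>) +
     (1 + c) powr \<bar>\<alpha> - \<theta> - 2\<bar> / (1 + \<theta> - \<alpha>))
     * (t 1 * t m powr (\<alpha> - 1) * log_power \<theta> (t 1 / t m))"
proof -
  define x where "x = t 1 / t m"
  have t1: "0 < t 1" "t 1 \<le> t n0" "0 < t m" "t 1 \<le> t m"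
    using t_1_pos t_1_le[of n0] t_1_le[of m] t_pos[of m] m n0 by auto
  have x: "0 < x" "x \<le> 1" using t1 by (auto simp: x_def)
  define Q where "Q = log_power \<theta> x"
  have Q: "1 \<le> Q" "x powr (\<theta> - 1) \<le> Q" using log_power_ge[OF x] by (auto simp: Q_def)
  define w where "w i = (t (Suc i) - t i) * t (Suc i) powr (-\<theta>)" for i
  have w: "0 \<le> w i" if "i < N" for i using t_less_Suc[OF that] by (simp add: w_def)
  have e1: "t 1 powr \<theta> * t 1 powr (1 - \<theta>) = t 1" using t1 by (simp flip: powr_add)
  have ex: "t 1 powr \<theta> * t m powr (1 - \<theta>) = t 1 * x powr (\<theta> - 1)"
    using t1 by (simp add: x_def powr_divide powr_diff)
  have part1: "t 1 powr \<theta> * (t n0 powr (1 - \<theta>) * barrier n0 m) \<le> P powr \<bar>1 - \<theta>\<bar> * (t 1 * t m powr (\<alpha> - 1) * Q)"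
  proof -
    have "t n0 powr (1 - \<theta>) \<le> P powr \<bar>1 - \<theta>\<bar> * t 1 powr (1 - \<theta>)"
    proof (rule powr_ratio_bounds)
      have "t 1 \<le> 1 * t n0" using t1 by simp
      also have "\<dots> \<le> P * t n0" using P t1 by (intro mult_right_mono) auto
      finally show "t 1 \<le> P * t n0" .
    qed (use t1 n0 P in auto)
    then have "t 1 powr \<theta> * (t n0 powr (1 - \<theta>) * barrier n0 m) \<le> t 1 powr \<theta> * ((P powr \<bar>1 - \<theta>\<bar> * t 1 powr (1 - \<theta>)) * t m powr (\<alpha> - 1))"
      using barrier_le_power[of m n0] barrier_pos[of m n0] m n0 by (intro mult_left_mono mult_mono) auto
    also have "\<dots> = P powr \<bar>1 - \<theta>\<bar> * ((t 1 powr \<theta> * t 1 powr (1 - \<theta>)) * t m powr (\<alpha> - 1) * 1)"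
      by (simp add: mult_ac)
    also have "\<dots> \<le> P powr \<bar>1 - \<theta>\<bar> * (t 1 * t m powr (\<alpha> - 1) * Q)"
      unfolding e1 using Q t1 by (intro mult_left_mono) auto
    finally show ?thesis .
  qed
  define C2 where "C2 = (if \<theta> = 1 then 1 else 1 / \<bar>1 - \<theta>\<bar>)"
  have part2: "t 1 powr \<theta> * (\<Sum>i\<in>{1..<m}. w i * t m powr (\<alpha> - 1)) \<le> (1 + c) powr \<theta> * C2 * (t 1 * t m powr (\<alpha> - 1) * Q)"
  proof -
    \<comment> \<open>Naming an antiderivative \<open>F\<close> of \<open>s powr (-\<theta>)\<close>
      confines the distinction between logarithm and power to this step.\<close>
    have "\<exists>F. (\<forall>s>0. (F has_real_derivative s powr (-\<theta>)) (at s)) \<and> t 1 powr \<theta> * (F (t m) - F (t 1)) \<le> C2 * (t 1 * Q)"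
    proof (cases "\<theta> = 1")
      case True
      have "(ln has_real_derivative s powr (-\<theta>)) (at s)" if "s > 0" for s
        using that True by (auto intro!: derivative_eq_intros simp: powr_minus divide_simps)
      moreover have "t 1 * (ln (t m) - ln (t 1)) \<le> t 1 * Q"
        using True t1 x by (intro mult_left_mono) (auto simp: Q_def log_power_def x_def ln_div)
      ultimately show ?thesis using True t1 by (intro exI[of _ ln]) (auto simp: C2_def)
    next
      case False
      define F where "F s = s powr (1 - \<theta>) / (1 - \<theta>)" for s :: real
      have "(F has_real_derivative s powr (-\<theta>)) (at s)" if "s > 0" for s
        using has_real_derivative_powr_div[of "-\<theta>" s] False that by (simp add: F_def[abs_def])
      moreover have "t 1 powr \<theta> * (F (t m) - F (t 1)) \<le> C2 * (t 1 * Q)"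
      proof (cases "\<theta> < 1")
        case True
        have "t 1 powr \<theta> * (F (t m) - F (t 1)) \<le> t 1 powr \<theta> * F (t m)"
          using True by (intro mult_left_mono) (auto simp: F_def)
        also have "\<dots> = C2 * (t 1 powr \<theta> * t m powr (1 - \<theta>))" using True by (simp add: F_def C2_def)
        also have "\<dots> = C2 * (t 1 * Q)" unfolding ex using True by (simp add: Q_def log_power_def)
        finally show ?thesis .
      next
        case F: False
        have "t 1 powr \<theta> * (F (t m) - F (t 1)) \<le> t 1 powr \<theta> * (- F (t 1))"
          using F False by (intro mult_left_mono) (auto simp: F_def divide_le_0_iff)
        also have "- F (t 1) = C2 * t 1 powr (1 - \<theta>)"
          using False F by (simp add: F_def C2_def abs_if minus_divide_right)
        also have "t 1 powr \<theta> * (C2 * t 1 powr (1 - \<theta>)) = C2 * (t 1 powr \<theta> * t 1 powr (1 - \<theta>))" by simp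
        also have "\<dots> = C2 * (t 1 * Q)" unfolding e1 using False F by (simp add: Q_def log_power_def)
        finally show ?thesis .
      qed
      ultimately show ?thesis by blast
    qed
    then obtain F where F: "\<And>s. s > 0 \<Longrightarrow> (F has_real_derivative s powr (-\<theta>)) (at s)"
      "t 1 powr \<theta> * (F (t m) - F (t 1)) \<le> C2 * (t 1 * Q)" by blast
    have "(\<Sum>i\<in>{1..<m}. w i) \<le> (\<Sum>i\<in>{1..<m}. (1 + c) powr \<bar>-\<theta>\<bar> * (F (t (Suc i)) - F (t i)))"
    proof (rule sum_mono)
      fix i assume i: "i \<in> {1..<m}"
      show "w i \<le> (1 + c) powr \<bar>-\<theta>\<bar> * (F (t (Suc i)) - F (t i))"
        unfolding w_def by (rule powr_antiderivative_bounds(1))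
         (use i m c t_pos[of i] t_less_Suc[of i] t_Suc_le[of i] in \<open>auto intro!: F(1)\<close>)
    qed
    also have "\<dots> = (1 + c) powr \<theta> * (F (t m) - F (t 1))"
      using \<theta> m sum_Suc_diff'[of 1 m "\<lambda>i. F (t i)"] by (simp flip: sum_distrib_left)
    finally have "t 1 powr \<theta> * (\<Sum>i\<in>{1..<m}. w i) \<le> t 1 powr \<theta> * ((1 + c) powr \<theta> * (F (t m) - F (t 1)))"
      by (rule mult_left_mono) simp
    also have "\<dots> = (1 + c) powr \<theta> * (t 1 powr \<theta> * (F (t m) - F (t 1)))" by simp
    also have "\<dots> \<le> (1 + c) powr \<theta> * (C2 * (t 1 * Q))" using F(2) by (intro mult_left_mono) auto
    finally have "t 1 powr \<theta> * (\<Sum>i\<in>{1..<m}. w i) * t m powr (\<alpha> - 1) \<le> (1 + c) powr \<theta> * (C2 * (t 1 * Q)) * t m powr (\<alpha> - 1)"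
      by (rule mult_right_mono) simp
    then show ?thesis by (simp add: sum_distrib_right[symmetric] mult_ac)
  qed
  have part3: "t 1 powr \<theta> * (\<Sum>i\<in>{m..<N}. w i * (t m * t (Suc i) powr (\<alpha> - 2))) \<le>
     (1 + c) powr \<bar>\<alpha> - \<theta> - 2\<bar> / (1 + \<theta> - \<alpha>) * (t 1 * t m powr (\<alpha> - 1) * Q)"
  proof -
    define e where "e = \<alpha> - \<theta> - 1"
    have e: "e < 0" using \<theta> \<alpha> by (simp add: e_def)
    have "(\<Sum>i\<in>{m..<N}. w i * t (Suc i) powr (\<alpha> - 2)) \<le> (\<Sum>i\<in>{m..<N}. (1 + c) powr \<bar>e - 1\<bar> * (t (Suc i) powr e / e - t i powr e / e))"
    proof (rule sum_mono)
      fix i assume i: "i \<in> {m..<N}"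
      have "w i * t (Suc i) powr (\<alpha> - 2) = (t (Suc i) - t i) * t (Suc i) powr (e - 1)"
      proof -
        have "t (Suc i) powr (-\<theta>) * t (Suc i) powr (\<alpha> - 2) = t (Suc i) powr (e - 1)"
          by (subst powr_add[symmetric]) (simp add: e_def algebra_simps)
        then show ?thesis by (simp add: w_def mult.assoc)
      qed
      then show "w i * t (Suc i) powr (\<alpha> - 2) \<le> (1 + c) powr \<bar>e - 1\<bar> * (t (Suc i) powr e / e - t i powr e / e)"
        using powr_diff_bounds(1)[of "t i" "t (Suc i)" "1 + c" "t (Suc i)" "e - 1"] e
         i m c t_pos[of i] t_less_Suc[of i] t_Suc_le[of i] by simp
    qed
    also have "\<dots> = (1 + c) powr \<bar>e - 1\<bar> * (t N powr e / e - t m powr e / e)"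
      using m sum_Suc_diff'[of m N "\<lambda>i. t i powr e / e"] by (simp flip: sum_distrib_left)
    also have "\<dots> \<le> (1 + c) powr \<bar>e - 1\<bar> * (t m powr e / (- e))"
      using e by (intro mult_left_mono) (auto simp: divide_le_0_iff)
    finally have "t 1 powr \<theta> * t m * (\<Sum>i\<in>{m..<N}. w i * t (Suc i) powr (\<alpha> - 2)) \<le> t 1 powr \<theta> * t m * ((1 + c) powr \<bar>e - 1\<bar> * (t m powr e / (- e)))"
      using t1 by (intro mult_left_mono) auto
    also have "\<dots> = (1 + c) powr \<bar>e - 1\<bar> / (- e) * (t 1 powr \<theta> * (t m * t m powr e))"
      by simp
    also have "t m * t m powr e = t m powr (1 - \<theta>) * t m powr (\<alpha> - 1)"
      using t1 by (simp add: e_def powr_diff powr_add)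
    also have "t 1 powr \<theta> * (t m powr (1 - \<theta>) * t m powr (\<alpha> - 1)) = t 1 * t m powr (\<alpha> - 1) * x powr (\<theta> - 1)"
      using ex by (simp add: mult_ac)
    also have "(1 + c) powr \<bar>e - 1\<bar> / (- e) * \<dots> \<le> (1 + c) powr \<bar>e - 1\<bar> / (- e) * (t 1 * t m powr (\<alpha> - 1) * Q)"
      using Q t1 e by (intro mult_left_mono) (auto simp: divide_le_0_iff)
    finally have "t 1 powr \<theta> * t m * (\<Sum>i\<in>{m..<N}. w i * t (Suc i) powr (\<alpha> - 2))
       \<le> (1 + c) powr \<bar>e - 1\<bar> / (- e) * (t 1 * t m powr (\<alpha> - 1) * Q)" .
    moreover have "- e = 1 + \<theta> - \<alpha>" "\<bar>e - 1\<bar> = \<bar>\<alpha> - \<theta> - 2\<bar>" by (auto simp: e_def)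
    ultimately show ?thesis by (simp only:) (simp add: sum_distrib_left mult_ac)
  qed
  have "(\<Sum>i\<in>{n0..<N}. w i * barrier (Suc i) m) \<le> (\<Sum>i\<in>{1..<m} \<union> {m..<N}. w i * barrier (Suc i) m)"
    using n0 m w barrier_pos[of m] by (intro sum_mono2) (auto intro!: mult_nonneg_nonneg simp: less_imp_le)
  also have "\<dots> = (\<Sum>i\<in>{1..<m}. w i * barrier (Suc i) m) + (\<Sum>i\<in>{m..<N}. w i * barrier (Suc i) m)"
    by (intro sum.union_disjoint) auto
  also have "(\<Sum>i\<in>{1..<m}. w i * barrier (Suc i) m) \<le> (\<Sum>i\<in>{1..<m}. w i * t m powr (\<alpha> - 1))"
    using m w by (intro sum_mono mult_left_mono barrier_le_power) auto
  also have "(\<Sum>i\<in>{m..<N}. w i * barrier (Suc i) m) = (\<Sum>i\<in>{m..<N}. w i * (t m * t (Suc i) powr (\<alpha> - 2)))"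
    by (intro sum.cong) (auto simp: barrier_def)
  finally have "t 1 powr \<theta> * (\<Sum>i\<in>{n0..<N}. w i * barrier (Suc i) m) \<le>
    t 1 powr \<theta> * ((\<Sum>i\<in>{1..<m}. w i * t m powr (\<alpha> - 1)) + (\<Sum>i\<in>{m..<N}. w i * (t m * t (Suc i) powr (\<alpha> - 2))))"
    by (intro mult_left_mono) auto
  with part1 part2 part3 show ?thesis
    unfolding comb_barrier_def w_def[symmetric] C2_def[symmetric] x_def[symmetric] Q_def[symmetric] distrib_left distrib_right
    by linarith
qed

text \<open>The gain of the barrier switching at \<open>q\<close> is
  \<open>q powr \<alpha> * t m powr (-\<alpha> - 1)\<close> up to a factor, and its weighted sum
  \<open>Z\<close> is comparable to an integral converging at 0 because \<theta> < \<alpha> + 1. The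
  loss \<open>E\<close> is common to all of them and gets multiplied by the total weight
  \<open>W\<close>. Switch points beyond \<open>t m\<close> contribute nonnegatively and are
  dropped.\<close>

lemma L1_sum_comb_barrier_ge:
  assumes m: "1 \<le> m" "m \<le> N" and n0: "1 \<le> n0" "n0 < m"
    and \<theta>: "0 < \<theta>" "\<theta> < \<alpha> + 1" "\<theta> < \<nu> + 1" and \<nu>: "0 < \<nu>"
    and \<epsilon>: "(1 - \<alpha>) * (2 - \<alpha>) * (\<Sum>j\<in>{1..<m}. (t (Suc j) - t j) * t j powr (\<alpha> - 3) * ker_osc m j)
       \<le> D * (t m powr (-1) * (t 1 / t m) powr \<nu>)" and D: "0 \<le> D"
  shows "((1 - \<alpha>) * min 1 ((1 + c) powr - \<bar>\<alpha> - \<theta>\<bar> / (\<alpha> - \<theta> + 1))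
     - D * max 1 ((1 + c) powr \<bar>\<nu> - \<theta>\<bar> / (\<nu> - \<theta> + 1)) * (t 1 / t n0) powr \<nu>) * (t 1 / t m) powr \<theta>
     \<le> L1_sum m (comb_barrier \<theta> n0)"
proof -
  have n0N: "n0 \<le> N" using n0 m by simp
  have t1: "0 < t 1" "0 < t n0" "0 < t m" "t n0 < t m"
    using t_1_pos t_pos[of m] t_pos[of n0] t_less[of n0 m] m n0 by auto
  define E where "E = D * (t m powr (-1) * (t 1 / t m) powr \<nu>)"
  have E: "0 \<le> E" using D by (simp add: E_def)
  define w where "w i = (t (Suc i) - t i) * t (Suc i) powr (-\<theta>)" for i
  have w: "0 \<le> w i" if "i < N" for i using t_less_Suc[OF that] by (simp add: w_def)
  define M where "M n = (1 - \<alpha>) * (t n powr \<alpha> * t m powr (-\<alpha> - 1))" for n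
  have le: "M n - E \<le> L1_sum m (barrier n)" if n: "1 \<le> n" "n \<le> m" for n
  proof (cases "n = m")
    \<comment> \<open>At the switch point itself the barrier is still straight, so the exact formula
      applies; it beats the required bound because
      \<open>1 - \<alpha> \<le> 1 / (1 - \<alpha>)\<close>.\<close>
    case True
    have "L1_sum m (barrier m) = t m powr (\<alpha> - 2) * (t m powr (1 - \<alpha>) / (1 - \<alpha>))"
      using L1_sum_barrier_le[of m m] m by simp
    also have "\<dots> = t m powr (-1) / (1 - \<alpha>)" by (simp flip: powr_add)
    also have "\<dots> \<ge> (1 - \<alpha>) * t m powr (-1)"
    proof -
      have "(1 - \<alpha>) * (1 - \<alpha>) \<le> 1 * 1" using \<alpha> by (intro mult_mono) auto
      then have "(1 - \<alpha>) \<le> 1 / (1 - \<alpha>)" using \<alpha> by (simp add: pos_le_divide_eq)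
      then have "(1 - \<alpha>) * t m powr (-1) \<le> 1 / (1 - \<alpha>) * t m powr (-1)" by (rule mult_right_mono) simp
      then show ?thesis by (simp add: mult_ac)
    qed
    also have "(1 - \<alpha>) * t m powr (-1) = M m" by (simp add: M_def flip: powr_add)
    finally show ?thesis using True E by simp
  next
    case False
    then show ?thesis using L1_sum_barrier_gt[of n m] n m \<epsilon> unfolding M_def E_def by simp
  qed
  have nonneg: "0 \<le> L1_sum m (barrier n)" if "m \<le> n" "n \<le> N" for n
    using L1_sum_barrier_le[of m n] that m \<alpha> by simp
  have eM: "y powr (-\<theta>) * y powr \<alpha> = y powr (\<alpha> - \<theta>)" for y by (simp flip: powr_add)
  define W where "W = t n0 powr (1 - \<theta>) + (\<Sum>i\<in>{n0..<m}. w i)"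
  define Z where "Z = t n0 powr (\<alpha> - \<theta> + 1) + (\<Sum>i\<in>{n0..<m}. (t (Suc i) - t i) * t (Suc i) powr (\<alpha> - \<theta>))"
  have main: "t 1 powr \<theta> * ((1 - \<alpha>) * t m powr (-\<alpha> - 1) * Z - E * W) \<le> L1_sum m (comb_barrier \<theta> n0)"
  proof -
    have "(1 - \<alpha>) * t m powr (-\<alpha> - 1) * Z - E * W = t n0 powr (1 - \<theta>) * (M n0 - E) + (\<Sum>i\<in>{n0..<m}. w i * (M (Suc i) - E))"
    proof -
      have a: "t n0 powr (1 - \<theta>) * (M n0 - E) = (1 - \<alpha>) * t m powr (-\<alpha> - 1) * t n0 powr (\<alpha> - \<theta> + 1) - E * t n0 powr (1 - \<theta>)"
        by (simp add: M_def right_diff_distrib powr_add powr_diff mult_ac)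
      have b: "w i * (M (Suc i) - E) = (1 - \<alpha>) * t m powr (-\<alpha> - 1) * ((t (Suc i) - t i) * t (Suc i) powr (\<alpha> - \<theta>)) - E * w i" for i
      proof -
        have "w i * M (Suc i) = (1 - \<alpha>) * t m powr (-\<alpha> - 1) * ((t (Suc i) - t i) * (t (Suc i) powr (-\<theta>) * t (Suc i) powr \<alpha>))"
          by (simp only: w_def M_def mult_ac)
        then show ?thesis unfolding eM by (simp add: right_diff_distrib)
      qed
      show ?thesis unfolding a b sum_subtractf W_def Z_def by (simp add: distrib_left sum_distrib_left)
    qed
    also have "\<dots> \<le> t n0 powr (1 - \<theta>) * L1_sum m (barrier n0) + (\<Sum>i\<in>{n0..<m}. w i * L1_sum m (barrier (Suc i)))"
      using le n0 m w by (intro add_mono mult_left_mono sum_mono) auto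
    also have "(\<Sum>i\<in>{n0..<m}. w i * L1_sum m (barrier (Suc i))) \<le> (\<Sum>i\<in>{n0..<N}. w i * L1_sum m (barrier (Suc i)))"
      using m w nonneg by (intro sum_mono2) (auto intro!: mult_nonneg_nonneg)
    finally show ?thesis unfolding L1_sum_comb_barrier w_def[symmetric] by (simp add: mult_left_mono)
  qed
  have Z_ge: "min 1 ((1 + c) powr - \<bar>\<alpha> - \<theta>\<bar> / (\<alpha> - \<theta> + 1)) * t m powr (\<alpha> - \<theta> + 1) \<le> Z"
  proof -
    define e where "e = \<alpha> - \<theta> + 1"
    define q where "q = min 1 ((1 + c) powr - \<bar>\<alpha> - \<theta>\<bar> / e)"
    have e: "0 < e" using \<theta> by (simp add: e_def)
    have le_e: "t n0 powr e \<le> t m powr e" using t1 e by (intro powr_mono2) auto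
    have "(1 + c) powr - \<bar>\<alpha> - \<theta>\<bar> / e * (t m powr e - t n0 powr e) =
       (\<Sum>i\<in>{n0..<m}. (1 + c) powr - \<bar>\<alpha> - \<theta>\<bar> * (t (Suc i) powr e / e - t i powr e / e))"
      using n0 by (subst sum_distrib_left[symmetric], subst sum_Suc_diff'[where f = "\<lambda>i. t i powr e / e"])
         (auto simp: diff_divide_distrib right_diff_distrib)
    also have "\<dots> \<le> (\<Sum>i\<in>{n0..<m}. (t (Suc i) - t i) * t (Suc i) powr (\<alpha> - \<theta>))"
    proof (rule sum_mono)
      fix i assume i: "i \<in> {n0..<m}"
      have "t (Suc i) powr e / e - t i powr e / e \<le> (1 + c) powr \<bar>\<alpha> - \<theta>\<bar> * ((t (Suc i) - t i) * t (Suc i) powr (\<alpha> - \<theta>))"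
        using powr_diff_bounds(2)[of "t i" "t (Suc i)" "1 + c" "t (Suc i)" "\<alpha> - \<theta>"] e i m n0 c
          t_pos[of i] t_less_Suc[of i] t_Suc_le[of i] by (simp add: e_def)
      then have "(1 + c) powr - \<bar>\<alpha> - \<theta>\<bar> * (t (Suc i) powr e / e - t i powr e / e) \<le>
         (1 + c) powr - \<bar>\<alpha> - \<theta>\<bar> * ((1 + c) powr \<bar>\<alpha> - \<theta>\<bar> * ((t (Suc i) - t i) * t (Suc i) powr (\<alpha> - \<theta>)))"
        by (rule mult_left_mono) simp
      also have "\<dots> = ((1 + c) powr - \<bar>\<alpha> - \<theta>\<bar> * (1 + c) powr \<bar>\<alpha> - \<theta>\<bar>) * ((t (Suc i) - t i) * t (Suc i) powr (\<alpha> - \<theta>))"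
        by simp
      also have "(1 + c) powr - \<bar>\<alpha> - \<theta>\<bar> * (1 + c) powr \<bar>\<alpha> - \<theta>\<bar> = 1" using c by (simp flip: powr_add)
      finally show "(1 + c) powr - \<bar>\<alpha> - \<theta>\<bar> * (t (Suc i) powr e / e - t i powr e / e) \<le> (t (Suc i) - t i) * t (Suc i) powr (\<alpha> - \<theta>)" by simp
    qed
    finally have s: "(1 + c) powr - \<bar>\<alpha> - \<theta>\<bar> / e * (t m powr e - t n0 powr e) \<le> Z - t n0 powr e"
      unfolding Z_def e_def by simp
    have "q * (t m powr e - t n0 powr e) \<le> (1 + c) powr - \<bar>\<alpha> - \<theta>\<bar> / e * (t m powr e - t n0 powr e)"
      using le_e by (intro mult_right_mono) (auto simp: q_def)
    moreover have "q * t n0 powr e \<le> 1 * t n0 powr e" by (intro mult_right_mono) (auto simp: q_def)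
    ultimately have "q * t m powr e \<le> Z" using s by (simp add: right_diff_distrib)
    then show ?thesis by (simp add: q_def e_def)
  qed
  have W_le: "W \<le> max 1 ((1 + c) powr \<bar>\<nu> - \<theta>\<bar> / (\<nu> - \<theta> + 1)) * (t n0 powr (-\<nu>) * t m powr (\<nu> - \<theta> + 1))"
  proof -
    define e where "e = \<nu> - \<theta> + 1"
    define q where "q = max 1 ((1 + c) powr \<bar>\<nu> - \<theta>\<bar> / e)"
    have e: "0 < e" using \<theta> by (simp add: e_def)
    have le_e: "t n0 powr e \<le> t m powr e" using t1 e by (intro powr_mono2) auto
    have "(\<Sum>i\<in>{n0..<m}. w i) \<le> (\<Sum>i\<in>{n0..<m}. t n0 powr (-\<nu>) * (1 + c) powr \<bar>\<nu> - \<theta>\<bar> * (t (Suc i) powr e / e - t i powr e / e))"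
    proof (rule sum_mono)
      fix i assume i: "i \<in> {n0..<m}"
      have ti: "t n0 \<le> t (Suc i)" "0 < t (Suc i)" using t_le[of n0 "Suc i"] t_pos[of "Suc i"] i m by auto
      \<comment> \<open>All switch points lie beyond \<open>t n0\<close>, so a factor
        \<open>t n0 powr (-\<nu>)\<close> can be taken out of the weight. This is the source of the
        small factor; what remains, \<open>s powr (\<nu> - \<theta>)\<close>, is integrable at 0
        because \<theta> < \<nu> + 1.\<close>
      have "t (Suc i) powr (-\<nu>) \<le> t n0 powr (-\<nu>)" using ti t1 \<nu> by (intro powr_mono2') auto
      then have "(t (Suc i) - t i) * (t (Suc i) powr (-\<nu>) * t (Suc i) powr (\<nu> - \<theta>)) \<le> (t (Suc i) - t i) * (t n0 powr (-\<nu>) * t (Suc i) powr (\<nu> - \<theta>))"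
        using t_less_Suc[of i] i m by (intro mult_left_mono mult_right_mono) auto
      then have "w i \<le> t n0 powr (-\<nu>) * ((t (Suc i) - t i) * t (Suc i) powr (\<nu> - \<theta>))"
        by (simp add: w_def mult_ac flip: powr_add)
      also have "(t (Suc i) - t i) * t (Suc i) powr (\<nu> - \<theta>) \<le> (1 + c) powr \<bar>\<nu> - \<theta>\<bar> * (t (Suc i) powr e / e - t i powr e / e)"
        using powr_diff_bounds(1)[of "t i" "t (Suc i)" "1 + c" "t (Suc i)" "\<nu> - \<theta>"] e i m n0 c
          t_pos[of i] t_less_Suc[of i] t_Suc_le[of i] by (simp add: e_def)
      finally show "w i \<le> t n0 powr (-\<nu>) * (1 + c) powr \<bar>\<nu> - \<theta>\<bar> * (t (Suc i) powr e / e - t i powr e / e)"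
        by (simp add: mult_left_mono mult.assoc)
    qed
    also have "\<dots> = t n0 powr (-\<nu>) * ((1 + c) powr \<bar>\<nu> - \<theta>\<bar> / e * (t m powr e - t n0 powr e))"
      using n0 by (subst sum_distrib_left[symmetric], subst sum_Suc_diff'[where f = "\<lambda>i. t i powr e / e"])
         (auto simp: diff_divide_distrib right_diff_distrib mult.assoc)
    also have "\<dots> \<le> t n0 powr (-\<nu>) * (q * (t m powr e - t n0 powr e))"
      using le_e by (intro mult_left_mono mult_right_mono) (auto simp: q_def)
    finally have "(\<Sum>i\<in>{n0..<m}. w i) \<le> t n0 powr (-\<nu>) * (q * (t m powr e - t n0 powr e))" .
    moreover have "t n0 powr (1 - \<theta>) = t n0 powr (-\<nu>) * (1 * t n0 powr e)"
      by (simp add: e_def flip: powr_add)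
    moreover have "t n0 powr (-\<nu>) * (1 * t n0 powr e) \<le> t n0 powr (-\<nu>) * (q * t n0 powr e)"
      by (intro mult_left_mono mult_right_mono) (auto simp: q_def)
    ultimately have "W \<le> t n0 powr (-\<nu>) * (q * t m powr e)"
      by (simp add: W_def right_diff_distrib)
    then show ?thesis by (simp add: q_def e_def mult_ac)
  qed
  define q1 where "q1 = min 1 ((1 + c) powr - \<bar>\<alpha> - \<theta>\<bar> / (\<alpha> - \<theta> + 1))"
  define q2 where "q2 = max 1 ((1 + c) powr \<bar>\<nu> - \<theta>\<bar> / (\<nu> - \<theta> + 1))"
  have "t 1 powr \<theta> * ((1 - \<alpha>) * t m powr (-\<alpha> - 1) * (q1 * t m powr (\<alpha> - \<theta> + 1)) - E * (q2 * (t n0 powr (-\<nu>) * t m powr (\<nu> - \<theta> + 1))))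
     \<le> t 1 powr \<theta> * ((1 - \<alpha>) * t m powr (-\<alpha> - 1) * Z - E * W)"
    using Z_ge W_le E \<alpha> unfolding q1_def q2_def by (intro mult_left_mono diff_mono) auto
  also have "\<dots> \<le> L1_sum m (comb_barrier \<theta> n0)" by (rule main)
  finally have "t 1 powr \<theta> * ((1 - \<alpha>) * t m powr (-\<alpha> - 1) * (q1 * t m powr (\<alpha> - \<theta> + 1)) - E * (q2 * (t n0 powr (-\<nu>) * t m powr (\<nu> - \<theta> + 1))))
    \<le> L1_sum m (comb_barrier \<theta> n0)" .
  moreover have "t 1 powr \<theta> * ((1 - \<alpha>) * t m powr (-\<alpha> - 1) * (q1 * t m powr (\<alpha> - \<theta> + 1))) = (1 - \<alpha>) * q1 * (t 1 / t m) powr \<theta>"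
  proof -
    have "t m powr (-\<alpha> - 1) * t m powr (\<alpha> - \<theta> + 1) = t m powr (-\<theta>)" by (simp flip: powr_add)
    moreover have "(t 1 / t m) powr \<theta> = t 1 powr \<theta> * t m powr (-\<theta>)" using t1 by (simp add: powr_divide powr_minus divide_simps)
    ultimately show ?thesis by (metis (no_types, lifting) mult.assoc mult.left_commute)
  qed
  moreover have "t 1 powr \<theta> * (E * (q2 * (t n0 powr (-\<nu>) * t m powr (\<nu> - \<theta> + 1)))) = D * q2 * (t 1 / t n0) powr \<nu> * (t 1 / t m) powr \<theta>"
    using t1 unfolding E_def by (simp add: powr_divide powr_minus powr_add powr_diff divide_simps)
  ultimately show ?thesis
    unfolding q1_def[symmetric] q2_def[symmetric] right_diff_distrib[of "t 1 powr \<theta>"] left_diff_distrib[of "(1 - \<alpha>) * q1"]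
    by linarith
qed

text \<open>Up to \<open>t n0\<close> every barrier involved is straight, hence its L1 operator is
  exact and nonnegative, and the first summand alone suffices. The constant arises from
  \<open>t n0 \<le> P * t m\<close>.\<close>

lemma L1_sum_comb_barrier_initial:
  assumes m: "1 \<le> m" "m \<le> n0" and n0: "n0 \<le> N" "t n0 \<le> P * t 1" and P: "1 \<le> P"
    and \<theta>: "0 < \<theta>"
  shows "P powr (\<alpha> - 1 - \<theta>) * (t 1 / t m) powr \<theta> \<le> L1_sum m (comb_barrier \<theta> n0)"
proof -
  have t1: "0 < t 1" "0 < t m" "t 1 \<le> t m" "t m \<le> t n0" "0 < t n0" "t n0 \<le> P * t m"
  proof -
    show "0 < t 1" "0 < t m" "t 1 \<le> t m" "t m \<le> t n0" "0 < t n0"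
      using t_1_pos t_1_le[of m] t_le[of m n0] m n0 t_pos[of m] t_pos[of n0] by auto
    then have "P * t 1 \<le> P * t m" using P by (intro mult_left_mono) auto
    then show "t n0 \<le> P * t m" using n0 by simp
  qed
  have "(P * t m) powr (\<alpha> - 1 - \<theta>) \<le> t n0 powr (\<alpha> - 1 - \<theta>)"
    using t1 \<alpha> \<theta> by (intro powr_mono2') auto
  then have a: "P powr (\<alpha> - 1 - \<theta>) * t m powr (\<alpha> - 1 - \<theta>) \<le> t n0 powr (\<alpha> - 1 - \<theta>)"
    using P t1 by (simp add: powr_mult)
  have "P powr (\<alpha> - 1 - \<theta>) * (t 1 / t m) powr \<theta> = t 1 powr \<theta> * ((P powr (\<alpha> - 1 - \<theta>) * t m powr (\<alpha> - 1 - \<theta>)) * (t m powr (1 - \<alpha>) / 1))"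
    using t1 by (simp add: powr_divide powr_diff mult_ac)
  also have "\<dots> \<le> t 1 powr \<theta> * (t n0 powr (\<alpha> - 1 - \<theta>) * (t m powr (1 - \<alpha>) / (1 - \<alpha>)))"
    using a \<alpha> by (intro mult_left_mono mult_mono divide_left_mono) auto
  also have "t n0 powr (\<alpha> - 1 - \<theta>) * (t m powr (1 - \<alpha>) / (1 - \<alpha>)) = t n0 powr (1 - \<theta>) * L1_sum m (barrier n0)"
  proof -
    have "t n0 powr (1 - \<theta>) * t n0 powr (\<alpha> - 2) = t n0 powr (\<alpha> - 1 - \<theta>)"
      by (subst powr_add[symmetric]) (simp add: algebra_simps)
    then show ?thesis using L1_sum_barrier_le[of m n0] m n0 by (simp add: mult.assoc[symmetric])
  qed
  also have "t 1 powr \<theta> * \<dots> \<le> L1_sum m (comb_barrier \<theta> n0)"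
    unfolding L1_sum_comb_barrier using L1_sum_barrier_le[of m] m \<alpha> t_less_Suc
    by (intro mult_left_mono) (auto intro!: sum_nonneg mult_nonneg_nonneg simp: less_imp_le)
  finally show ?thesis .
qed

end

text \<open>The two lower bounds of the L1 operator are joined: up to \<open>n0\<close> the barriers
  are straight, and beyond \<open>n0\<close> the loss is at most half of the gain. The condition
  \<nu> < \<alpha> is the integrability condition of \<open>sum_ker_osc_weighted\<close> at \<mu> =
  \<alpha> - 1.\<close>

theorem discrete_barrier:
  fixes \<alpha> r c \<nu> \<theta> :: real
  assumes \<alpha>: "0 < \<alpha>" "\<alpha> < 1" and r: "1 \<le> r" and c: "0 < c"
    and \<nu>: "0 < \<nu>" "\<nu> < \<alpha>" "\<nu> \<le> (2 - \<alpha>) / r" and \<theta>: "0 < \<theta>" "\<theta> < \<nu> + 1"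
  shows "\<exists>C>0. \<forall>N t. fine_mesh \<alpha> r c N t \<longrightarrow> (\<exists>S. S 0 = 0 \<and> (\<forall>m\<in>{1..N}. 0 < S m \<and>
     S m \<le> C * (t 1 * t m powr (\<alpha> - 1) * log_power \<theta> (t 1 / t m)) \<and>
     (t 1 / t m) powr \<theta> \<le> fine_mesh.L1_sum \<alpha> t m S))"
proof -
  obtain C0 where C0: "C0 > 0" "\<And>N t m. fine_mesh \<alpha> r c N t \<Longrightarrow> m \<in> {1..N} \<Longrightarrow>
    (\<Sum>j\<in>{1..<m}. (t (Suc j) - t j) * t j powr (\<alpha> - 1 - 2) * fine_mesh.ker_osc \<alpha> t m j)
      \<le> C0 * (t m powr (\<alpha> - 1 - \<alpha>) * (t 1 / t m) powr \<nu>)"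
    using sum_ker_osc_weighted[of \<nu> \<alpha> r "\<alpha> - 1" c] assms by auto
  define D where "D = (1 - \<alpha>) * (2 - \<alpha>) * C0"
  have D: "0 < D" using \<alpha> C0 by (simp add: D_def)
  define q1 where "q1 = (1 - \<alpha>) * min 1 ((1 + c) powr - \<bar>\<alpha> - \<theta>\<bar> / (\<alpha> - \<theta> + 1))"
  define q2 where "q2 = D * max 1 ((1 + c) powr \<bar>\<nu> - \<theta>\<bar> / (\<nu> - \<theta> + 1))"
  have q: "0 < q1" "0 < q2" using \<alpha> \<nu> \<theta> c D by (auto simp: q1_def q2_def)
  \<comment> \<open>Solves \<open>q2 * p powr (-\<nu>) \<le> q1 / 2\<close>: with switch points
    beyond \<open>p * t 1\<close> the loss is at most half of the gain.\<close>
  define p where "p = max 1 ((2 * q2 / q1) powr (1 / \<nu>))"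
  have p1: "1 \<le> p" by (simp add: p_def)
  have p2: "q2 * p powr (-\<nu>) \<le> q1 / 2"
  proof -
    have "2 * q2 / q1 = ((2 * q2 / q1) powr (1 / \<nu>)) powr \<nu>" using q \<nu> by (simp add: powr_powr)
    also have "\<dots> \<le> p powr \<nu>" using \<nu> by (intro powr_mono2) (auto simp: p_def)
    finally show ?thesis using p1 q by (simp add: powr_minus divide_simps mult_ac)
  qed
  \<comment> \<open>The first mesh point beyond \<open>p * t 1\<close> may overshoot by the ratio
    \<open>1 + c\<close> of consecutive points.\<close>
  define P where "P = (1 + c) * p"
  have P: "1 \<le> P" "p \<le> P" using p1 c by (auto simp: P_def algebra_simps intro: order_trans)
  define c1 where "c1 = min (q1 / 2) (P powr (\<alpha> - 1 - \<theta>))"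
  have c1: "0 < c1" using q P by (simp add: c1_def)
  define C where "C = (P powr \<bar>1 - \<theta>\<bar> + (1 + c) powr \<theta> * (if \<theta> = 1 then 1 else 1 / \<bar>1 - \<theta>\<bar>) +
     (1 + c) powr \<bar>\<alpha> - \<theta> - 2\<bar> / (1 + \<theta> - \<alpha>))"
  have C: "0 < C" unfolding C_def using P c \<alpha> \<theta> by (intro add_pos_nonneg) auto
  show ?thesis
  proof (intro exI[of _ "C / c1"] conjI allI impI)
    show "0 < C / c1" using C c1 by simp
    fix N t assume fm: "fine_mesh \<alpha> r c N t"
    then interpret fine_mesh \<alpha> r c N t .
    have "\<exists>n0. 1 \<le> n0 \<and> n0 \<le> N \<and> t n0 \<le> P * t 1 \<and> (n0 < N \<longrightarrow> p * t 1 \<le> t n0)"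
    proof -
      \<comment> \<open>If no mesh point reaches \<open>p * t 1\<close>, then \<open>n0 = N\<close>
        and every \<open>m\<close> is covered by the straight part.\<close>
      define n0 where "n0 = (LEAST n. 1 \<le> n \<and> (n = N \<or> p * t 1 \<le> t n))"
      have ex: "1 \<le> N \<and> (N = N \<or> p * t 1 \<le> t N)" using N by simp
      have n0: "1 \<le> n0 \<and> (n0 = N \<or> p * t 1 \<le> t n0)" unfolding n0_def by (rule LeastI[where P = "\<lambda>n. 1 \<le> n \<and> (n = N \<or> p * t 1 \<le> t n)", OF ex])
      have n0N: "n0 \<le> N" unfolding n0_def by (rule Least_le[where P = "\<lambda>n. 1 \<le> n \<and> (n = N \<or> p * t 1 \<le> t n)", OF ex])
      have "t n0 \<le> P * t 1"
      proof (cases "n0 = 1")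
        case True
        then show ?thesis using P t_1_pos by simp
      next
        case False
        then obtain k where k: "n0 = Suc k" "1 \<le> k" using n0 by (cases n0) auto
        have "\<not> (1 \<le> k \<and> (k = N \<or> p * t 1 \<le> t k))"
          using not_less_Least[of k "\<lambda>n. 1 \<le> n \<and> (n = N \<or> p * t 1 \<le> t n)"] k by (simp add: n0_def)
        then have "t k \<le> p * t 1" using k by auto
        then have "(1 + c) * t k \<le> (1 + c) * (p * t 1)" using c by (intro mult_left_mono) auto
        then show ?thesis using t_Suc_le[of k] k n0N by (simp add: P_def mult.assoc)
      qed
      then show ?thesis using n0 n0N by blast
    qed
    then obtain n0 where n0: "1 \<le> n0" "n0 \<le> N" "t n0 \<le> P * t 1" "n0 < N \<Longrightarrow> p * t 1 \<le> t n0" by blast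
    define S where "S j = (1 / c1) * comb_barrier \<theta> n0 j" for j
    show "\<exists>S. S 0 = 0 \<and> (\<forall>m\<in>{1..N}. 0 < S m \<and> S m \<le> C / c1 * (t 1 * t m powr (\<alpha> - 1) * log_power \<theta> (t 1 / t m)) \<and>
        (t 1 / t m) powr \<theta> \<le> L1_sum m S)"
    proof (intro exI[of _ S] conjI ballI)
      show "S 0 = 0" by (simp add: S_def comb_barrier_0)
      fix m assume m: "m \<in> {1..N}"
      show "0 < S m" using c1 comb_barrier_pos[of m n0] m n0 by (simp add: S_def)
      have "comb_barrier \<theta> n0 m \<le> C * (t 1 * t m powr (\<alpha> - 1) * log_power \<theta> (t 1 / t m))"
        unfolding C_def using m n0 P \<theta> by (intro comb_barrier_le) auto
      then have "1 / c1 * comb_barrier \<theta> n0 m \<le> 1 / c1 * (C * (t 1 * t m powr (\<alpha> - 1) * log_power \<theta> (t 1 / t m)))"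
        using c1 by (intro mult_left_mono) auto
      then show "S m \<le> C / c1 * (t 1 * t m powr (\<alpha> - 1) * log_power \<theta> (t 1 / t m))"
        by (simp add: S_def)
      have "c1 * (t 1 / t m) powr \<theta> \<le> L1_sum m (comb_barrier \<theta> n0)"
      proof (cases "m \<le> n0")
        case True
        have "c1 * (t 1 / t m) powr \<theta> \<le> P powr (\<alpha> - 1 - \<theta>) * (t 1 / t m) powr \<theta>"
          by (intro mult_right_mono) (auto simp: c1_def)
        also have "\<dots> \<le> L1_sum m (comb_barrier \<theta> n0)"
          using True m n0 P \<theta> by (intro L1_sum_comb_barrier_initial) auto
        finally show ?thesis .
      next
        case False
        then have tn0: "p * t 1 \<le> t n0" using n0 m by auto
        have eps: "(1 - \<alpha>) * (2 - \<alpha>) * (\<Sum>j\<in>{1..<m}. (t (Suc j) - t j) * t j powr (\<alpha> - 3) * ker_osc m j)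
          \<le> D * (t m powr (-1) * (t 1 / t m) powr \<nu>)"
        proof -
          have "(\<Sum>j\<in>{1..<m}. (t (Suc j) - t j) * t j powr (\<alpha> - 3) * ker_osc m j) \<le> C0 * (t m powr (-1) * (t 1 / t m) powr \<nu>)"
            using C0(2)[OF fm m] by simp
          then have "(1 - \<alpha>) * (2 - \<alpha>) * (\<Sum>j\<in>{1..<m}. (t (Suc j) - t j) * t j powr (\<alpha> - 3) * ker_osc m j) \<le>
            (1 - \<alpha>) * (2 - \<alpha>) * (C0 * (t m powr (-1) * (t 1 / t m) powr \<nu>))"
            using \<alpha> by (intro mult_left_mono) auto
          then show ?thesis by (simp add: D_def mult.assoc)
        qed
        have "(t 1 / t n0) powr \<nu> \<le> (1 / p) powr \<nu>"
          using tn0 p1 t_1_pos t_pos[of n0] n0 \<nu> by (intro powr_mono2) (auto simp: divide_simps mult_ac)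
        also have "\<dots> = p powr (-\<nu>)" using p1 by (simp add: powr_divide powr_minus divide_simps)
        finally have "q2 * (t 1 / t n0) powr \<nu> \<le> q2 * p powr (-\<nu>)" using q by (intro mult_left_mono) auto
        then have "c1 \<le> q1 - q2 * (t 1 / t n0) powr \<nu>" using p2 by (simp add: c1_def min_def)
        then have "c1 * (t 1 / t m) powr \<theta> \<le> (q1 - q2 * (t 1 / t n0) powr \<nu>) * (t 1 / t m) powr \<theta>"
          by (rule mult_right_mono) simp
        also have "\<dots> \<le> L1_sum m (comb_barrier \<theta> n0)"
          unfolding q1_def q2_def using False m n0 \<theta> \<nu> D eps by (intro L1_sum_comb_barrier_ge) auto
        finally show ?thesis .
      qed
      then have "1 / c1 * (c1 * (t 1 / t m) powr \<theta>) \<le> 1 / c1 * L1_sum m (comb_barrier \<theta> n0)"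
        using c1 by (intro mult_left_mono) auto
      then show "(t 1 / t m) powr \<theta> \<le> L1_sum m S" using c1 L1_sum_cmult[of m "1 / c1" "comb_barrier \<theta> n0"]
        by (simp add: S_def[abs_def])
    qed
  qed
qed

section \<open>Integral inequalities for \<open>L\<^sub>p\<close> bounds\<close>

text \<open>For \<open>p = 2\<close> and \<open>p = \<infinity>\<close> only; every other exponent is treated as \<open>2\<close>.\<close>

definition Lp_le :: "ennreal \<Rightarrow> 'a measure \<Rightarrow> ('a \<Rightarrow> ennreal) \<Rightarrow> real \<Rightarrow> bool" where
  "Lp_le p M F C \<longleftrightarrow> (if p = \<infinity> then AE x in M. F x \<le> ennreal C else (\<integral>\<^sup>+x. (F x)\<^sup>2 \<partial>M) \<le> ennreal (C\<^sup>2))"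

lemma Lp_le_mono:
  assumes "Lp_le p M G C" "\<And>x. x \<in> space M \<Longrightarrow> F x \<le> G x" "0 \<le> C" "C \<le> D"
  shows "Lp_le p M F D"
proof (cases "p = \<infinity>")
  case True
  then have "AE x in M. G x \<le> ennreal C" using assms(1) by (simp add: Lp_le_def)
  then have "AE x in M. F x \<le> ennreal D"
    using AE_space by eventually_elim (use assms in \<open>meson ennreal_leI order_trans\<close>)
  then show ?thesis using True by (simp add: Lp_le_def)
next
  case False
  have "(\<integral>\<^sup>+x. (F x)\<^sup>2 \<partial>M) \<le> (\<integral>\<^sup>+x. (G x)\<^sup>2 \<partial>M)"
    using assms by (intro nn_integral_mono power_mono) auto
  also have "\<dots> \<le> ennreal (C\<^sup>2)" using assms False by (simp add: Lp_le_def)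
  also have "\<dots> \<le> ennreal (D\<^sup>2)" using assms by (intro ennreal_leI power_mono) auto
  finally show ?thesis using False by (simp add: Lp_le_def)
qed

text \<open>
  Given the bound \<open>\<rho>\<close> of the norms, Minkowski's integral inequality for \<open>p = 2\<close> is the
  Cauchy--Schwarz inequality in \<open>s\<close> with weight \<open>\<rho>\<close>, followed by Fubini.
\<close>

lemma Lp_le_integral:
  fixes G :: "'a \<Rightarrow> 'b \<Rightarrow> ennreal" and w \<rho> :: "'b \<Rightarrow> real"
  assumes sf: "sigma_finite_measure M" "sigma_finite_measure N"
    and G: "(\<lambda>(x, s). G x s) \<in> borel_measurable (M \<Otimes>\<^sub>M N)"
    and w[measurable]: "w \<in> borel_measurable N" "\<And>s. 0 \<le> w s"
    and \<rho>[measurable]: "\<rho> \<in> borel_measurable N" "\<And>s. s \<in> space N \<Longrightarrow> 0 < \<rho> s"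
    and le: "\<And>s. s \<in> space N \<Longrightarrow> Lp_le p M (\<lambda>x. G x s) (\<rho> s)"
    and C: "(\<integral>\<^sup>+s. ennreal (w s * \<rho> s) \<partial>N) \<le> ennreal C" "0 \<le> C"
  shows "Lp_le p M (\<lambda>x. \<integral>\<^sup>+s. ennreal (w s) * G x s \<partial>N) C"
proof -
  interpret M: sigma_finite_measure M by fact
  interpret N: sigma_finite_measure N by fact
  interpret pair_sigma_finite M N ..
  have [measurable]: "(\<lambda>x. G (fst x) (snd x)) \<in> borel_measurable (M \<Otimes>\<^sub>M N)"
    using G by (simp add: case_prod_beta')
  have Gx[measurable]: "G x \<in> borel_measurable N" if "x \<in> space M" for x
    using measurable_Pair2[OF G that] by simp
  show ?thesis
  proof (cases "p = \<infinity>")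
    case True
    \<comment> \<open>The exceptional set of \<open>x\<close> depends on \<open>s\<close>; Fubini
      exchanges the two quantifiers, which needs the joint measurability shown next.\<close>
    have "AE s in N. AE x in M. G x s \<le> ennreal (\<rho> s)"
      using le True by (auto simp: Lp_le_def)
    moreover have "{x \<in> space (M \<Otimes>\<^sub>M N). G (fst x) (snd x) \<le> ennreal (\<rho> (snd x))} \<in> sets (M \<Otimes>\<^sub>M N)"
      by measurable
    ultimately have "AE x in M. AE s in N. G x s \<le> ennreal (\<rho> s)"
      using AE_commute[of "\<lambda>x s. G x s \<le> ennreal (\<rho> s)"] by simp
    then have "AE x in M. (\<integral>\<^sup>+s. ennreal (w s) * G x s \<partial>N) \<le> ennreal C"
    proof eventually_elim
      case (elim x)
      have "(\<integral>\<^sup>+s. ennreal (w s) * G x s \<partial>N) \<le> (\<integral>\<^sup>+s. ennreal (w s * \<rho> s) \<partial>N)"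
        using elim by (intro nn_integral_mono_AE) (auto elim!: eventually_mono simp: ennreal_mult' w intro!: mult_left_mono)
      then show ?case using C by simp
    qed
    then show ?thesis using True by (simp add: Lp_le_def)
  next
    case False
    have "(\<integral>\<^sup>+x. (\<integral>\<^sup>+s. ennreal (w s) * G x s \<partial>N)\<^sup>2 \<partial>M) \<le> (\<integral>\<^sup>+x. ennreal C * (\<integral>\<^sup>+s. ennreal (w s / \<rho> s) * (G x s)\<^sup>2 \<partial>N) \<partial>M)"
    proof (rule nn_integral_mono)
      fix x assume x: "x \<in> space M"
      note [measurable] = Gx[OF x]
      have "(\<integral>\<^sup>+s. ennreal (w s) * G x s \<partial>N) = (\<integral>\<^sup>+s. ennreal (sqrt (w s * \<rho> s)) * (ennreal (sqrt (w s / \<rho> s)) * G x s) \<partial>N)"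
      proof (rule nn_integral_cong)
        fix s assume s: "s \<in> space N"
        have "sqrt (w s * \<rho> s) * sqrt (w s / \<rho> s) = w s"
          using \<rho>(2)[OF s] w(2)[of s] by (simp flip: real_sqrt_mult)
        then show "ennreal (w s) * G x s = ennreal (sqrt (w s * \<rho> s)) * (ennreal (sqrt (w s / \<rho> s)) * G x s)"
          using \<rho>(2)[OF s] w(2)[of s] by (simp add: mult.assoc[symmetric] flip: ennreal_mult)
      qed
      also have "\<dots>\<^sup>2 \<le> (\<integral>\<^sup>+s. (ennreal (sqrt (w s * \<rho> s)))\<^sup>2 \<partial>N) * (\<integral>\<^sup>+s. (ennreal (sqrt (w s / \<rho> s)) * G x s)\<^sup>2 \<partial>N)"
        by (rule Cauchy_Schwarz_nn_integral) measurable
      also have "(\<integral>\<^sup>+s. (ennreal (sqrt (w s * \<rho> s)))\<^sup>2 \<partial>N) = (\<integral>\<^sup>+s. ennreal (w s * \<rho> s) \<partial>N)"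
        using \<rho>(2) w(2) by (intro nn_integral_cong) (auto simp: ennreal_power less_imp_le)
      also have "(\<integral>\<^sup>+s. (ennreal (sqrt (w s / \<rho> s)) * G x s)\<^sup>2 \<partial>N) = (\<integral>\<^sup>+s. ennreal (w s / \<rho> s) * (G x s)\<^sup>2 \<partial>N)"
        using \<rho>(2) w(2) by (intro nn_integral_cong) (auto simp: ennreal_power less_imp_le power_mult_distrib)
      finally show "(\<integral>\<^sup>+s. ennreal (w s) * G x s \<partial>N)\<^sup>2 \<le> ennreal C * (\<integral>\<^sup>+s. ennreal (w s / \<rho> s) * (G x s)\<^sup>2 \<partial>N)"
        using C(1) by (meson mult_right_mono order_trans zero_le)
    qed
    also have "\<dots> = ennreal C * (\<integral>\<^sup>+x. (\<integral>\<^sup>+s. ennreal (w s / \<rho> s) * (G x s)\<^sup>2 \<partial>N) \<partial>M)"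
      by (intro nn_integral_cmult) measurable
    also have "(\<integral>\<^sup>+x. (\<integral>\<^sup>+s. ennreal (w s / \<rho> s) * (G x s)\<^sup>2 \<partial>N) \<partial>M) = (\<integral>\<^sup>+s. (\<integral>\<^sup>+x. ennreal (w s / \<rho> s) * (G x s)\<^sup>2 \<partial>M) \<partial>N)"
      by (rule Fubini'[symmetric]) measurable
    also have "\<dots> \<le> (\<integral>\<^sup>+s. ennreal (w s * \<rho> s) \<partial>N)"
    proof (rule nn_integral_mono)
      fix s assume s: "s \<in> space N"
      have [measurable]: "(\<lambda>x. G x s) \<in> borel_measurable M"
        using measurable_Pair1[OF G s] by simp
      have "(\<integral>\<^sup>+x. ennreal (w s / \<rho> s) * (G x s)\<^sup>2 \<partial>M) = ennreal (w s / \<rho> s) * (\<integral>\<^sup>+x. (G x s)\<^sup>2 \<partial>M)"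
        by (intro nn_integral_cmult) measurable
      also have "\<dots> \<le> ennreal (w s / \<rho> s) * ennreal ((\<rho> s)\<^sup>2)"
        using le[OF s] False by (intro mult_left_mono) (auto simp: Lp_le_def)
      also have "\<dots> = ennreal (w s * \<rho> s)"
        using \<rho>(2)[OF s] w(2)[of s] by (simp add: power2_eq_square flip: ennreal_mult)
      finally show "(\<integral>\<^sup>+x. ennreal (w s / \<rho> s) * (G x s)\<^sup>2 \<partial>M) \<le> ennreal (w s * \<rho> s)" .
    qed
    also have "\<dots> \<le> ennreal C" by (rule C)
    finally have "(\<integral>\<^sup>+x. (\<integral>\<^sup>+s. ennreal (w s) * G x s \<partial>N)\<^sup>2 \<partial>M) \<le> ennreal C * ennreal C"
      by (simp add: mult_left_mono)
    then show ?thesis using False C(2) by (simp add: Lp_le_def power2_eq_square ennreal_mult)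
  qed
qed

text \<open>A finite sum is an integral over a counting measure. The modified weight
  \<open>w'\<close> is nonnegative outside \<open>I\<close> as well, as
  \<open>Lp_le_integral\<close> demands.\<close>

lemma Lp_le_sum:
  fixes G :: "'i \<Rightarrow> 'a \<Rightarrow> ennreal" and w \<rho> :: "'i \<Rightarrow> real"
  assumes sf: "sigma_finite_measure M" and I: "finite I"
    and G: "\<And>i. i \<in> I \<Longrightarrow> G i \<in> borel_measurable M"
    and w: "\<And>i. i \<in> I \<Longrightarrow> 0 \<le> w i" and \<rho>: "\<And>i. i \<in> I \<Longrightarrow> 0 < \<rho> i"
    and le: "\<And>i. i \<in> I \<Longrightarrow> Lp_le p M (G i) (\<rho> i)"
  shows "Lp_le p M (\<lambda>x. \<Sum>i\<in>I. ennreal (w i) * G i x) (\<Sum>i\<in>I. w i * \<rho> i)"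
proof -
  define w' where "w' i = max 0 (w i)" for i
  have w'_eq: "w' i = w i" if "i \<in> I" for i using w[OF that] by (simp add: w'_def)
  have "Lp_le p M (\<lambda>x. \<integral>\<^sup>+i. ennreal (w' i) * G i x \<partial>count_space I) (\<Sum>i\<in>I. w i * \<rho> i)"
  proof (rule Lp_le_integral[OF sf, where \<rho> = \<rho>])
    show "sigma_finite_measure (count_space I)" using I by (rule sigma_finite_measure_count_space_finite)
    show "(\<lambda>(x, i). G i x) \<in> borel_measurable (M \<Otimes>\<^sub>M count_space I)"
      unfolding case_prod_beta'
      by (rule measurable_compose_countable'[where I = I]) (use I G in \<open>auto simp: countable_finite intro: measurable_compose[OF measurable_fst]\<close>)
    show "(\<integral>\<^sup>+i. ennreal (w' i * \<rho> i) \<partial>count_space I) \<le> ennreal (\<Sum>i\<in>I. w i * \<rho> i)"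
      using I w \<rho> by (simp add: nn_integral_count_space_finite w'_eq sum_ennreal less_imp_le)
    show "0 \<le> (\<Sum>i\<in>I. w i * \<rho> i)" using w \<rho> by (auto intro!: sum_nonneg simp: less_imp_le)
  qed (use \<rho> le in \<open>auto simp: w'_def\<close>)
  then show ?thesis using I by (simp add: nn_integral_count_space_finite w'_eq cong: sum.cong)
qed

section \<open>Borel and Lebesgue measure on the domain\<close>

lemma space_lborel_on [simp]: "space (restrict_space lborel \<Omega>) = \<Omega>"
  by (simp add: space_restrict_space)

lemma sigma_finite_lborel_on: "\<Omega> \<in> sets borel \<Longrightarrow> sigma_finite_measure (restrict_space lborel \<Omega>)"
  by (intro sigma_finite_measure_restrict_space) (auto simp: lborel.sigma_finite_measure_axioms)

lemma nn_integral_lborel_on: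
  assumes "\<Omega> \<in> sets borel"
  shows "(\<integral>\<^sup>+x. f x \<partial>restrict_space lborel \<Omega>) = (\<integral>\<^sup>+x. f x * indicator \<Omega> x \<partial>lborel)"
    "(\<integral>\<^sup>+x. f x \<partial>lebesgue_on \<Omega>) = (\<integral>\<^sup>+x. f x * indicator \<Omega> x \<partial>lborel)"
  using assms by (simp_all add: nn_integral_restrict_space nn_integral_completion)

lemma AE_lborel_on:
  assumes "\<Omega> \<in> sets borel"
  shows "(AE x in restrict_space lborel \<Omega>. P x) \<longleftrightarrow> (AE x in lborel. x \<in> \<Omega> \<longrightarrow> P x)"
    "(AE x in lebesgue_on \<Omega>. P x) \<longleftrightarrow> (AE x in lborel. x \<in> \<Omega> \<longrightarrow> P x)"
  using assms by (simp_all add: AE_restrict_space_iff AE_completion_iff)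

text \<open>The norm lives on the completed measure, while the Fubini arguments run on products of
  Borel measures. Completion changes neither nonnegative integrals nor almost-everywhere statements;
  only the measurability that a finite norm entails has to be kept as a separate conjunct.\<close>

lemma Lp_norm_le_iff:
  fixes g :: "real ^ 'd::finite \<Rightarrow> real"
  assumes p: "p \<in> {2, \<infinity>}" and \<Omega>: "\<Omega> \<in> sets borel" and C: "0 \<le> C"
  shows "Lp_norm p \<Omega> g \<le> ennreal C \<longleftrightarrow>
    g \<in> borel_measurable (lebesgue_on \<Omega>) \<and> Lp_le p (restrict_space lborel \<Omega>) (\<lambda>x. ennreal \<bar>g x\<bar>) C"
proof (cases "g \<in> borel_measurable (lebesgue_on \<Omega>)")
  case False
  then show ?thesis by (simp add: Lp_norm_def top_unique)
next
  case g: True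
  show ?thesis
  proof (cases "p = \<infinity>")
    case True
    have "esssup (lebesgue_on \<Omega>) (\<lambda>x. ennreal \<bar>g x\<bar>) \<le> ennreal C \<longleftrightarrow> (AE x in lebesgue_on \<Omega>. ennreal \<bar>g x\<bar> \<le> ennreal C)"
    proof
      assume le: "esssup (lebesgue_on \<Omega>) (\<lambda>x. ennreal \<bar>g x\<bar>) \<le> ennreal C"
      show "AE x in lebesgue_on \<Omega>. ennreal \<bar>g x\<bar> \<le> ennreal C"
        using esssup_AE[of "\<lambda>x. ennreal \<bar>g x\<bar>" "lebesgue_on \<Omega>"] by eventually_elim (use le in \<open>auto intro: order_trans\<close>)
    next
      assume "AE x in lebesgue_on \<Omega>. ennreal \<bar>g x\<bar> \<le> ennreal C"
      then show "esssup (lebesgue_on \<Omega>) (\<lambda>x. ennreal \<bar>g x\<bar>) \<le> ennreal C" using g by (intro esssup_I) auto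
    qed
    then show ?thesis using True g \<Omega> by (simp add: Lp_norm_def Lp_le_def AE_lborel_on)
  next
    case False
    then have p2: "p = 2" using p by simp
    have e2: "enn2real 2 = 2" by (metis enn2real_ennreal ennreal_numeral zero_le_numeral)
    define I where "I = (\<integral>\<^sup>+x. (ennreal \<bar>g x\<bar>)\<^sup>2 \<partial>lebesgue_on \<Omega>)"
    have I: "(\<integral>\<^sup>+x. ennreal (\<bar>g x\<bar> powr enn2real p) \<partial>lebesgue_on \<Omega>) = I"
      unfolding I_def p2 e2 by (intro nn_integral_cong) (auto simp: ennreal_power)
    have "Lp_norm p \<Omega> g = (if I = \<infinity> then \<infinity> else ennreal (sqrt (enn2real I)))"
      using g False by (simp add: Lp_norm_def I Let_def) (simp add: p2 e2 powr_half_sqrt)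
    also have "\<dots> \<le> ennreal C \<longleftrightarrow> I \<le> ennreal (C\<^sup>2)"
    proof (cases I)
      case (real r)
      moreover have "sqrt r \<le> C \<longleftrightarrow> r \<le> C\<^sup>2"
        using real C real_le_lsqrt[of C r] sqrt_le_D[of r C] by auto
      ultimately show ?thesis using C by auto
    qed (auto simp: top_unique)
    finally show ?thesis using g False \<Omega> by (simp add: I_def Lp_le_def nn_integral_lborel_on)
  qed
qed

section \<open>The truncation error\<close>

lemma set_integrable_nonneg_has_integral:
  fixes f :: "real \<Rightarrow> real"
  assumes "(f has_integral I) S" "\<And>x. x \<in> S \<Longrightarrow> 0 \<le> f x" "(\<lambda>x. indicator S x * f x) \<in> borel_measurable borel"
  shows "set_integrable lborel S f" "(LINT x:S|lborel. f x) = I"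
proof -
  have "f absolutely_integrable_on S"
    using assms by (intro nonnegative_absolutely_integrable_1) (auto simp: integrable_on_def)
  then show *: "set_integrable lborel S f"
    using assms(3) unfolding set_integrable_def by (subst (asm) integrable_completion) auto
  show "(LINT x:S|lborel. f x) = I"
    using set_borel_integral_eq_integral(2)[OF *] assms(1) by (simp add: integral_unique)
qed

lemma set_integral_FTC:
  fixes F f :: "real \<Rightarrow> real"
  assumes ab: "a \<le> b" and F: "continuous_on {a..b} F" "\<And>x. a < x \<Longrightarrow> x < b \<Longrightarrow> (F has_real_derivative f x) (at x)"
    and f: "set_integrable lborel {a<..<b} f"
  shows "(LINT x:{a<..<b}|lborel. f x) = F b - F a"
proof -
  have "(f has_integral (F b - F a)) {a..b}"
    using F ab by (intro fundamental_theorem_of_calculus_interior) (auto simp: has_real_derivative_iff_has_vector_derivative)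
  then have "(f has_integral (F b - F a)) {a<..<b}" by (simp add: has_integral_Icc_iff_Ioo)
  then show ?thesis using set_borel_integral_eq_integral(2)[OF f] by (simp add: integral_unique)
qed

lemma kernel_integral:
  fixes \<alpha> a b d :: real
  assumes "\<alpha> < 1" "a \<le> b" "b \<le> d"
  shows "set_integrable lborel {a<..<b} (\<lambda>s. (d - s) powr (-\<alpha>))"
    "(LINT s:{a<..<b}|lborel. (d - s) powr (-\<alpha>)) = ((d - a) powr (1 - \<alpha>) - (d - b) powr (1 - \<alpha>)) / (1 - \<alpha>)"
proof -
  define F where "F s = - ((d - s) powr (1 - \<alpha>)) / (1 - \<alpha>)" for s
  have "continuous_on {a..b} (\<lambda>s. (d - s) powr (1 - \<alpha>))"
    using assms by (intro continuous_on_powr' continuous_on_diff continuous_on_const continuous_on_id) auto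
  then have "continuous_on {a..b} F" unfolding F_def using assms(1)
    by (intro continuous_on_divide continuous_on_minus continuous_on_const) auto
  moreover have "(F has_real_derivative (d - s) powr (-\<alpha>)) (at s)" if "s < b" for s
    unfolding F_def using that assms by (auto intro!: derivative_eq_intros)
  ultimately have "((\<lambda>s. (d - s) powr (-\<alpha>)) has_integral (F b - F a)) {a..b}"
    using assms by (intro fundamental_theorem_of_calculus_interior) (auto simp: has_real_derivative_iff_has_vector_derivative)
  then have I: "((\<lambda>s. (d - s) powr (-\<alpha>)) has_integral (F b - F a)) {a<..<b}" by (simp add: has_integral_Icc_iff_Ioo)
  show "set_integrable lborel {a<..<b} (\<lambda>s. (d - s) powr (-\<alpha>))"
    by (rule set_integrable_nonneg_has_integral(1)[OF I]) auto
  have "(LINT s:{a<..<b}|lborel. (d - s) powr (-\<alpha>)) = F b - F a"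
    by (rule set_integrable_nonneg_has_integral(2)[OF I]) auto
  then show "(LINT s:{a<..<b}|lborel. (d - s) powr (-\<alpha>)) = ((d - a) powr (1 - \<alpha>) - (d - b) powr (1 - \<alpha>)) / (1 - \<alpha>)"
    by (simp add: F_def diff_divide_distrib)
qed

section \<open>Consistency error of the L1 operator for a scalar function of time\<close>

context fine_mesh
begin

lemma set_integral_mesh:
  fixes f :: "real \<Rightarrow> real"
  assumes "n \<le> N" "set_integrable lborel {0<..<t n} f"
  shows "(LINT s:{0<..<t n}|lborel. f s) = (\<Sum>j<n. LINT s:{t j<..<t (Suc j)}|lborel. f s)"
proof -
  have ind: "indicator {0<..<t k} s = (\<Sum>j<k. indicator {t j<..<t (Suc j)} s :: real)" if "k \<le> N" "s \<notin> t ` {..N}" for k s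
    using that(1)
  proof (induction k)
    case 0
    then show ?case by (simp add: t_0)
  next
    case (Suc k)
    have "s \<noteq> t k" using that(2) Suc.prems by auto
    moreover have "0 \<le> t k" "t k < t (Suc k)" using t_le[of 0 k] t_less_Suc[of k] t_0 Suc.prems by auto
    ultimately have "indicator {0<..<t (Suc k)} s = (indicator {0<..<t k} s + indicator {t k<..<t (Suc k)} s :: real)"
      by (auto simp: indicator_def)
    then show ?case using Suc by simp
  qed
  have "finite (t ` {..N})" by simp
  then have "AE s in lborel. s \<notin> t ` {..N}"
    by (intro AE_not_in finite_imp_null_set_lborel)
  then have ae: "AE s in lborel. indicator {0<..<t n} s *\<^sub>R f s = (\<Sum>j<n. indicator {t j<..<t (Suc j)} s *\<^sub>R f s)"
  proof eventually_elim
    case (elim s)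
    show ?case unfolding ind[OF assms(1) elim] scaleR_sum_left ..
  qed
  have si: "set_integrable lborel {t j<..<t (Suc j)} f" if "j < n" for j
    using assms(2)
  proof (rule set_integrable_subset)
    show "{t j<..<t (Suc j)} \<subseteq> {0<..<t n}"
      using t_le[of 0 j] t_le[of "Suc j" n] that assms(1) t_0 by auto
  qed simp
  have "(LINT s:{0<..<t n}|lborel. f s) = (\<integral>s. (\<Sum>j<n. indicator {t j<..<t (Suc j)} s *\<^sub>R f s) \<partial>lborel)"
    unfolding set_lebesgue_integral_def
  proof (rule integral_cong_AE)
    show "(\<lambda>s. indicator {0<..<t n} s *\<^sub>R f s) \<in> borel_measurable lborel"
      using assms(2) by (auto simp: set_integrable_def)
    show "(\<lambda>s. \<Sum>j<n. indicator {t j<..<t (Suc j)} s *\<^sub>R f s) \<in> borel_measurable lborel"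
      using si by (intro borel_measurable_sum) (auto simp: set_integrable_def)
  qed (rule ae)
  also have "\<dots> = (\<Sum>j<n. LINT s:{t j<..<t (Suc j)}|lborel. f s)"
    unfolding set_lebesgue_integral_def using si by (intro Bochner_Integration.integral_sum) (auto simp: set_integrable_def)
  finally show ?thesis .
qed

text \<open>The kernel minus its mean integrates to zero, so \<open>V' b\<close> may be subtracted
  from \<open>V'\<close>, and the difference is at most the integral of
  \<open>\<bar>V''\<bar>\<close>. The bound is an extended real, since pointwise in space
  \<open>V''\<close> need not be integrable; if it is not, the right-hand side is infinite.\<close>

lemma truncation_interval:
  assumes j: "1 \<le> j" "j < m" "m \<le> N"
    and cV: "continuous_on {t j..t (Suc j)} V" and dV: "\<And>s. t j < s \<Longrightarrow> s < t (Suc j) \<Longrightarrow> (V has_real_derivative V' s) (at s)"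
    and cV': "continuous_on {t j..t (Suc j)} V'" and dV': "\<And>s. t j < s \<Longrightarrow> s < t (Suc j) \<Longrightarrow> (V' has_real_derivative V'' s) (at s)"
    and V': "set_integrable lborel {t j<..<t (Suc j)} V'"
      "set_integrable lborel {t j<..<t (Suc j)} (\<lambda>s. (t m - s) powr (-\<alpha>) * V' s)"
    and V'': "set_borel_measurable borel {t j<..<t (Suc j)} V''"
  shows "ennreal \<bar>(V (t (Suc j)) - V (t j)) * ker_avg m j - (LINT s:{t j<..<t (Suc j)}|lborel. (t m - s) powr (-\<alpha>) * V' s)\<bar>
    \<le> ennreal (2 * ker_osc m j) * (\<integral>\<^sup>+s. ennreal \<bar>V'' s\<bar> * indicator {t j<..<t (Suc j)} s \<partial>lborel)"
proof -
  define a b where "a = t j" and "b = t (Suc j)"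
  have ab: "a < b" "b \<le> t m" using t_less_Suc[of j] t_le[of "Suc j" m] j by (auto simp: a_def b_def)
  define k where "k s = (t m - s) powr (-\<alpha>)" for s
  define A where "A = ker_avg m j"
  define q where "q = ker_osc m j / (b - a)"
  define Z where "Z = (\<integral>\<^sup>+s. ennreal \<bar>V'' s\<bar> * indicator {a<..<b} s \<partial>lborel)"
  have osc: "0 < ker_osc m j" using ker_osc_pos j by simp
  show ?thesis
  proof (cases "Z = \<infinity>")
    case True
    then show ?thesis using osc unfolding Z_def a_def b_def by (simp add: ennreal_mult_top)
  next
    case False
    have eZ: "Z = (\<integral>\<^sup>+s. ennreal (norm (indicator {a<..<b} s *\<^sub>R V'' s)) \<partial>lborel)"
      unfolding Z_def by (intro nn_integral_cong) (auto simp: indicator_def)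
    have mV'': "(\<lambda>s. indicator {a<..<b} s *\<^sub>R V'' s) \<in> borel_measurable lborel"
      using V'' by (simp add: set_borel_measurable_def a_def b_def)
    have iV'': "set_integrable lborel {a<..<b} V''"
      unfolding set_integrable_def using mV'' False eZ by (intro integrableI_bounded) (auto simp: top.not_eq_extremum)
    obtain z where z: "Z = ennreal z" "0 \<le> z" using False by (cases Z) auto
    have diff_le: "\<bar>V' b - V' s\<bar> \<le> z" if s: "a < s" "s < b" for s
    proof -
      have sub: "set_integrable lborel {s<..<b} V''" using iV'' by (rule set_integrable_subset) (use s in auto)
      have "(LINT x:{s<..<b}|lborel. V'' x) = V' b - V' s"
      proof (rule set_integral_FTC)
        show "continuous_on {s..b} V'" using cV' by (rule continuous_on_subset) (use s in \<open>auto simp: a_def b_def\<close>)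
      qed (use s sub dV' in \<open>auto simp: a_def b_def\<close>)
      moreover have "ennreal (norm (LINT x:{s<..<b}|lborel. V'' x)) \<le> Z"
      proof -
        have "ennreal (norm (LINT x:{s<..<b}|lborel. V'' x)) \<le> (\<integral>\<^sup>+x. ennreal (norm (indicator {s<..<b} x *\<^sub>R V'' x)) \<partial>lborel)"
          unfolding set_lebesgue_integral_def using sub by (intro integral_norm_bound_ennreal) (simp add: set_integrable_def)
        also have "\<dots> \<le> Z" unfolding eZ using s by (intro nn_integral_mono) (auto simp: indicator_def)
        finally show ?thesis .
      qed
      ultimately have "ennreal \<bar>V' b - V' s\<bar> \<le> ennreal z" using z by simp
      then show ?thesis using z by (subst (asm) ennreal_le_iff) auto
    qed
    have V'i: "set_integrable lborel {a<..<b} V'" "set_integrable lborel {a<..<b} (\<lambda>s. k s * V' s)"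
      using V' by (auto simp: a_def b_def k_def)
    have ki: "set_integrable lborel {a<..<b} k" "(LINT s:{a<..<b}|lborel. k s) = ker_int m j"
      using kernel_integral[of \<alpha> a b "t m"] \<alpha> ab by (auto simp: k_def[abs_def] ker_int_def a_def b_def)
    have ci: "set_integrable lborel {a<..<b} (\<lambda>s. d)" "(LINT s:{a<..<b}|lborel. d) = d * (b - a)" for d :: real
      using ab by (auto simp: set_integrable_def set_lebesgue_integral_def)
    have ftc: "(LINT s:{a<..<b}|lborel. V' s) = V b - V a"
      using cV dV V'i ab by (intro set_integral_FTC) (auto simp: a_def b_def)
    have A_int: "A * (b - a) = ker_int m j" using mult_ker_avg[of j m] j by (simp add: A_def a_def b_def mult.commute)
    have D: "(V b - V a) * A - (LINT s:{a<..<b}|lborel. k s * V' s) = (LINT s:{a<..<b}|lborel. (A - k s) * (V' s - V' b))"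
    proof -
      have "(LINT s:{a<..<b}|lborel. (A - k s) * (V' s - V' b)) = (LINT s:{a<..<b}|lborel. (A * V' s - k s * V' s) - (V' b * A - V' b * k s))"
        by (simp add: algebra_simps)
      also have "\<dots> = A * (V b - V a) - (LINT s:{a<..<b}|lborel. k s * V' s) - (V' b * A * (b - a) - V' b * ker_int m j)"
        using V'i ki ci by (simp add: ftc set_integral_diff)
      also have "V' b * A * (b - a) - V' b * ker_int m j = 0" using A_int by (simp add: mult.assoc)
      finally show ?thesis by (simp add: mult.commute)
    qed
    have "\<bar>LINT s:{a<..<b}|lborel. (A - k s) * (V' s - V' b)\<bar> \<le> (LINT s:{a<..<b}|lborel. z * (2 * q - (A - k s)))"
    proof -
      have bnd: "\<bar>(A - k s) * (V' s - V' b)\<bar> \<le> z * (2 * q - (A - k s))" if "a < s" "s < b" for s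
      proof -
        have "A - k s \<le> q" using ker_avg_minus_kernel_le[of j m s] that j by (simp add: A_def k_def q_def a_def b_def)
        moreover have "0 < q" using osc ab by (simp add: q_def)
        \<comment> \<open>The upper bound \<open>q\<close> on \<open>A - k s\<close> yields a
          majorant of its absolute value whose integral is exactly \<open>2 * ker_osc m j\<close>,
          again by the zero mean.\<close>
        ultimately have "\<bar>A - k s\<bar> \<le> 2 * q - (A - k s)" by (auto simp: abs_le_iff)
        then have "\<bar>A - k s\<bar> * \<bar>V' s - V' b\<bar> \<le> (2 * q - (A - k s)) * z"
          using diff_le[OF that] by (intro mult_mono) (auto simp: abs_minus_commute)
        then show ?thesis by (simp add: abs_mult mult.commute)
      qed
      have int1: "set_integrable lborel {a<..<b} (\<lambda>s. (A * V' s - k s * V' s) - (V' b * A - V' b * k s))"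
        using V'i ki ci by (intro set_integral_diff) auto
      then have int1': "set_integrable lborel {a<..<b} (\<lambda>s. (A - k s) * (V' s - V' b))"
        by (simp add: algebra_simps)
      have int2: "set_integrable lborel {a<..<b} (\<lambda>s. z * (2 * q - (A - k s)))"
        using ki ci by (auto intro!: set_integral_diff)
      have "norm (LINT s:{a<..<b}|lborel. (A - k s) * (V' s - V' b)) \<le> (LINT s:{a<..<b}|lborel. norm ((A - k s) * (V' s - V' b)))"
        by (rule set_integral_norm_bound[OF int1'])
      also have "\<dots> \<le> (LINT s:{a<..<b}|lborel. z * (2 * q - (A - k s)))"
        using bnd int1' int2 by (intro set_integral_mono set_integrable_norm) auto
      finally show ?thesis by simp
    qed
    also have "\<dots> = z * (2 * q * (b - a) - (A * (b - a) - ker_int m j))"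
      using ki ci by (simp add: set_integral_diff)
    also have "\<dots> = z * (2 * ker_osc m j)" using A_int ab by (simp add: q_def)
    finally have "\<bar>(V b - V a) * A - (LINT s:{a<..<b}|lborel. k s * V' s)\<bar> \<le> 2 * ker_osc m j * z" unfolding D by (simp add: mult.commute)
    then have "ennreal \<bar>(V b - V a) * A - (LINT s:{a<..<b}|lborel. k s * V' s)\<bar> \<le> ennreal (2 * ker_osc m j) * Z"
      using osc z by (simp add: ennreal_leI flip: ennreal_mult)
    then show ?thesis unfolding Z_def A_def k_def a_def b_def .
  qed
qed

text \<open>On the first interval a second derivative of size \<open>s powr (\<alpha> - 2)\<close>
  is not integrable, so the error is expressed by the first derivative.\<close>

lemma truncation_first_interval:
  assumes m: "1 \<le> m" "m \<le> N"
    and cV: "continuous_on {0..t 1} V" and dV: "\<And>s. 0 < s \<Longrightarrow> s < t 1 \<Longrightarrow> (V has_real_derivative V' s) (at s)"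
    and V': "set_integrable lborel {0<..<t 1} V'" "set_integrable lborel {0<..<t 1} (\<lambda>s. (t m - s) powr (-\<alpha>) * V' s)"
  shows "ennreal \<bar>(V (t 1) - V 0) * ker_avg m 0 - (LINT s:{0<..<t 1}|lborel. (t m - s) powr (-\<alpha>) * V' s)\<bar>
    \<le> (\<integral>\<^sup>+s. ennreal (\<bar>ker_avg m 0 - (t m - s) powr (-\<alpha>)\<bar> * indicator {0<..<t 1} s) * ennreal \<bar>V' s\<bar> \<partial>lborel)"
proof -
  define k where "k s = (t m - s) powr (-\<alpha>)" for s
  define A where "A = ker_avg m 0"
  have V'i: "set_integrable lborel {0<..<t 1} V'" "set_integrable lborel {0<..<t 1} (\<lambda>s. k s * V' s)"
    using V' by (auto simp: k_def)
  have ftc: "(LINT s:{0<..<t 1}|lborel. V' s) = V (t 1) - V 0"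
    using cV dV V'i t_1_pos by (intro set_integral_FTC) auto
  have int: "set_integrable lborel {0<..<t 1} (\<lambda>s. A * V' s - k s * V' s)"
    using V'i by (intro set_integral_diff) auto
  have "(V (t 1) - V 0) * A - (LINT s:{0<..<t 1}|lborel. k s * V' s) = (LINT s:{0<..<t 1}|lborel. A * V' s - k s * V' s)"
  proof -
    have "set_integrable lborel {0<..<t 1} (\<lambda>s. A * V' s)" using V'i by auto
    from set_integral_diff(2)[OF this V'i(2)] show ?thesis
      by (simp only: set_integral_mult_right ftc) (simp only: mult.commute)
  qed
  then have "ennreal \<bar>(V (t 1) - V 0) * A - (LINT s:{0<..<t 1}|lborel. k s * V' s)\<bar> \<le>
    (\<integral>\<^sup>+s. ennreal (norm (indicator {0<..<t 1} s *\<^sub>R (A * V' s - k s * V' s))) \<partial>lborel)"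
    using integral_norm_bound_ennreal[of lborel "\<lambda>s. indicator {0<..<t 1} s *\<^sub>R (A * V' s - k s * V' s)"] int
    by (simp add: set_lebesgue_integral_def set_integrable_def)
  also have "\<dots> = (\<integral>\<^sup>+s. ennreal (\<bar>A - k s\<bar> * indicator {0<..<t 1} s) * ennreal \<bar>V' s\<bar> \<partial>lborel)"
    by (intro nn_integral_cong) (auto simp: indicator_def abs_mult left_diff_distrib[symmetric] simp flip: ennreal_mult)
  finally show ?thesis unfolding A_def k_def .
qed

lemma truncation_pointwise:
  assumes m: "1 \<le> m" "m \<le> N"
    and cV: "continuous_on {0..t m} V" and dV: "\<And>s. 0 < s \<Longrightarrow> s < t m \<Longrightarrow> (V has_real_derivative V' s) (at s)"
    and cV': "continuous_on {0<..t m} V'" and dV': "\<And>s. 0 < s \<Longrightarrow> s < t m \<Longrightarrow> (V' has_real_derivative V'' s) (at s)"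
    and V': "set_integrable lborel {0<..<t m} (\<lambda>s. (t m - s) powr (-\<alpha>) * V' s)"
    and V'': "set_borel_measurable borel {0<..<t m} V''"
  shows "ennreal \<bar>L1_sum m (\<lambda>j. V (t j)) - (LINT s:{0<..<t m}|lborel. (t m - s) powr (-\<alpha>) * V' s)\<bar>
    \<le> (\<integral>\<^sup>+s. ennreal (\<bar>ker_avg m 0 - (t m - s) powr (-\<alpha>)\<bar> * indicator {0<..<t 1} s) * ennreal \<bar>V' s\<bar> \<partial>lborel)
     + (\<Sum>j\<in>{1..<m}. ennreal (2 * ker_osc m j) * (\<integral>\<^sup>+s. ennreal \<bar>V'' s\<bar> * indicator {t j<..<t (Suc j)} s \<partial>lborel))"
proof -
  have tm: "0 < t m" "t 1 \<le> t m" using t_pos[of m] t_1_le[of m] m by auto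
  have sub: "{t j<..<t (Suc j)} \<subseteq> {0<..<t m}" if "j < m" for j
    using t_le[of 0 j] t_le[of "Suc j" m] that m t_0 by auto
  have V'i: "set_integrable lborel {0<..<t m} V'"
    \<comment> \<open>The kernel is at least \<open>t m powr (-\<alpha>)\<close>, so integrability
      of the kernel times \<open>V'\<close> passes on to \<open>V'\<close>.\<close>
    unfolding set_integrable_def
  proof (rule Bochner_Integration.integrable_bound)
    show "integrable lborel (\<lambda>s. t m powr \<alpha> *\<^sub>R (indicator {0<..<t m} s *\<^sub>R ((t m - s) powr (-\<alpha>) * V' s)))"
      using V' unfolding set_integrable_def by (rule integrable_scaleR_right)
    have "continuous_on {0<..<t m} V'" using cV' by (rule continuous_on_subset) auto
    then have "(\<lambda>s. indicator {0<..<t m} s *\<^sub>R V' s) \<in> borel_measurable borel"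
      by (intro borel_measurable_continuous_on_indicator) auto
    then show "(\<lambda>s. indicator {0<..<t m} s *\<^sub>R V' s) \<in> borel_measurable lborel" by simp
    show "AE s in lborel. norm (indicator {0<..<t m} s *\<^sub>R V' s) \<le>
       norm (t m powr \<alpha> *\<^sub>R (indicator {0<..<t m} s *\<^sub>R ((t m - s) powr (-\<alpha>) * V' s)))"
    proof (rule AE_I2)
      fix s
      show "norm (indicator {0<..<t m} s *\<^sub>R V' s) \<le> norm (t m powr \<alpha> *\<^sub>R (indicator {0<..<t m} s *\<^sub>R ((t m - s) powr (-\<alpha>) * V' s)))"
      proof (cases "s \<in> {0<..<t m}")
        case True
        have "t m powr (-\<alpha>) \<le> (t m - s) powr (-\<alpha>)" using True \<alpha> by (intro powr_mono2') auto
        then have "t m powr \<alpha> * t m powr (-\<alpha>) \<le> t m powr \<alpha> * (t m - s) powr (-\<alpha>)" by (intro mult_left_mono) auto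
        then have "1 \<le> t m powr \<alpha> * (t m - s) powr (-\<alpha>)" using tm by (simp flip: powr_add)
        then have "1 * \<bar>V' s\<bar> \<le> (t m powr \<alpha> * (t m - s) powr (-\<alpha>)) * \<bar>V' s\<bar>" by (rule mult_right_mono) simp
        then show ?thesis using True by (simp add: abs_mult mult.assoc)
      qed simp
    qed
  qed
  have V'j: "set_integrable lborel {t j<..<t (Suc j)} V'"
      "set_integrable lborel {t j<..<t (Suc j)} (\<lambda>s. (t m - s) powr (-\<alpha>) * V' s)" if "j < m" for j
    using set_integrable_subset[OF V'i _ sub[OF that]] set_integrable_subset[OF V' _ sub[OF that]] by auto
  define d where "d j = (V (t (Suc j)) - V (t j)) * ker_avg m j - (LINT s:{t j<..<t (Suc j)}|lborel. (t m - s) powr (-\<alpha>) * V' s)" for j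
  have split: "{..<m} = insert 0 {1..<m}" using m by auto
  have "L1_sum m (\<lambda>j. V (t j)) - (LINT s:{0<..<t m}|lborel. (t m - s) powr (-\<alpha>) * V' s) = (\<Sum>j<m. d j)"
    unfolding L1_sum_def set_integral_mesh[OF m(2) V'] d_def by (simp add: sum_subtractf)
  also have "\<dots> = d 0 + (\<Sum>j\<in>{1..<m}. d j)" unfolding split by simp
  finally have e: "L1_sum m (\<lambda>j. V (t j)) - (LINT s:{0<..<t m}|lborel. (t m - s) powr (-\<alpha>) * V' s) = d 0 + (\<Sum>j\<in>{1..<m}. d j)" .
  have "ennreal \<bar>d 0 + (\<Sum>j\<in>{1..<m}. d j)\<bar> \<le> ennreal (\<bar>d 0\<bar> + (\<Sum>j\<in>{1..<m}. \<bar>d j\<bar>))"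
    using sum_abs[of d "{1..<m}"] by (intro ennreal_leI) linarith
  also have "\<dots> = ennreal \<bar>d 0\<bar> + (\<Sum>j\<in>{1..<m}. ennreal \<bar>d j\<bar>)"
    by (simp add: ennreal_plus sum_nonneg sum_ennreal)
  also have "\<dots> \<le> (\<integral>\<^sup>+s. ennreal (\<bar>ker_avg m 0 - (t m - s) powr (-\<alpha>)\<bar> * indicator {0<..<t 1} s) * ennreal \<bar>V' s\<bar> \<partial>lborel)
     + (\<Sum>j\<in>{1..<m}. ennreal (2 * ker_osc m j) * (\<integral>\<^sup>+s. ennreal \<bar>V'' s\<bar> * indicator {t j<..<t (Suc j)} s \<partial>lborel))"
  proof (intro add_mono sum_mono)
    have "continuous_on {0..t 1} V" using cV by (rule continuous_on_subset) (use tm in auto)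
    then show "ennreal \<bar>d 0\<bar> \<le> (\<integral>\<^sup>+s. ennreal (\<bar>ker_avg m 0 - (t m - s) powr (-\<alpha>)\<bar> * indicator {0<..<t 1} s) * ennreal \<bar>V' s\<bar> \<partial>lborel)"
      using truncation_first_interval[OF m, of V V'] dV V'j[of 0] tm m by (simp add: d_def t_0)
    fix j assume j: "j \<in> {1..<m}"
    have tj: "0 < t j" "t (Suc j) \<le> t m" using t_pos[of j] t_le[of "Suc j" m] j m by auto
    have "set_borel_measurable borel {t j<..<t (Suc j)} V''"
      using V'' by (rule set_borel_measurable_subset) (use sub[of j] j in auto)
    moreover have "continuous_on {t j..t (Suc j)} V" "continuous_on {t j..t (Suc j)} V'"
      using tj by (auto intro: continuous_on_subset[OF cV] continuous_on_subset[OF cV'])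
    ultimately show "ennreal \<bar>d j\<bar> \<le> ennreal (2 * ker_osc m j) * (\<integral>\<^sup>+s. ennreal \<bar>V'' s\<bar> * indicator {t j<..<t (Suc j)} s \<partial>lborel)"
      unfolding d_def using j m tj dV dV' V'j[of j] by (intro truncation_interval) auto
  qed
  finally show ?thesis unfolding e .
qed

end

text \<open>Fubini requires joint measurability, which follows for the derivative as a pointwise
  limit of difference quotients. The increment depends on \<open>s\<close> so that the shifted time
  stays below \<open>T\<close>.\<close>

lemma borel_measurable_time_derivative:
  fixes G G' :: "'a \<Rightarrow> real \<Rightarrow> real"
  assumes G: "(\<lambda>(x, s). G x s) \<in> borel_measurable (M \<Otimes>\<^sub>M restrict_space lborel {0<..<T})"
    and der: "\<And>x s. x \<in> space M \<Longrightarrow> 0 < s \<Longrightarrow> s < T \<Longrightarrow> (G x has_real_derivative G' x s) (at s)"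
  shows "(\<lambda>(x, s). G' x s) \<in> borel_measurable (M \<Otimes>\<^sub>M restrict_space lborel {0<..<T})"
proof -
  define N where "N = restrict_space lborel {0<..<T}"
  have spN: "space N = {0<..<T}" by (simp add: N_def)
  have sndm: "snd \<in> borel_measurable (M \<Otimes>\<^sub>M N)"
    unfolding N_def by (intro measurable_compose[OF measurable_snd] measurable_restrict_space1) auto
  note [measurable] = sndm
  define \<delta> where "\<delta> n s = (T - s) / real (n + 2)" for n s
  have \<delta>: "0 < \<delta> n s" "s + \<delta> n s < T" if "s < T" for n s
  proof -
    show "0 < \<delta> n s" using that by (simp add: \<delta>_def)
    have "(T - s) * 1 < (T - s) * real (n + 2)" using that by (intro mult_strict_left_mono) auto
    then have "\<delta> n s < T - s" by (simp add: \<delta>_def pos_divide_less_eq)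
    then show "s + \<delta> n s < T" by simp
  qed
  have shift: "(\<lambda>z. (fst z, snd z + \<delta> n (snd z))) \<in> measurable (M \<Otimes>\<^sub>M N) (M \<Otimes>\<^sub>M N)" for n
  proof (intro measurable_Pair measurable_fst)
    have "(\<lambda>z. snd z + \<delta> n (snd z)) \<in> borel_measurable (M \<Otimes>\<^sub>M N)" unfolding \<delta>_def by measurable
    moreover have "0 < snd z + \<delta> n (snd z) \<and> snd z + \<delta> n (snd z) < T" if "z \<in> space (M \<Otimes>\<^sub>M N)" for z
      using that \<delta>[of "snd z" n] by (auto simp: space_pair_measure spN intro: add_pos_pos)
    ultimately show "(\<lambda>z. snd z + \<delta> n (snd z)) \<in> measurable (M \<Otimes>\<^sub>M N) N"
      unfolding N_def by (intro measurable_restrict_space2) auto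
  qed
  have Gm: "(\<lambda>z. G (fst z) (snd z)) \<in> borel_measurable (M \<Otimes>\<^sub>M N)" using G by (simp add: case_prod_beta' N_def)
  have "(\<lambda>z. G' (fst z) (snd z)) \<in> borel_measurable (M \<Otimes>\<^sub>M N)"
  proof (rule borel_measurable_LIMSEQ_real)
    fix n
    have "(\<lambda>z. G (fst z) (snd z + \<delta> n (snd z))) \<in> borel_measurable (M \<Otimes>\<^sub>M N)"
      using measurable_compose[OF shift Gm] by simp
    moreover have "(\<lambda>z. \<delta> n (snd z)) \<in> borel_measurable (M \<Otimes>\<^sub>M N)" unfolding \<delta>_def by measurable
    ultimately show "(\<lambda>z. (G (fst z) (snd z + \<delta> n (snd z)) - G (fst z) (snd z)) / \<delta> n (snd z)) \<in> borel_measurable (M \<Otimes>\<^sub>M N)"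
      using Gm by (intro borel_measurable_divide borel_measurable_diff)
  next
    fix z assume "z \<in> space (M \<Otimes>\<^sub>M N)"
    then obtain x s where z: "z = (x, s)" "x \<in> space M" "0 < s" "s < T" by (cases z) (auto simp: space_pair_measure spN)
    have "((\<lambda>h. (G x (s + h) - G x s) / h) \<longlongrightarrow> G' x s) (at 0)" using der[OF z(2-4)] by (simp add: DERIV_def)
    moreover have "filterlim (\<lambda>n. \<delta> n s) (at 0) sequentially"
    proof -
      have "(\<lambda>n. (T - s) / real (n + 2)) \<longlonglongrightarrow> 0"
        by (rule LIMSEQ_ignore_initial_segment[OF lim_const_over_n])
      then show ?thesis using \<delta>(1)[OF z(4)] by (auto simp: filterlim_at \<delta>_def[abs_def] intro!: always_eventually)
    qed
    ultimately show "(\<lambda>n. (G (fst z) (snd z + \<delta> n (snd z)) - G (fst z) (snd z)) / \<delta> n (snd z)) \<longlonglongrightarrow> G' (fst z) (snd z)"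
      using filterlim_compose[of "\<lambda>h. (G x (s + h) - G x s) / h" "nhds (G' x s)" "at 0" "\<lambda>n. \<delta> n s"] by (simp add: z)
  qed
  then show ?thesis by (simp add: case_prod_beta' N_def)
qed

lemma dt_has_real_derivative:
  assumes "g differentiable (at s within {0..T})" "0 < s" "s < T"
  shows "(g has_real_derivative dt T g s) (at s)"
  using assms vector_derivative_works[of g "at s within {0..T}"]
  by (simp add: dt_def has_real_derivative_iff_has_vector_derivative at_within_Icc_at)

lemma nn_integral_has_integral_Ioo:
  fixes f :: "real \<Rightarrow> real"
  assumes "(f has_integral I) {a<..<b}" "\<And>x. 0 \<le> f x"
  shows "(\<integral>\<^sup>+s. ennreal (f s * indicator {a<..<b} s) \<partial>lborel) = ennreal I"
  using nn_integral_has_integral_lebesgue[OF _ assms(1)] assms(2) by (simp add: mult.commute)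

section \<open>The kernel on the first interval, against the initial singularity\<close>

context fine_mesh
begin

text \<open>The weight \<open>s powr (\<alpha> - 1)\<close> is the bound of the first time
  derivative. If \<open>t m\<close> is at least \<open>2 * t 1\<close>, the kernel oscillates by at
  most a multiple of \<open>t 1 * t m powr (-\<alpha> - 1)\<close>, and the weight integrates to
  \<open>t 1 powr \<alpha> / \<alpha>\<close>; this gives the exponent \<alpha> + 1, the origin of
  the restriction on \<theta>. Otherwise \<open>t m\<close> is comparable to \<open>t 1\<close> and
  a constant bound is enough.\<close>

lemma first_interval_kernel:
  assumes m: "1 \<le> m" "m \<le> N" and \<theta>: "0 \<le> \<theta>" "\<theta> \<le> \<alpha> + 1"
  shows "(\<integral>\<^sup>+s. ennreal (\<bar>ker_avg m 0 - (t m - s) powr (-\<alpha>)\<bar> * s powr (\<alpha> - 1) * indicator {0<..<t 1} s) \<partial>lborel)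
    \<le> ennreal ((2 powr (\<alpha> + 1) + 2 powr \<theta> * ((2 / (1 - \<alpha>) + 2) / \<alpha> + 2 / (1 - \<alpha>))) * (t 1 / t m) powr \<theta>)"
proof -
  define x where "x = t 1 / t m"
  have t1: "0 < t 1" "0 < t m" "t 1 \<le> t m" using t_1_pos t_pos[of m] t_1_le[of m] m by auto
  have x: "0 < x" "x \<le> 1" using t1 by (auto simp: x_def)
  have I1: "(\<integral>\<^sup>+s. ennreal (s powr (\<alpha> - 1) * indicator {0<..<t 1} s) \<partial>lborel) = ennreal (t 1 powr \<alpha> / \<alpha>)"
    using has_integral_powr_from_0[of "\<alpha> - 1" "t 1"] \<alpha> t1
    by (intro nn_integral_has_integral_Ioo) (auto simp: has_integral_Icc_iff_Ioo)
  have I2: "(\<integral>\<^sup>+s. ennreal ((t 1 - s) powr (-\<alpha>) * indicator {0<..<t 1} s) \<partial>lborel) = ennreal (t 1 powr (1 - \<alpha>) / (1 - \<alpha>))"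
  proof (intro nn_integral_has_integral_Ioo)
    have "((\<lambda>s. (t 1 - s) powr (-\<alpha>)) has_integral integral {0<..<t 1} (\<lambda>s. (t 1 - s) powr (-\<alpha>))) {0<..<t 1}"
      using set_borel_integral_eq_integral(1)[OF kernel_integral(1)[of \<alpha> 0 "t 1" "t 1"]] \<alpha> t1 by (simp add: integrable_integral)
    then show "((\<lambda>s. (t 1 - s) powr (-\<alpha>)) has_integral t 1 powr (1 - \<alpha>) / (1 - \<alpha>)) {0<..<t 1}"
      using set_borel_integral_eq_integral(2)[OF kernel_integral(1)[of \<alpha> 0 "t 1" "t 1"]] kernel_integral(2)[of \<alpha> 0 "t 1" "t 1"] \<alpha> t1 by simp
  qed auto
  define Cn where "Cn = (2 / (1 - \<alpha>) + 2) / \<alpha> + 2 / (1 - \<alpha>)"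
  have Cn: "0 \<le> Cn" using \<alpha> by (simp add: Cn_def)
  define J where "J = (\<integral>\<^sup>+s. ennreal (\<bar>ker_avg m 0 - (t m - s) powr (-\<alpha>)\<bar> * s powr (\<alpha> - 1) * indicator {0<..<t 1} s) \<partial>lborel)"
  show ?thesis
  proof (cases "2 * t 1 \<le> t m")
    case True
    then have m1: "Suc 0 < m" using m t1 by (cases "m = 1") auto
    have "\<exists>\<xi>>0. \<xi> < t 1 \<and> (t m - t 1) powr (-\<alpha>) - (t m - 0) powr (-\<alpha>) = (t 1 - 0) * (\<alpha> * (t m - \<xi>) powr (-\<alpha> - 1))"
      by (rule MVT2[where f = "\<lambda>s. (t m - s) powr (-\<alpha>)"]) (use t1 True in \<open>auto intro!: derivative_eq_intros\<close>)
    then obtain \<xi> where \<xi>: "0 < \<xi>" "\<xi> < t 1"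
      "(t m - t 1) powr (-\<alpha>) - t m powr (-\<alpha>) = t 1 * (\<alpha> * (t m - \<xi>) powr (-\<alpha> - 1))" by auto
    have "(t m - \<xi>) powr (-\<alpha> - 1) \<le> (t m / 2) powr (-\<alpha> - 1)" using \<xi> True t1 \<alpha> by (intro powr_mono2') auto
    then have dk: "(t m - t 1) powr (-\<alpha>) - t m powr (-\<alpha>) \<le> t 1 * (\<alpha> * (t m / 2) powr (-\<alpha> - 1))"
      unfolding \<xi>(3) using t1 \<alpha> by (intro mult_left_mono) auto
    define Q where "Q = t 1 * (\<alpha> * (t m / 2) powr (-\<alpha> - 1))"
    have bnd: "\<bar>ker_avg m 0 - (t m - s) powr (-\<alpha>)\<bar> \<le> Q" if "0 < s" "s < t 1" for s
    proof -
      have "t m powr (-\<alpha>) \<le> (t m - s) powr (-\<alpha>)" "(t m - s) powr (-\<alpha>) \<le> (t m - t 1) powr (-\<alpha>)"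
        using that True t1 \<alpha> by (auto intro!: powr_mono2')
      moreover have "t m powr (-\<alpha>) \<le> ker_avg m 0" "ker_avg m 0 \<le> (t m - t 1) powr (-\<alpha>)"
        using ker_avg_ge[of 0 m] ker_avg_le[of 0 m] m1 m t_0 by auto
      ultimately show ?thesis using dk unfolding Q_def abs_le_iff by linarith
    qed
    have "J \<le> (\<integral>\<^sup>+s. ennreal Q * ennreal (s powr (\<alpha> - 1) * indicator {0<..<t 1} s) \<partial>lborel)"
      unfolding J_def
    proof (rule nn_integral_mono)
      fix s
      have "\<bar>ker_avg m 0 - (t m - s) powr (-\<alpha>)\<bar> * s powr (\<alpha> - 1) * indicator {0<..<t 1} s \<le> Q * (s powr (\<alpha> - 1) * indicator {0<..<t 1} s)"
        using bnd[of s] by (auto simp: indicator_def intro!: mult_right_mono)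
      moreover have "0 \<le> Q" using t1 \<alpha> by (simp add: Q_def)
      ultimately show "ennreal (\<bar>ker_avg m 0 - (t m - s) powr (-\<alpha>)\<bar> * s powr (\<alpha> - 1) * indicator {0<..<t 1} s) \<le> ennreal Q * ennreal (s powr (\<alpha> - 1) * indicator {0<..<t 1} s)"
        by (simp add: ennreal_leI flip: ennreal_mult')
    qed
    also have "\<dots> = ennreal Q * ennreal (t 1 powr \<alpha> / \<alpha>)" using I1 by (subst nn_integral_cmult) auto
    also have "\<dots> = ennreal (Q * (t 1 powr \<alpha> / \<alpha>))" using t1 \<alpha> by (simp add: Q_def flip: ennreal_mult)
    also have "Q * (t 1 powr \<alpha> / \<alpha>) = 2 powr (\<alpha> + 1) * x powr (\<alpha> + 1)"
    proof -
      have "(t m / 2) powr (-\<alpha> - 1) = 2 powr (\<alpha> + 1) / t m powr (\<alpha> + 1)"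
        using t1 powr_minus_divide[of "t m / 2" "\<alpha> + 1"] by (simp add: powr_divide)
      then show ?thesis using t1 \<alpha> by (simp add: Q_def x_def powr_divide powr_add)
    qed
    also have "ennreal (2 powr (\<alpha> + 1) * x powr (\<alpha> + 1)) \<le> ennreal ((2 powr (\<alpha> + 1) + 2 powr \<theta> * Cn) * x powr \<theta>)"
    proof (rule ennreal_leI)
      have "2 powr (\<alpha> + 1) * x powr (\<alpha> + 1) \<le> 2 powr (\<alpha> + 1) * x powr \<theta>"
        using x \<theta> by (intro mult_left_mono powr_mono') auto
      then show "2 powr (\<alpha> + 1) * x powr (\<alpha> + 1) \<le> (2 powr (\<alpha> + 1) + 2 powr \<theta> * Cn) * x powr \<theta>"
        using Cn by (simp add: distrib_right add_increasing2)
    qed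
    finally show ?thesis unfolding J_def Cn_def x_def .
  next
    case False
    have A: "ker_avg m 0 \<le> 2 / (1 - \<alpha>) * t 1 powr (-\<alpha>)"
    proof -
      have "ker_int m 0 \<le> t m powr (1 - \<alpha>) / (1 - \<alpha>)" using \<alpha> by (simp add: ker_int_def t_0 divide_right_mono)
      also have "\<dots> \<le> (2 * t 1) powr (1 - \<alpha>) / (1 - \<alpha>)" using False t1 \<alpha> by (intro divide_right_mono powr_mono2) auto
      also have "\<dots> = 2 powr (1 - \<alpha>) * t 1 powr (1 - \<alpha>) / (1 - \<alpha>)" using t1 by (simp add: powr_mult)
      also have "\<dots> \<le> 2 powr 1 * t 1 powr (1 - \<alpha>) / (1 - \<alpha>)"
        using \<alpha> by (intro divide_right_mono mult_right_mono powr_mono) auto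
      finally have "ker_int m 0 / t 1 \<le> 2 * t 1 powr (1 - \<alpha>) / (1 - \<alpha>) / t 1" using t1 by (intro divide_right_mono) auto
      also have "2 * t 1 powr (1 - \<alpha>) / (1 - \<alpha>) / t 1 = 2 / (1 - \<alpha>) * t 1 powr (-\<alpha>)"
        using t1 by (simp add: powr_diff powr_minus divide_inverse)
      finally show ?thesis by (simp add: ker_avg_def t_0)
    qed
    have A0: "0 \<le> ker_avg m 0" using ker_avg_pos[of 0 m] m by simp
    define d1 d2 where "d1 = (2 / (1 - \<alpha>) + 2) * t 1 powr (-\<alpha>)" and "d2 = 2 * t 1 powr (\<alpha> - 1)"
    have d: "0 \<le> d1" "0 \<le> d2" using \<alpha> by (auto simp: d1_def d2_def)
    have half: "(t 1 / 2) powr (-\<alpha>) \<le> 2 * t 1 powr (-\<alpha>)" "(t 1 / 2) powr (\<alpha> - 1) \<le> 2 * t 1 powr (\<alpha> - 1)"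
    proof -
      have "(t 1 / 2) powr e \<le> 2 * t 1 powr e" if "-1 \<le> e" for e
      proof -
        have "1 / 2 powr e = 2 powr (- e)" by (simp add: powr_minus_divide)
        also have "\<dots> \<le> 2 powr 1" using that by (intro powr_mono) auto
        finally have "1 / 2 powr e * t 1 powr e \<le> 2 * t 1 powr e" by (intro mult_right_mono) auto
        then show ?thesis using t1 by (simp add: powr_divide)
      qed
      then show "(t 1 / 2) powr (-\<alpha>) \<le> 2 * t 1 powr (-\<alpha>)" "(t 1 / 2) powr (\<alpha> - 1) \<le> 2 * t 1 powr (\<alpha> - 1)"
        using \<alpha> by auto
    qed
    have bnd: "\<bar>ker_avg m 0 - (t m - s) powr (-\<alpha>)\<bar> * s powr (\<alpha> - 1) \<le> d1 * s powr (\<alpha> - 1) + d2 * (t 1 - s) powr (-\<alpha>)"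
      if s: "0 < s" "s < t 1" for s
    proof -
      have k: "(t m - s) powr (-\<alpha>) \<le> (t 1 - s) powr (-\<alpha>)" using s t1 \<alpha> by (intro powr_mono2') auto
      \<comment> \<open>Halving the interval separates the singularity of the weight at 0 from that
        of the kernel at \<open>t 1\<close>; on each half one of the two factors is bounded.\<close>
      have "(t 1 - s) powr (-\<alpha>) * s powr (\<alpha> - 1) \<le> 2 * t 1 powr (-\<alpha>) * s powr (\<alpha> - 1) + d2 * (t 1 - s) powr (-\<alpha>)"
      proof (cases "s \<le> t 1 / 2")
        case True
        have "(t 1 - s) powr (-\<alpha>) \<le> (t 1 / 2) powr (-\<alpha>)" using True s t1 \<alpha> by (intro powr_mono2') auto
        then have "(t 1 - s) powr (-\<alpha>) * s powr (\<alpha> - 1) \<le> 2 * t 1 powr (-\<alpha>) * s powr (\<alpha> - 1)"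
          using half by (intro mult_right_mono) auto
        then show ?thesis using d by (simp add: add_increasing2)
      next
        case False
        have "s powr (\<alpha> - 1) \<le> (t 1 / 2) powr (\<alpha> - 1)" using False s t1 \<alpha> by (intro powr_mono2') auto
        then have "s powr (\<alpha> - 1) * (t 1 - s) powr (-\<alpha>) \<le> d2 * (t 1 - s) powr (-\<alpha>)"
          using half unfolding d2_def by (intro mult_right_mono) auto
        then show ?thesis by (simp add: mult.commute add_increasing)
      qed
      moreover have "\<bar>ker_avg m 0 - (t m - s) powr (-\<alpha>)\<bar> \<le> 2 / (1 - \<alpha>) * t 1 powr (-\<alpha>) + (t 1 - s) powr (-\<alpha>)"
        using A A0 k powr_ge_zero[of "t m - s" "-\<alpha>"] unfolding abs_le_iff by linarith
      then have "\<bar>ker_avg m 0 - (t m - s) powr (-\<alpha>)\<bar> * s powr (\<alpha> - 1) \<le> (2 / (1 - \<alpha>) * t 1 powr (-\<alpha>) + (t 1 - s) powr (-\<alpha>)) * s powr (\<alpha> - 1)"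
        by (rule mult_right_mono) simp
      ultimately show ?thesis unfolding d1_def distrib_right by linarith
    qed
    have "J \<le> (\<integral>\<^sup>+s. ennreal d1 * ennreal (s powr (\<alpha> - 1) * indicator {0<..<t 1} s) + ennreal d2 * ennreal ((t 1 - s) powr (-\<alpha>) * indicator {0<..<t 1} s) \<partial>lborel)"
      unfolding J_def
    proof (rule nn_integral_mono)
      fix s
      have "\<bar>ker_avg m 0 - (t m - s) powr (-\<alpha>)\<bar> * s powr (\<alpha> - 1) * indicator {0<..<t 1} s
         \<le> d1 * (s powr (\<alpha> - 1) * indicator {0<..<t 1} s) + d2 * ((t 1 - s) powr (-\<alpha>) * indicator {0<..<t 1} s)"
        using bnd[of s] by (auto simp: indicator_def)
      then show "ennreal (\<bar>ker_avg m 0 - (t m - s) powr (-\<alpha>)\<bar> * s powr (\<alpha> - 1) * indicator {0<..<t 1} s)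
        \<le> ennreal d1 * ennreal (s powr (\<alpha> - 1) * indicator {0<..<t 1} s) + ennreal d2 * ennreal ((t 1 - s) powr (-\<alpha>) * indicator {0<..<t 1} s)"
        using d by (simp add: ennreal_leI flip: ennreal_mult ennreal_plus)
    qed
    also have "\<dots> = ennreal d1 * ennreal (t 1 powr \<alpha> / \<alpha>) + ennreal d2 * ennreal (t 1 powr (1 - \<alpha>) / (1 - \<alpha>))"
      using I1 I2 by (subst nn_integral_add) (auto simp: nn_integral_cmult)
    also have "\<dots> = ennreal (d1 * (t 1 powr \<alpha> / \<alpha>) + d2 * (t 1 powr (1 - \<alpha>) / (1 - \<alpha>)))"
      using d \<alpha> by (simp flip: ennreal_mult ennreal_plus)
    also have "d1 * (t 1 powr \<alpha> / \<alpha>) + d2 * (t 1 powr (1 - \<alpha>) / (1 - \<alpha>)) = Cn"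
    proof -
      have "t 1 powr (-\<alpha>) * t 1 powr \<alpha> = 1" "t 1 powr (\<alpha> - 1) * t 1 powr (1 - \<alpha>) = 1"
        using t1 by (simp_all flip: powr_add)
      then have "d1 * (t 1 powr \<alpha> / \<alpha>) = (2 / (1 - \<alpha>) + 2) / \<alpha>" "d2 * (t 1 powr (1 - \<alpha>) / (1 - \<alpha>)) = 2 / (1 - \<alpha>)"
        unfolding d1_def d2_def by (metis (no_types, lifting) mult.assoc mult.right_neutral times_divide_eq_right)+
      then show ?thesis by (simp only: Cn_def)
    qed
    also have "ennreal Cn \<le> ennreal ((2 powr (\<alpha> + 1) + 2 powr \<theta> * Cn) * x powr \<theta>)"
    proof (rule ennreal_leI)
      have "1 / 2 \<le> x" using False t1 by (simp add: x_def divide_simps)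
      then have "(1 / 2) powr \<theta> \<le> x powr \<theta>" using \<theta> by (intro powr_mono2) auto
      then have "2 powr \<theta> * (1 / 2) powr \<theta> \<le> 2 powr \<theta> * x powr \<theta>" by (intro mult_left_mono) auto
      then have "1 \<le> 2 powr \<theta> * x powr \<theta>" by (simp flip: powr_mult)
      then have "1 * Cn \<le> (2 powr \<theta> * x powr \<theta>) * Cn" using Cn by (rule mult_right_mono)
      moreover have "0 \<le> 2 powr (\<alpha> + 1) * x powr \<theta>" by simp
      moreover have "2 powr \<theta> * Cn * x powr \<theta> = (2 powr \<theta> * x powr \<theta>) * Cn" by simp
      ultimately show "Cn \<le> (2 powr (\<alpha> + 1) + 2 powr \<theta> * Cn) * x powr \<theta>" unfolding distrib_right by linarith
    qed
    finally show ?thesis unfolding J_def Cn_def x_def .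
  qed
qed

end

section \<open>Stability of the elliptic operator\<close>

text \<open>\<open>pd\<close> has a value even where no derivative exists; the relational form
  carries existence through the product and chain rules.\<close>

definition has_pd :: "'d::finite \<Rightarrow> (real ^ 'd \<Rightarrow> real) \<Rightarrow> real \<Rightarrow> real ^ 'd \<Rightarrow> bool" where
  "has_pd k g D x \<longleftrightarrow> ((\<lambda>h. g (x + h *\<^sub>R axis k 1)) has_real_derivative D) (at 0)"

lemma has_pd_imp_pd: "has_pd k g D x \<Longrightarrow> pd k g x = D"
  by (simp add: has_pd_def pd_def DERIV_imp_deriv)

lemma eventually_line_in_open:
  assumes "open \<Omega>" "x \<in> \<Omega>"
  shows "\<forall>\<^sub>F h in nhds 0. x + h *\<^sub>R axis k 1 \<in> (\<Omega> :: (real ^ 'd::finite) set)"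
proof -
  have "((\<lambda>h. x + h *\<^sub>R axis k 1) \<longlongrightarrow> x + 0 *\<^sub>R axis k 1) (nhds (0::real))"
    by (intro tendsto_intros filterlim_ident)
  then show ?thesis using assms by (auto dest: topological_tendstoD)
qed

lemma has_pd_cong:
  assumes "open \<Omega>" "x \<in> \<Omega>" "\<And>y. y \<in> \<Omega> \<Longrightarrow> f y = g y"
  shows "has_pd k f D x \<longleftrightarrow> has_pd k g D x"
  unfolding has_pd_def
  using eventually_line_in_open[OF assms(1,2), of k] assms(3)
  by (intro DERIV_cong_ev) (auto elim!: eventually_mono)

lemma has_pd_diff: "has_pd k f D x \<Longrightarrow> has_pd k g E x \<Longrightarrow> has_pd k (\<lambda>x. f x - g x) (D - E) x"
  unfolding has_pd_def by (rule DERIV_diff)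

lemma has_pd_mult: "has_pd k f D x \<Longrightarrow> has_pd k g E x \<Longrightarrow> has_pd k (\<lambda>x. f x * g x) (D * g x + E * f x) x"
  unfolding has_pd_def using DERIV_mult[of "\<lambda>h. f (x + h *\<^sub>R axis k 1)" D 0 UNIV "\<lambda>h. g (x + h *\<^sub>R axis k 1)" E] by simp

lemma has_pd_compose:
  assumes "(\<phi> has_real_derivative E) (at (f x))" "has_pd k f D x"
  shows "has_pd k (\<lambda>x. \<phi> (f x)) (E * D) x"
  using DERIV_chain2[of \<phi> E "\<lambda>h. f (x + h *\<^sub>R axis k 1)" 0 D UNIV] assms unfolding has_pd_def by simp

lemma Ck_on_Suc_has_pd: "Ck_on (Suc n) \<Omega> g \<Longrightarrow> x \<in> \<Omega> \<Longrightarrow> has_pd k g (pd k g x) x"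
  by (auto simp: has_pd_def pd_def DERIV_deriv_iff_real_differentiable)

lemma Ck_on_continuous: "Ck_on n \<Omega> g \<Longrightarrow> continuous_on \<Omega> g"
  by (cases n) auto

lemma Ck_on_2D:
  assumes "Ck_on 2 \<Omega> g"
  shows "continuous_on \<Omega> g" "continuous_on \<Omega> (pd k g)" "continuous_on \<Omega> (pd k (pd k g))"
    "x \<in> \<Omega> \<Longrightarrow> has_pd k g (pd k g x) x" "x \<in> \<Omega> \<Longrightarrow> has_pd k (pd k g) (pd k (pd k g) x) x"
proof -
  have g: "Ck_on (Suc (Suc 0)) \<Omega> g" "Ck_on (Suc 0) \<Omega> (pd k g)" "Ck_on 0 \<Omega> (pd k (pd k g))"
    using assms by (auto simp: numeral_2_eq_2)
  show "continuous_on \<Omega> g" "continuous_on \<Omega> (pd k g)" "continuous_on \<Omega> (pd k (pd k g))"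
    using g Ck_on_continuous by blast+
  show "x \<in> \<Omega> \<Longrightarrow> has_pd k g (pd k g x) x" "x \<in> \<Omega> \<Longrightarrow> has_pd k (pd k g) (pd k (pd k g) x) x"
    using g Ck_on_Suc_has_pd by blast+
qed

text \<open>\<open>w\<close> is compared with the difference on \<Omega> only, because the induction
  passes to \<open>pd k w\<close>, which is known only there.\<close>

lemma Ck_on_diff:
  assumes "open \<Omega>" "Ck_on n \<Omega> f" "Ck_on n \<Omega> g" "\<And>x. x \<in> \<Omega> \<Longrightarrow> w x = f x - g x"
  shows "Ck_on n \<Omega> w"
  using assms(2-4)
proof (induction n arbitrary: f g w)
  case 0
  have "continuous_on \<Omega> w \<longleftrightarrow> continuous_on \<Omega> (\<lambda>x. f x - g x)" using 0 by (intro continuous_on_cong) auto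
  then show ?case using 0 by (auto intro: continuous_intros)
next
  case (Suc n)
  have "continuous_on \<Omega> w \<longleftrightarrow> continuous_on \<Omega> (\<lambda>x. f x - g x)" using Suc by (intro continuous_on_cong) auto
  moreover have "continuous_on \<Omega> (\<lambda>x. f x - g x)" using Suc by (auto intro: continuous_intros)
  moreover have w: "has_pd k w (pd k f x - pd k g x) x" if "x \<in> \<Omega>" for k x
    using has_pd_diff[OF Ck_on_Suc_has_pd[OF Suc.prems(1) that] Ck_on_Suc_has_pd[OF Suc.prems(2) that], of k]
      has_pd_cong[OF assms(1) that, of w "\<lambda>x. f x - g x"] Suc.prems(3) by blast
  moreover have "Ck_on n \<Omega> (pd k w)" for k
    by (rule Suc.IH[of "pd k f" "pd k g"]) (use Suc.prems has_pd_imp_pd[OF w] in auto)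
  ultimately show ?case
    unfolding has_pd_def by (auto simp: real_differentiable_def)
qed

locale elliptic_domain =
  fixes \<Omega> :: "(real ^ 'd::finite) set" and a b :: "'d \<Rightarrow> real ^ 'd \<Rightarrow> real \<Rightarrow> real"
    and c :: "real ^ 'd \<Rightarrow> real \<Rightarrow> real" and t :: real
  assumes open_dom: "open \<Omega>" and bounded_dom: "bounded \<Omega>"
    and a_C1: "Ck_on 1 \<Omega> (\<lambda>x. a k x t)" and a_pos: "x \<in> \<Omega> \<Longrightarrow> 0 < a k x t"
    and b_cont: "continuous_on (closure \<Omega>) (\<lambda>x. b k x t)"
    and c_cont: "continuous_on (closure \<Omega>) (\<lambda>x. c x t)"
begin

lemma has_pd_a: "x \<in> \<Omega> \<Longrightarrow> has_pd k (\<lambda>x. a k x t) (pd k (\<lambda>x. a k x t) x) x"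
  using Ck_on_Suc_has_pd[of 0 \<Omega> "\<lambda>x. a k x t"] a_C1[of k] by simp

lemma has_pd_flux:
  assumes "Ck_on 2 \<Omega> v" "x \<in> \<Omega>"
  shows "has_pd k (\<lambda>y. a k y t * pd k v y) (pd k (\<lambda>x. a k x t) x * pd k v x + pd k (pd k v) x * a k x t) x"
  using has_pd_mult[OF has_pd_a[OF assms(2)] Ck_on_2D(5)[OF assms]] .

lemma ell_op_expand:
  assumes "Ck_on 2 \<Omega> v" "x \<in> \<Omega>"
  shows "ell_op a b c t v x = (\<Sum>k\<in>UNIV. - (pd k (\<lambda>x. a k x t) x * pd k v x + pd k (pd k v) x * a k x t)
     + b k x t * pd k v x) + c x t * v x"
  unfolding ell_op_def by (simp add: has_pd_imp_pd[OF has_pd_flux[OF assms]])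

lemma continuous_coeffs:
  "continuous_on \<Omega> (\<lambda>x. a k x t)" "continuous_on \<Omega> (pd k (\<lambda>x. a k x t))"
  "continuous_on \<Omega> (\<lambda>x. b k x t)" "continuous_on \<Omega> (\<lambda>x. c x t)"
  using a_C1[of k] b_cont[of k] c_cont closure_subset by (auto intro: continuous_on_subset)

lemma continuous_ell_op:
  assumes "Ck_on 2 \<Omega> v"
  shows "continuous_on \<Omega> (ell_op a b c t v)"
proof -
  have "continuous_on \<Omega> (\<lambda>x. (\<Sum>k\<in>UNIV. - (pd k (\<lambda>x. a k x t) x * pd k v x + pd k (pd k v) x * a k x t)
     + b k x t * pd k v x) + c x t * v x)"
    using assms by (intro continuous_intros continuous_coeffs Ck_on_2D) auto
  then show ?thesis using ell_op_expand[OF assms] by (subst continuous_on_cong[OF refl]) auto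
qed

lemma ell_op_diff:
  assumes "Ck_on 2 \<Omega> v" "Ck_on 2 \<Omega> w" "\<And>x. x \<in> \<Omega> \<Longrightarrow> z x = v x - w x" "x \<in> \<Omega>"
  shows "ell_op a b c t z x = ell_op a b c t v x - ell_op a b c t w x"
proof -
  have z: "Ck_on 2 \<Omega> z" by (rule Ck_on_diff[OF open_dom assms(1-3)])
  have p1: "pd k z y = pd k v y - pd k w y" if "y \<in> \<Omega>" for k y
    using has_pd_diff[OF Ck_on_2D(4)[OF assms(1) that] Ck_on_2D(4)[OF assms(2) that], of k]
      has_pd_cong[OF open_dom that, of z "\<lambda>x. v x - w x"] assms(3) has_pd_imp_pd by blast
  have p2: "pd k (pd k z) x = pd k (pd k v) x - pd k (pd k w) x" for k
    using has_pd_diff[OF Ck_on_2D(5)[OF assms(1,4)] Ck_on_2D(5)[OF assms(2,4)], of k]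
      has_pd_cong[OF open_dom assms(4), of "pd k z" "\<lambda>x. pd k v x - pd k w x"] p1 has_pd_imp_pd by blast
  show ?thesis
    unfolding ell_op_expand[OF assms(1,4)] ell_op_expand[OF assms(2,4)] ell_op_expand[OF z assms(4)]
      p1[OF assms(4)] p2 assms(3)[OF assms(4)]
    by (simp add: algebra_simps sum.distrib sum_subtractf sum_negf)
qed

end

lemma second_derivative_local_max:
  fixes f f' :: "real \<Rightarrow> real"
  assumes max: "\<forall>\<^sub>F h in nhds 0. f h \<le> f 0" and f: "\<forall>\<^sub>F h in nhds 0. (f has_real_derivative f' h) (at h)"
    and f': "(f' has_real_derivative D) (at 0)"
  shows "f' 0 = 0" "D \<le> 0"
proof -
  from max f have "\<forall>\<^sub>F h in nhds 0. f h \<le> f 0 \<and> (f has_real_derivative f' h) (at h)" by (rule eventually_conj)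
  then obtain e where e: "e > 0" "\<And>h. \<bar>h\<bar> < e \<Longrightarrow> f h \<le> f 0 \<and> (f has_real_derivative f' h) (at h)"
    unfolding eventually_nhds_metric by (auto simp: dist_real_def)
  show z: "f' 0 = 0"
    using DERIV_local_max[of f "f' 0" 0 e] e by (auto simp: abs_minus_commute)
  show "D \<le> 0"
  proof (rule ccontr)
    assume "\<not> D \<le> 0"
    then obtain d where d: "d > 0" "\<And>h. h > 0 \<Longrightarrow> h < d \<Longrightarrow> f' h > 0"
      using has_real_derivative_pos_inc_right[OF f'] z by auto
    define h where "h = min d e / 2"
    have h: "0 < h" "h < d" "h < e" using d e by (auto simp: h_def min_def)
    have "\<exists>\<xi>>0. \<xi> < h \<and> f h - f 0 = (h - 0) * f' \<xi>"
      by (rule MVT2) (use h e in auto)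
    then obtain \<xi> where "0 < \<xi>" "\<xi> < h" "f h - f 0 = h * f' \<xi>" by auto
    moreover from this d h have "0 < h * f' \<xi>" by simp
    ultimately show False using e(2)[of h] h by auto
  qed
qed

section \<open>The maximum principle\<close>

context elliptic_domain
begin

text \<open>A positive maximum is interior by the boundary condition. There the gradient vanishes,
  which removes convection and the derivatives of \<open>a\<close>, and the pure second derivatives
  are nonpositive; so the zero-order terms alone are at most \<open>C\<close>.\<close>

lemma max_principle_upper:
  assumes v: "continuous_on (closure \<Omega>) v" "Ck_on 2 \<Omega> v" "\<And>x. x \<in> frontier \<Omega> \<Longrightarrow> v x = 0"
    and \<kappa>: "0 < \<kappa>" and c: "\<And>x. x \<in> \<Omega> \<Longrightarrow> 0 \<le> c x t" and C: "0 \<le> C"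
    and le: "\<And>x. x \<in> \<Omega> \<Longrightarrow> \<kappa> * v x + ell_op a b c t v x \<le> C" and x: "x \<in> \<Omega>"
  shows "v x \<le> C / \<kappa>"
proof -
  have "compact (closure \<Omega>)" using bounded_dom by simp
  moreover have "closure \<Omega> \<noteq> {}" using x closure_subset by auto
  ultimately obtain y where y: "y \<in> closure \<Omega>" "\<And>z. z \<in> closure \<Omega> \<Longrightarrow> v z \<le> v y"
    using continuous_attains_sup[OF _ _ v(1)] by blast
  have xy: "v x \<le> v y" using y x closure_subset by auto
  show ?thesis
  proof (cases "0 < v y")
    case False
    then show ?thesis using xy C \<kappa> by (smt (verit) divide_nonneg_pos)
  next
    case True
    then have y\<Omega>: "y \<in> \<Omega>" using v(3)[of y] y open_dom by (auto simp: frontier_def interior_open)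
    have "pd k v y = 0 \<and> pd k (pd k v) y \<le> 0" for k
    proof -
      define f where "f h = v (y + h *\<^sub>R axis k 1)" for h
      define f' where "f' h = pd k v (y + h *\<^sub>R axis k 1)" for h
      have "\<forall>\<^sub>F h in nhds 0. f h \<le> f 0"
        using eventually_line_in_open[OF open_dom y\<Omega>, of k] by eventually_elim (use y closure_subset in \<open>auto simp: f_def\<close>)
      moreover have "\<forall>\<^sub>F h in nhds 0. (f has_real_derivative f' h) (at h)"
        using eventually_line_in_open[OF open_dom y\<Omega>, of k]
      proof eventually_elim
        case (elim h)
        have "((\<lambda>s. f (h + s)) has_real_derivative f' h) (at 0)"
          using Ck_on_2D(4)[OF v(2) elim, of k] unfolding has_pd_def f_def f'_def
          by (simp add: scaleR_left_distrib add.assoc)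
        then show ?case using DERIV_shift[of f "f' h" 0 h] by (simp add: add.commute)
      qed
      moreover have "(f' has_real_derivative pd k (pd k v) y) (at 0)"
        using Ck_on_2D(5)[OF v(2) y\<Omega>, of k] unfolding has_pd_def f'_def .
      ultimately show ?thesis using second_derivative_local_max[of f f'] by (auto simp: f'_def)
    qed
    then have "ell_op a b c t v y = (\<Sum>k\<in>UNIV. - (pd k (pd k v) y * a k y t)) + c y t * v y"
      and "0 \<le> (\<Sum>k\<in>UNIV. - (pd k (pd k v) y * a k y t))"
      unfolding ell_op_expand[OF v(2) y\<Omega>] using a_pos[OF y\<Omega>]
      by (auto intro!: sum_nonneg mult_nonpos_nonneg simp: less_imp_le)
    moreover have "0 \<le> c y t * v y" using c[OF y\<Omega>] True by simp
    ultimately have "\<kappa> * v y \<le> C" using le[OF y\<Omega>] by simp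
    then have "v y \<le> C / \<kappa>" using \<kappa> by (simp add: pos_le_divide_eq mult.commute)
    then show ?thesis using xy by simp
  qed
qed

lemma max_principle:
  assumes v: "continuous_on (closure \<Omega>) v" "Ck_on 2 \<Omega> v" "\<And>x. x \<in> frontier \<Omega> \<Longrightarrow> v x = 0"
    and \<kappa>: "0 < \<kappa>" and c: "\<And>x. x \<in> \<Omega> \<Longrightarrow> 0 \<le> c x t" and C: "0 \<le> C"
    and le: "\<And>x. x \<in> \<Omega> \<Longrightarrow> \<bar>\<kappa> * v x + ell_op a b c t v x\<bar> \<le> C" and x: "x \<in> \<Omega>"
  shows "\<bar>v x\<bar> \<le> C / \<kappa>"
proof -
  \<comment> \<open>Negation is obtained from two differences, \<open>v - v\<close> and then
    \<open>(v - v) - v\<close>, so that \<open>Ck_on_diff\<close> and \<open>ell_op_diff\<close>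
    apply.\<close>
  have z: "Ck_on 2 \<Omega> (\<lambda>x. v x - v x)" by (rule Ck_on_diff[OF open_dom v(2) v(2)]) simp
  have neg: "Ck_on 2 \<Omega> (\<lambda>x. - v x)" by (rule Ck_on_diff[OF open_dom z v(2)]) simp
  have z0: "ell_op a b c t (\<lambda>x. v x - v x) y = 0" if "y \<in> \<Omega>" for y
    using ell_op_diff[OF v(2) v(2) _ that, of "\<lambda>x. v x - v x"] by simp
  have "ell_op a b c t (\<lambda>x. - v x) y = - ell_op a b c t v y" if "y \<in> \<Omega>" for y
    using ell_op_diff[OF z v(2) _ that, of "\<lambda>x. - v x"] z0[OF that] by simp
  then have "\<kappa> * (- v y) + ell_op a b c t (\<lambda>x. - v x) y \<le> C" if "y \<in> \<Omega>" for y
    using le[OF that] that by (simp add: abs_le_iff)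
  then have "- v x \<le> C / \<kappa>"
    using v neg by (intro max_principle_upper[OF _ _ _ \<kappa> c C _ x]) (auto intro: continuous_intros)
  moreover have "v x \<le> C / \<kappa>"
    using le by (intro max_principle_upper[OF v \<kappa> c C _ x]) (auto simp: abs_le_iff)
  ultimately show ?thesis by (simp add: abs_le_iff)
qed

end

section \<open>Integration by parts for compactly supported functions\<close>

lemma continuous_ext_compact:
  fixes f :: "'a::euclidean_space \<Rightarrow> real"
  assumes \<Omega>: "open \<Omega>" and K: "compact K" "K \<subseteq> \<Omega>" and f: "continuous_on \<Omega> f"
    and z: "\<And>x. x \<in> \<Omega> \<Longrightarrow> x \<notin> K \<Longrightarrow> f x = 0"
  shows "continuous_on UNIV (\<lambda>x. if x \<in> \<Omega> then f x else 0)" "integrable lborel (\<lambda>x. if x \<in> \<Omega> then f x else 0)"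
proof -
  have "continuous_on (\<Omega> \<union> - K) (\<lambda>x. if x \<in> \<Omega> then f x else 0)"
    using \<Omega> K f z
    by (intro continuous_on_open_Un) (auto simp: compact_imp_closed open_Compl cong: continuous_on_cong
      intro: continuous_on_eq[of _ "\<lambda>_. 0"] continuous_on_eq[OF f])
  moreover have "\<Omega> \<union> - K = UNIV" using K by auto
  ultimately show "continuous_on UNIV (\<lambda>x. if x \<in> \<Omega> then f x else 0)" by simp
  have "integrable lborel (\<lambda>x. indicator K x *\<^sub>R f x)"
    using K f by (intro borel_integrable_compact) (auto intro: continuous_on_subset)
  moreover have "(\<lambda>x. indicator K x *\<^sub>R f x) = (\<lambda>x. if x \<in> \<Omega> then f x else 0)"
    using K z by (auto simp: indicator_def fun_eq_iff)
  ultimately show "integrable lborel (\<lambda>x. if x \<in> \<Omega> then f x else 0)" by simp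
qed

text \<open>
  Difference quotients of an integrable function have mean zero by translation invariance, and
  converge boundedly to the derivative.
\<close>

lemma integral_pd_compact_support:
  fixes f f' :: "real ^ 'd::finite \<Rightarrow> real"
  assumes f: "continuous_on UNIV f" and f': "continuous_on UNIV f'"
    and K: "compact K" "\<And>x. x \<notin> K \<Longrightarrow> f x = 0" "\<And>x. x \<notin> K \<Longrightarrow> f' x = 0"
    and pd: "\<And>x. has_pd k f (f' x) x"
  shows "(\<integral>x. f' x \<partial>lborel) = 0"
proof -
  have int_f: "integrable lborel f"
    using continuous_ext_compact(2)[of UNIV K f] f K by simp
  have "bounded (f' ` K)" using f' K(1) by (intro compact_imp_bounded compact_continuous_image) (auto intro: continuous_on_subset)
  then obtain B where B: "B > 0" "\<And>x. x \<in> K \<Longrightarrow> \<bar>f' x\<bar> \<le> B" by (auto simp: bounded_pos)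
  have B': "\<bar>f' x\<bar> \<le> B" for x using B(1) B(2)[of x] K(3)[of x] by (cases "x \<in> K") auto
  obtain R where R: "\<And>x. x \<in> K \<Longrightarrow> norm x \<le> R" using compact_imp_bounded[OF K(1)] by (auto simp: bounded_iff)
  define e where "e = (axis k 1 :: real ^ 'd)"
  have norm_e: "norm e = 1" by (simp add: e_def)
  have line: "((\<lambda>h. f (x + h *\<^sub>R e)) has_real_derivative f' (x + s *\<^sub>R e)) (at s)" for x s
  proof -
    have "((\<lambda>h. f (x + (h + s) *\<^sub>R e)) has_real_derivative f' (x + s *\<^sub>R e)) (at 0)"
      using pd[of "x + s *\<^sub>R e"] unfolding has_pd_def e_def by (simp add: scaleR_left_distrib add_ac)
    then show ?thesis using DERIV_shift[of "\<lambda>h. f (x + h *\<^sub>R e)" "f' (x + s *\<^sub>R e)" 0 s] by simp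
  qed
  define h where "h n = inverse (real (Suc n))" for n
  have h: "0 < h n" "h n \<le> 1" for n by (auto simp: h_def inverse_le_1_iff)
  define q where "q n x = (f (x + h n *\<^sub>R e) - f x) / h n" for n x
  have shift: "integrable lborel (\<lambda>x. f (x + h n *\<^sub>R e))" "(\<integral>x. f (x + h n *\<^sub>R e) \<partial>lborel) = (\<integral>x. f x \<partial>lborel)" for n
  proof -
    have d: "distr lborel borel ((+) (h n *\<^sub>R e)) = lborel" by (rule lborel_distr_plus)
    have bm: "f \<in> borel_measurable borel" using f by (rule borel_measurable_continuous_onI)
    have "(\<integral>x. f x \<partial>distr lborel borel ((+) (h n *\<^sub>R e))) = (\<integral>x. f (h n *\<^sub>R e + x) \<partial>lborel)"
      using bm by (intro integral_distr) auto
    then show "(\<integral>x. f (x + h n *\<^sub>R e) \<partial>lborel) = (\<integral>x. f x \<partial>lborel)" unfolding d by (simp add: add.commute)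
    have "integrable (distr lborel borel ((+) (h n *\<^sub>R e))) f \<longleftrightarrow> integrable lborel (\<lambda>x. f (h n *\<^sub>R e + x))"
      using bm by (intro integrable_distr_eq) auto
    then show "integrable lborel (\<lambda>x. f (x + h n *\<^sub>R e))" unfolding d using int_f by (simp add: add.commute)
  qed
  have q0: "(\<integral>x. q n x \<partial>lborel) = 0" for n
    unfolding q_def using shift[of n] int_f by simp
  have "(\<lambda>n. \<integral>x. q n x \<partial>lborel) \<longlonglongrightarrow> (\<integral>x. f' x \<partial>lborel)"
  proof (rule integral_dominated_convergence)
    show "f' \<in> borel_measurable lborel" using f' by (simp add: borel_measurable_continuous_onI)
    show "q n \<in> borel_measurable lborel" for n
      using shift(1)[of n] int_f unfolding q_def by (auto dest!: borel_measurable_integrable)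
    \<comment> \<open>The majorant: increments have length at most 1, so every difference quotient
      vanishes outside the ball of radius \<open>R + 1\<close>, and inside the mean value theorem
      bounds it by \<open>B\<close>.\<close>
    have "integrable lborel (\<lambda>x. indicator (cball 0 (R + 1)) x *\<^sub>R B)"
      by (intro borel_integrable_compact) auto
    then show "integrable lborel (\<lambda>x. B * indicator (cball (0 :: real ^ 'd) (R + 1)) x)" by (simp add: mult.commute)
    show "AE x in lborel. (\<lambda>n. q n x) \<longlonglongrightarrow> f' x"
    proof (rule AE_I2)
      fix x
      have "((\<lambda>y. (f (x + y *\<^sub>R e) - f (x + 0 *\<^sub>R e)) / (y - 0)) \<longlongrightarrow> f' (x + 0 *\<^sub>R e)) (at 0)"
        using line[of x 0] unfolding has_field_derivative_iff .
      moreover have "filterlim h (at 0) sequentially"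
        unfolding filterlim_at using h(1) LIMSEQ_inverse_real_of_nat by (auto simp: h_def[abs_def])
      ultimately show "(\<lambda>n. q n x) \<longlonglongrightarrow> f' x"
        unfolding q_def using filterlim_compose[of "\<lambda>y. (f (x + y *\<^sub>R e) - f (x + 0 *\<^sub>R e)) / (y - 0)" _ "at 0" h] by simp
    qed
    show "AE x in lborel. norm (q n x) \<le> B * indicator (cball 0 (R + 1)) x" for n
    proof (rule AE_I2)
      fix x
      show "norm (q n x) \<le> B * indicator (cball 0 (R + 1)) x"
      proof (cases "x \<in> cball 0 (R + 1)")
        case True
        obtain \<xi> where "0 < \<xi>" "\<xi> < h n" "f (x + h n *\<^sub>R e) - f (x + 0 *\<^sub>R e) = (h n - 0) * f' (x + \<xi> *\<^sub>R e)"
          using MVT2[OF h(1), of n "\<lambda>h. f (x + h *\<^sub>R e)" "\<lambda>s. f' (x + s *\<^sub>R e)"] line by blast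
        then have "q n x = f' (x + \<xi> *\<^sub>R e)" using h(1)[of n] by (simp add: q_def)
        then show ?thesis using B' True by simp
      next
        case False
        have "x \<notin> K" using False R[of x] by auto
        moreover have "x + h n *\<^sub>R e \<notin> K"
        proof
          assume "x + h n *\<^sub>R e \<in> K"
          then have "norm (x + h n *\<^sub>R e) \<le> R" by (rule R)
          moreover have "norm x \<le> norm (x + h n *\<^sub>R e) + norm (h n *\<^sub>R e)"
            by (metis add_diff_cancel_right' norm_triangle_ineq4)
          ultimately show False using False h[of n] norm_e by auto
        qed
        ultimately show ?thesis using K(2) B(1) by (simp add: q_def indicator_def)
      qed
    qed
  qed
  then show ?thesis unfolding q0 by (simp add: LIMSEQ_const_iff)
qed

lemma integral_pd_ext:
  fixes f f' :: "real ^ 'd::finite \<Rightarrow> real"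
  assumes \<Omega>: "open \<Omega>" and K: "compact K" "K \<subseteq> \<Omega>" and f: "continuous_on \<Omega> f" "continuous_on \<Omega> f'"
    and z: "\<And>x. x \<in> \<Omega> \<Longrightarrow> x \<notin> K \<Longrightarrow> f x = 0" "\<And>x. x \<in> \<Omega> \<Longrightarrow> x \<notin> K \<Longrightarrow> f' x = 0"
    and pd: "\<And>x. x \<in> \<Omega> \<Longrightarrow> has_pd k f (f' x) x"
  shows "(\<integral>x. (if x \<in> \<Omega> then f' x else 0) \<partial>lborel) = 0"
proof (rule integral_pd_compact_support[where K = K and f = "\<lambda>x. if x \<in> \<Omega> then f x else 0"])
  show "continuous_on UNIV (\<lambda>x. if x \<in> \<Omega> then f x else 0)" "continuous_on UNIV (\<lambda>x. if x \<in> \<Omega> then f' x else 0)"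
    using continuous_ext_compact(1)[OF \<Omega> K] f z by auto
  fix x
  show "has_pd k (\<lambda>x. if x \<in> \<Omega> then f x else 0) (if x \<in> \<Omega> then f' x else 0) x"
  proof (cases "x \<in> \<Omega>")
    case True
    then show ?thesis using pd[OF True] has_pd_cong[OF \<Omega> True, of f "\<lambda>x. if x \<in> \<Omega> then f x else 0"] by auto
  next
    case False
    have "open (- K)" "x \<in> - K" using K False by (auto simp: compact_imp_closed open_Compl)
    moreover have "has_pd k (\<lambda>x. 0) 0 x" by (simp add: has_pd_def)
    ultimately show ?thesis using has_pd_cong[of "- K" x "\<lambda>x. 0" "\<lambda>x. if x \<in> \<Omega> then f x else 0"] z False by auto
  qed
qed (use K z in auto)

text \<open>Squaring removes the corner of the positive part; this makes the smooth truncation below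
  continuously differentiable.\<close>

lemma has_real_derivative_pos_part_square:
  "((\<lambda>s. (max 0 s)\<^sup>2) has_real_derivative 2 * max 0 s) (at (s::real))"
proof (cases "s = 0")
  case True
  have "((\<lambda>h. ((max 0 (0 + h))\<^sup>2 - (max 0 (0::real))\<^sup>2) / h) \<longlongrightarrow> 0) (at 0)"
  proof (rule Lim_null_comparison)
    show "\<forall>\<^sub>F h in at (0::real). norm (((max 0 (0 + h))\<^sup>2 - (max 0 (0::real))\<^sup>2) / h) \<le> \<bar>h\<bar>"
      by (rule always_eventually) (auto simp: max_def power2_eq_square)
    show "((\<lambda>h. \<bar>h\<bar>) \<longlongrightarrow> 0) (at (0::real))" by (rule tendsto_rabs_zero) (rule tendsto_ident_at)
  qed
  then show ?thesis using True by (simp add: DERIV_def)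
next
  case False
  then consider "s > 0" | "s < 0" by linarith
  then show ?thesis
  proof cases
    case 1
    have "((\<lambda>s. s\<^sup>2) has_real_derivative 2 * s) (at s)" by (auto intro!: derivative_eq_intros)
    moreover have "\<forall>\<^sub>F y in nhds s. (max 0 y)\<^sup>2 = y\<^sup>2"
      using eventually_nhds_in_open[of "{0<..}" s] 1 by (auto elim!: eventually_mono)
    ultimately show ?thesis using 1 DERIV_cong_ev[OF refl, of "\<lambda>y. (max 0 y)\<^sup>2" "\<lambda>y. y\<^sup>2" s] by auto
  next
    case 2
    have "\<forall>\<^sub>F y in nhds s. (max 0 y)\<^sup>2 = (0::real)"
      using eventually_nhds_in_open[of "{..<0}" s] 2 by (auto elim!: eventually_mono simp: max_def)
    then show ?thesis using 2 DERIV_cong_ev[OF refl, of "\<lambda>y. (max 0 y)\<^sup>2" "\<lambda>y. 0" s] by auto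
  qed
qed

text \<open>
  A classical solution need not have square integrable derivatives up to the boundary, so the
  energy argument tests with \<open>\<phi> v\<close> where \<open>\<phi>\<close> is an increasing approximation of the identity that
  vanishes near \<open>0\<close>; then \<open>\<phi> v\<close> is compactly supported.
\<close>

lemma truncated_identity:
  fixes \<epsilon> :: real
  assumes \<epsilon>: "0 < \<epsilon>"
  obtains \<phi> \<phi>' \<Phi> :: "real \<Rightarrow> real"
  where "\<And>s. (\<phi> has_real_derivative \<phi>' s) (at s)" "continuous_on UNIV \<phi>'" "\<And>s. 0 \<le> \<phi>' s"
    "\<And>s. (\<Phi> has_real_derivative \<phi> s) (at s)" "\<And>s. 0 \<le> \<Phi> s"
    "\<And>s. \<bar>s\<bar> \<le> \<epsilon> \<Longrightarrow> \<phi> s = 0" "\<And>s. \<bar>s\<bar> \<le> \<epsilon> \<Longrightarrow> \<phi>' s = 0" "\<And>s. \<bar>s\<bar> \<le> \<epsilon> \<Longrightarrow> \<Phi> s = 0"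
    "\<And>s. \<bar>s - \<phi> s\<bar> \<le> 2 * \<epsilon>" "\<And>s. (\<phi> s)\<^sup>2 \<le> s * \<phi> s" "\<And>s. \<bar>\<phi> s\<bar> \<le> \<bar>s\<bar>" "\<And>s. \<bar>s * \<phi> s - 2 * \<Phi> s\<bar> \<le> 6 * \<epsilon> * \<bar>s\<bar>"
proof -
  \<comment> \<open>A smooth positive part: it vanishes for w <= 0 and lies between
    \<open>w - \<epsilon>\<close> and \<open>w\<close> for w >= 0.\<close>
  define h where "h w = sqrt ((max 0 w)\<^sup>2 + \<epsilon>\<^sup>2) - \<epsilon>" for w
  define h' where "h' w = max 0 w / sqrt ((max 0 w)\<^sup>2 + \<epsilon>\<^sup>2)" for w
  have pos: "0 < (max 0 w)\<^sup>2 + \<epsilon>\<^sup>2" for w :: real using \<epsilon> by (simp add: add_nonneg_pos)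
  have dh: "(h has_real_derivative h' w) (at w)" for w
  proof -
    have "((\<lambda>w. (max 0 w)\<^sup>2 + \<epsilon>\<^sup>2) has_real_derivative 2 * max 0 w) (at w)"
      using DERIV_add[OF has_real_derivative_pos_part_square[of w] DERIV_const[of "\<epsilon>\<^sup>2"]] by simp
    from DERIV_diff[OF DERIV_chain2[OF DERIV_real_sqrt[OF pos] this] DERIV_const[of \<epsilon>]]
    show ?thesis unfolding h_def by (rule DERIV_cong) (simp add: h'_def divide_simps)
  qed
  have h0: "h w = 0" "h' w = 0" if "w \<le> 0" for w using that \<epsilon> by (auto simp: h_def h'_def)
  have h_nn: "0 \<le> h w" "0 \<le> h' w" for w using \<epsilon> by (auto simp: h_def h'_def intro!: real_le_rsqrt)
  have h_le: "h w \<le> w" "w - \<epsilon> \<le> h w" if "0 \<le> w" for w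
  proof -
    have "w\<^sup>2 + \<epsilon>\<^sup>2 \<le> (w + \<epsilon>)\<^sup>2" using that \<epsilon> by (simp add: power2_sum)
    then have "sqrt (w\<^sup>2 + \<epsilon>\<^sup>2) \<le> w + \<epsilon>" using that \<epsilon> by (intro real_le_lsqrt) auto
    then show "h w \<le> w" using that by (simp add: h_def)
    have "w \<le> sqrt (w\<^sup>2 + \<epsilon>\<^sup>2)" by (rule real_le_rsqrt) simp
    then show "w - \<epsilon> \<le> h w" using that by (simp add: h_def)
  qed
  \<comment> \<open>The odd extension of \<open>h\<close> shifted by \<epsilon>. The shift creates
    the dead zone around 0, and shift and smoothing together move the identity by at most
    \<open>2 * \<epsilon>\<close>.\<close>
  define \<phi> where "\<phi> s = h (s - \<epsilon>) - h (- s - \<epsilon>)" for s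
  define \<phi>' where "\<phi>' s = h' (s - \<epsilon>) + h' (- s - \<epsilon>)" for s
  have d\<phi>: "(\<phi> has_real_derivative \<phi>' s) (at s)" for s
  proof -
    have 1: "((\<lambda>s. h (s - \<epsilon>)) has_real_derivative h' (s - \<epsilon>) * 1) (at s)"
      by (rule DERIV_chain2[OF dh]) (auto intro!: derivative_eq_intros)
    have 2: "((\<lambda>s. h (- s - \<epsilon>)) has_real_derivative h' (- s - \<epsilon>) * (- 1)) (at s)"
      by (rule DERIV_chain2[OF dh]) (auto intro!: derivative_eq_intros)
    show ?thesis using DERIV_diff[OF 1 2] by (simp add: \<phi>_def[abs_def] \<phi>'_def)
  qed
  have c\<phi>': "continuous_on UNIV \<phi>'"
  proof -
    have "sqrt ((max 0 w)\<^sup>2 + \<epsilon>\<^sup>2) \<noteq> 0" for w using \<epsilon> by simp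
    then show ?thesis unfolding \<phi>'_def h'_def by (intro continuous_intros) blast+
  qed
  have \<phi>_id: "\<bar>s - \<phi> s\<bar> \<le> 2 * \<epsilon>" "(0 \<le> s \<longrightarrow> 0 \<le> \<phi> s \<and> \<phi> s \<le> s)" "(s \<le> 0 \<longrightarrow> s \<le> \<phi> s \<and> \<phi> s \<le> 0)" for s
  proof -
    consider "\<epsilon> \<le> s" | "s \<le> - \<epsilon>" | "\<bar>s\<bar> \<le> \<epsilon>" by linarith
    then show "\<bar>s - \<phi> s\<bar> \<le> 2 * \<epsilon>" "(0 \<le> s \<longrightarrow> 0 \<le> \<phi> s \<and> \<phi> s \<le> s)" "(s \<le> 0 \<longrightarrow> s \<le> \<phi> s \<and> \<phi> s \<le> 0)"
      by (cases; use h_le[of "s - \<epsilon>"] h_le[of "- s - \<epsilon>"] h0[of "s - \<epsilon>"] h0[of "- s - \<epsilon>"]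
        h_nn[of "s - \<epsilon>"] h_nn[of "- s - \<epsilon>"] \<epsilon> in \<open>auto simp: \<phi>_def\<close>)+
  qed
  have \<phi>0: "\<phi> s = 0" "\<phi>' s = 0" if "\<bar>s\<bar> \<le> \<epsilon>" for s
    using that h0[of "s - \<epsilon>"] h0[of "- s - \<epsilon>"] by (auto simp: \<phi>_def \<phi>'_def)
  obtain F where F: "\<And>s. (F has_real_derivative \<phi> s) (at s)"
  proof -
    have "\<exists>F. \<forall>x :: real. - \<infinity> < ereal x \<longrightarrow> ereal x < \<infinity> \<longrightarrow> (F has_vector_derivative \<phi> x) (at x)"
      by (rule einterval_antiderivative) (use d\<phi> in \<open>auto intro: DERIV_isCont\<close>)
    then show ?thesis using that by (auto simp: has_real_derivative_iff_has_vector_derivative)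
  qed
  define \<Phi> where "\<Phi> s = F s - F 0" for s
  have d\<Phi>: "(\<Phi> has_real_derivative \<phi> s) (at s)" for s
    unfolding \<Phi>_def using DERIV_diff[OF F[of s] DERIV_const[of "F 0"]] by simp
  \<comment> \<open>Comparing \<Phi> with \<open>s\<^sup>2 / 2\<close> costs
    \<open>2 * \<epsilon> * \<bar>s\<bar>\<close>. Counted twice, and with the same cost for
    \<open>s * \<phi> s\<close> against \<open>s\<^sup>2\<close>, this gives the 6 in the last
    claim.\<close>
  have \<Phi>_le: "\<bar>\<Phi> s - s\<^sup>2 / 2\<bar> \<le> 2 * \<epsilon> * \<bar>s\<bar>" "0 \<le> \<Phi> s" "\<bar>s\<bar> \<le> \<epsilon> \<Longrightarrow> \<Phi> s = 0" for s
  proof -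
    have mvt: "\<exists>\<xi>. (\<xi> \<in> {0..s} \<or> \<xi> \<in> {s..0}) \<and> G s - G 0 = s * G' \<xi>"
      if "\<And>x. (G has_real_derivative G' x) (at x)" for G G' :: "real \<Rightarrow> real"
    proof (cases "s = 0")
      case False
      then consider "0 < s" | "s < 0" by linarith
      then show ?thesis
      proof cases
        case 1
        with MVT2[OF 1, of G G'] that show ?thesis by (auto intro: less_imp_le)
      next
        case 2
        with MVT2[OF 2, of G G'] that obtain z where "s < z" "z < 0" "G 0 - G s = (0 - s) * G' z" by blast
        then show ?thesis by (intro exI[of _ z]) auto
      qed
    qed auto
    have "((\<lambda>s. \<Phi> s - s\<^sup>2 / 2) has_real_derivative \<phi> x - x) (at x)" for x
      by (auto intro!: derivative_eq_intros d\<Phi>)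
    from mvt[OF this] obtain \<xi> where "\<Phi> s - s\<^sup>2 / 2 = s * (\<phi> \<xi> - \<xi>)" by (auto simp: \<Phi>_def)
    moreover have "\<bar>s * (\<phi> \<xi> - \<xi>)\<bar> \<le> \<bar>s\<bar> * (2 * \<epsilon>)"
      unfolding abs_mult using \<phi>_id(1)[of \<xi>] by (intro mult_left_mono) (auto simp: abs_minus_commute)
    ultimately show "\<bar>\<Phi> s - s\<^sup>2 / 2\<bar> \<le> 2 * \<epsilon> * \<bar>s\<bar>" by (simp add: mult_ac)
    from mvt[OF d\<Phi>] obtain \<xi> where \<xi>: "\<xi> \<in> {0..s} \<or> \<xi> \<in> {s..0}" "\<Phi> s = s * \<phi> \<xi>" by (auto simp: \<Phi>_def)
    show "0 \<le> \<Phi> s" using \<xi> \<phi>_id(2,3)[of \<xi>] by (auto simp: zero_le_mult_iff)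
    show "\<Phi> s = 0" if "\<bar>s\<bar> \<le> \<epsilon>" using \<xi> \<phi>0(1)[of \<xi>] that by auto
  qed
  show ?thesis
  proof (rule that[of \<phi> \<phi>' \<Phi>])
    fix s
    show "(\<phi> s)\<^sup>2 \<le> s * \<phi> s" using \<phi>_id(2,3)[of s]
      by (cases "0 \<le> s") (auto simp: power2_eq_square intro: mult_right_mono mult_right_mono_neg)
    show "\<bar>\<phi> s\<bar> \<le> \<bar>s\<bar>" using \<phi>_id(2,3)[of s] by (cases "0 \<le> s") auto
    have "\<bar>s * (\<phi> s - s)\<bar> \<le> 2 * \<epsilon> * \<bar>s\<bar>"
      unfolding abs_mult mult.commute[of "\<bar>s\<bar>"] using \<phi>_id(1)[of s]
      by (intro mult_right_mono) (auto simp: abs_minus_commute)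
    moreover have "s * \<phi> s - 2 * \<Phi> s = s * (\<phi> s - s) - 2 * (\<Phi> s - s\<^sup>2 / 2)" by (simp add: algebra_simps power2_eq_square)
    moreover have "\<bar>p - 2 * q\<bar> \<le> 6 * z" if "\<bar>p\<bar> \<le> 2 * z" "\<bar>q\<bar> \<le> 2 * z" for p q z :: real
      using that by linarith
    ultimately show "\<bar>s * \<phi> s - 2 * \<Phi> s\<bar> \<le> 6 * \<epsilon> * \<bar>s\<bar>"
      using \<Phi>_le(1)[of s] by (simp only: mult.assoc)
    show "0 \<le> \<phi>' s" using h_nn by (simp add: \<phi>'_def)
  qed (use d\<phi> c\<phi>' d\<Phi> \<Phi>_le \<phi>0 \<phi>_id in auto)
qed

section \<open>The energy estimate in the square mean\<close>

context elliptic_domain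
begin

text \<open>The equation is multiplied by \<open>\<phi> (v x)\<close>. Diffusion gives the
  divergence of a flux plus a nonnegative term with the factor \<open>\<phi>'\<close>. Convection
  gives the divergence of \<open>b\<close> times \<open>\<Phi> (v x)\<close> minus the divergence of
  \<open>b\<close> times \<open>\<Phi> (v x)\<close>; since the divergence of \<open>b\<close> is at
  most \<open>2 * c\<close>, that term and the reaction term add up to at least
  \<open>c * (v * \<phi> - 2 * \<Phi>)\<close>, which is of order \<epsilon>. Both divergences have
  compact support and integrate to zero.\<close>

lemma energy_inequality:
  assumes v: "continuous_on (closure \<Omega>) v" "Ck_on 2 \<Omega> v" "\<And>x. x \<in> frontier \<Omega> \<Longrightarrow> v x = 0"
    and \<kappa>: "0 < \<kappa>" and b: "\<And>k. Ck_on 1 \<Omega> (\<lambda>x. b k x t)"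
    and cb: "\<And>x. x \<in> \<Omega> \<Longrightarrow> 0 \<le> c x t - 1 / 2 * (\<Sum>k\<in>UNIV. pd k (\<lambda>y. b k y t) x)"
    and B: "\<And>x. x \<in> \<Omega> \<Longrightarrow> \<bar>v x\<bar> \<le> B" and Cm: "\<And>x. x \<in> \<Omega> \<Longrightarrow> \<bar>c x t\<bar> \<le> Cm" and \<epsilon>: "0 < \<epsilon>"
    and g: "integrable lborel (\<lambda>x. if x \<in> \<Omega> then (\<kappa> * v x + ell_op a b c t v x)\<^sup>2 else 0)"
  shows "\<kappa> / 2 * (\<integral>x. (if x \<in> \<Omega> then (v x)\<^sup>2 else 0) \<partial>lborel) \<le>
    (\<integral>x. (if x \<in> \<Omega> then (\<kappa> * v x + ell_op a b c t v x)\<^sup>2 else 0) \<partial>lborel) / (2 * \<kappa>)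
     + \<epsilon> * ((6 * Cm * B + 2 * \<kappa> * B) * measure lborel \<Omega>)"
proof -
  define g where "g x = \<kappa> * v x + ell_op a b c t v x" for x
  obtain \<phi> \<phi>' \<Phi> where \<phi>: "\<And>s. (\<phi> has_real_derivative \<phi>' s) (at s)" "continuous_on UNIV \<phi>'" "\<And>s. 0 \<le> \<phi>' s"
    "\<And>s. (\<Phi> has_real_derivative \<phi> s) (at s)" "\<And>s. 0 \<le> \<Phi> s"
    "\<And>s. \<bar>s\<bar> \<le> \<epsilon> \<Longrightarrow> \<phi> s = 0" "\<And>s. \<bar>s\<bar> \<le> \<epsilon> \<Longrightarrow> \<phi>' s = 0" "\<And>s. \<bar>s\<bar> \<le> \<epsilon> \<Longrightarrow> \<Phi> s = 0"
    "\<And>s. \<bar>s - \<phi> s\<bar> \<le> 2 * \<epsilon>" "\<And>s. (\<phi> s)\<^sup>2 \<le> s * \<phi> s" "\<And>s. \<bar>\<phi> s\<bar> \<le> \<bar>s\<bar>"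
    "\<And>s. \<bar>s * \<phi> s - 2 * \<Phi> s\<bar> \<le> 6 * \<epsilon> * \<bar>s\<bar>"
    using truncated_identity[OF \<epsilon>] by metis
  \<comment> \<open>The support of \<open>\<phi> (v x)\<close> lies in \<open>K\<close>, which is
    closed and bounded and avoids the boundary, where \<open>v\<close> vanishes.\<close>
  define K where "K = {x \<in> closure \<Omega>. \<epsilon> \<le> \<bar>v x\<bar>}"
  have "K = closure \<Omega> \<inter> (\<lambda>x. \<bar>v x\<bar>) -` {\<epsilon>..}" by (auto simp: K_def)
  moreover have "closed (closure \<Omega> \<inter> (\<lambda>x. \<bar>v x\<bar>) -` {\<epsilon>..})"
    using v(1) by (intro continuous_closed_preimage continuous_intros) auto
  ultimately have "closed K" by simp
  then have K: "compact K" using bounded_dom by (auto simp: compact_eq_bounded_closed K_def intro: bounded_subset[OF bounded_closure])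
  have K\<Omega>: "K \<subseteq> \<Omega>" using v(3) \<epsilon> open_dom by (force simp: K_def frontier_def interior_open)
  have outK: "\<bar>v x\<bar> \<le> \<epsilon>" if "x \<in> \<Omega>" "x \<notin> K" for x
    using that closure_subset by (auto simp: K_def)
  have cv: "continuous_on \<Omega> v" "continuous_on \<Omega> (pd k v)" "continuous_on \<Omega> (pd k (pd k v))" for k
    using Ck_on_2D[OF v(2)] by auto
  have c\<phi>: "continuous_on UNIV \<phi>" "continuous_on UNIV \<Phi>"
    using DERIV_isCont[OF \<phi>(1)] DERIV_isCont[OF \<phi>(4)] by (simp_all add: continuous_at_imp_continuous_on)
  have cc: "continuous_on \<Omega> (\<lambda>x. \<phi> (v x))" "continuous_on \<Omega> (\<lambda>x. \<phi>' (v x))" "continuous_on \<Omega> (\<lambda>x. \<Phi> (v x))"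
    using c\<phi> \<phi>(2) cv by (auto intro: continuous_on_compose2)
  have cb': "continuous_on \<Omega> (pd k (\<lambda>x. b k x t))" "x \<in> \<Omega> \<Longrightarrow> has_pd k (\<lambda>x. b k x t) (pd k (\<lambda>x. b k x t) x) x" for k x
    using b[of k] Ck_on_Suc_has_pd[of 0 \<Omega> "\<lambda>x. b k x t"] by (auto simp: One_nat_def)
  define F' where "F' k x = (pd k (\<lambda>x. a k x t) x * pd k v x + pd k (pd k v) x * a k x t) * \<phi> (v x)
      + \<phi>' (v x) * pd k v x * (a k x t * pd k v x)" for k x
  define H' where "H' k x = pd k (\<lambda>x. b k x t) x * \<Phi> (v x) + \<phi> (v x) * pd k v x * b k x t" for k x
  have pdF: "has_pd k (\<lambda>x. a k x t * pd k v x * \<phi> (v x)) (F' k x) x" if "x \<in> \<Omega>" for k x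
    unfolding F'_def by (intro has_pd_mult has_pd_flux[OF v(2) that] has_pd_compose[OF \<phi>(1)] Ck_on_2D(4)[OF v(2) that])
  have pdH: "has_pd k (\<lambda>x. b k x t * \<Phi> (v x)) (H' k x) x" if "x \<in> \<Omega>" for k x
    unfolding H'_def by (intro has_pd_mult cb'(2) that has_pd_compose[OF \<phi>(4)] Ck_on_2D(4)[OF v(2) that])
  have contF: "continuous_on \<Omega> (F' k)" "continuous_on \<Omega> (H' k)" for k
    unfolding F'_def H'_def by (intro continuous_intros continuous_coeffs cv cc cb')+
  have intF: "(\<integral>x. (if x \<in> \<Omega> then F' k x else 0) \<partial>lborel) = 0" for k
    by (rule integral_pd_ext[OF open_dom K K\<Omega> _ contF(1) _ _ pdF])
      (use outK \<phi> in \<open>auto simp: F'_def intro!: continuous_intros continuous_coeffs cv cc\<close>)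
  have intH: "(\<integral>x. (if x \<in> \<Omega> then H' k x else 0) \<partial>lborel) = 0" for k
    by (rule integral_pd_ext[OF open_dom K K\<Omega> _ contF(2) _ _ pdH])
      (use outK \<phi> in \<open>auto simp: H'_def intro!: continuous_intros continuous_coeffs cv cc\<close>)
  have itF: "integrable lborel (\<lambda>x. if x \<in> \<Omega> then F' k x else 0)" "integrable lborel (\<lambda>x. if x \<in> \<Omega> then H' k x else 0)" for k
    by (rule continuous_ext_compact[OF open_dom K K\<Omega> contF(1)] continuous_ext_compact[OF open_dom K K\<Omega> contF(2)];
      use outK \<phi> in \<open>auto simp: F'_def H'_def\<close>)+
  have it\<phi>: "integrable lborel (\<lambda>x. if x \<in> \<Omega> then (\<phi> (v x))\<^sup>2 else 0)"
    by (rule continuous_ext_compact[OF open_dom K K\<Omega>]) (use outK \<phi> in \<open>auto intro!: continuous_intros cc\<close>)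
  have fin: "emeasure lborel \<Omega> < \<infinity>" using bounded_dom by (rule emeasure_bounded_finite)
  have meas: "\<Omega> \<in> sets lborel" using open_dom by simp
  have itc: "integrable lborel (\<lambda>x. if x \<in> \<Omega> then (\<delta>::real) else 0)" "(\<integral>x. (if x \<in> \<Omega> then \<delta> else 0) \<partial>lborel) = \<delta> * measure lborel \<Omega>" for \<delta>
  proof -
    have e: "(\<lambda>x. if x \<in> \<Omega> then \<delta> else 0) = (\<lambda>x. \<delta> * indicator \<Omega> x)" by (auto simp: indicator_def)
    show "integrable lborel (\<lambda>x. if x \<in> \<Omega> then \<delta> else 0)" "(\<integral>x. (if x \<in> \<Omega> then \<delta> else 0) \<partial>lborel) = \<delta> * measure lborel \<Omega>"
      unfolding e using fin meas by auto
  qed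
  have pointwise: "\<kappa> / 2 * (\<phi> (v x))\<^sup>2 \<le> (g x)\<^sup>2 / (2 * \<kappa>) + (\<Sum>k\<in>UNIV. F' k x) - (\<Sum>k\<in>UNIV. H' k x) + 6 * Cm * B * \<epsilon>" if x: "x \<in> \<Omega>" for x
  proof -
    define s where "s = (\<Sum>k\<in>UNIV. pd k (\<lambda>x. b k x t) x)"
    have "g x * \<phi> (v x) = \<kappa> * (v x * \<phi> (v x)) + ((\<Sum>k\<in>UNIV. H' k x) - (\<Sum>k\<in>UNIV. F' k x))
       + (\<Sum>k\<in>UNIV. a k x t * (pd k v x)\<^sup>2 * \<phi>' (v x)) + (c x t * (v x * \<phi> (v x)) - s * \<Phi> (v x))"
      unfolding g_def ell_op_expand[OF v(2) x] F'_def H'_def s_def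
      by (simp add: algebra_simps sum.distrib sum_distrib_left sum_distrib_right sum_negf sum_subtractf power2_eq_square)
    moreover have "0 \<le> (\<Sum>k\<in>UNIV. a k x t * (pd k v x)\<^sup>2 * \<phi>' (v x))"
      using a_pos[OF x] \<phi>(3) by (intro sum_nonneg mult_nonneg_nonneg) (auto simp: less_imp_le)
    moreover have "- (6 * Cm * B * \<epsilon>) \<le> c x t * (v x * \<phi> (v x)) - s * \<Phi> (v x)"
    proof -
      have "s * \<Phi> (v x) \<le> (2 * c x t) * \<Phi> (v x)" using cb[OF x] \<phi>(5) by (intro mult_right_mono) (auto simp: s_def)
      moreover have "\<bar>c x t * (v x * \<phi> (v x) - 2 * \<Phi> (v x))\<bar> \<le> Cm * (6 * \<epsilon> * B)"
        unfolding abs_mult using Cm[OF x] B[OF x] \<epsilon> \<phi>(12)[of "v x"]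
        by (intro mult_mono) (auto intro: order_trans mult_left_mono)
      ultimately show ?thesis by (simp add: algebra_simps abs_le_iff)
    qed
    moreover have "\<kappa> * (\<phi> (v x))\<^sup>2 \<le> \<kappa> * (v x * \<phi> (v x))" using \<phi>(10) \<kappa> by (intro mult_left_mono) auto
    \<comment> \<open>Young's inequality balanced so that half of the coercive term is absorbed; the
      other half is the left-hand side of the claim.\<close>
    moreover have "g x * \<phi> (v x) \<le> (g x)\<^sup>2 / (2 * \<kappa>) + \<kappa> / 2 * (\<phi> (v x))\<^sup>2"
    proof -
      have "0 \<le> (g x - \<kappa> * \<phi> (v x))\<^sup>2 / (2 * \<kappa>)" using \<kappa> by simp
      also have "\<dots> = (g x)\<^sup>2 / (2 * \<kappa>) + \<kappa> / 2 * (\<phi> (v x))\<^sup>2 - g x * \<phi> (v x)"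
        using \<kappa> by (simp add: power2_diff field_simps power2_eq_square)
      finally show ?thesis by simp
    qed
    ultimately show ?thesis by linarith
  qed
  have "\<kappa> / 2 * (\<integral>x. (if x \<in> \<Omega> then (\<phi> (v x))\<^sup>2 else 0) \<partial>lborel) = (\<integral>x. \<kappa> / 2 * (if x \<in> \<Omega> then (\<phi> (v x))\<^sup>2 else 0) \<partial>lborel)"
    by simp
  also have "\<dots> \<le> (\<integral>x. (if x \<in> \<Omega> then (g x)\<^sup>2 else 0) / (2 * \<kappa>) + (\<Sum>k\<in>UNIV. (if x \<in> \<Omega> then F' k x else 0))
     - (\<Sum>k\<in>UNIV. (if x \<in> \<Omega> then H' k x else 0)) + (if x \<in> \<Omega> then 6 * Cm * B * \<epsilon> else 0) \<partial>lborel)"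
    using g it\<phi> itF itc pointwise unfolding g_def[symmetric]
    by (intro integral_mono) (auto intro!: Bochner_Integration.integrable_add Bochner_Integration.integrable_diff)
  also have "\<dots> = (\<integral>x. (if x \<in> \<Omega> then (g x)\<^sup>2 else 0) \<partial>lborel) / (2 * \<kappa>) + 6 * Cm * B * \<epsilon> * measure lborel \<Omega>"
    using g itF itc unfolding g_def[symmetric]
    by (simp add: intF intH Bochner_Integration.integral_sum)
  finally have main: "\<kappa> / 2 * (\<integral>x. (if x \<in> \<Omega> then (\<phi> (v x))\<^sup>2 else 0) \<partial>lborel) \<le>
     (\<integral>x. (if x \<in> \<Omega> then (g x)\<^sup>2 else 0) \<partial>lborel) / (2 * \<kappa>) + 6 * Cm * B * \<epsilon> * measure lborel \<Omega>" .
  \<comment> \<open>Returning from \<open>\<phi> (v x)\<close> to \<open>v x\<close> costs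
    \<open>(2 * \<epsilon>) * (2 * B)\<close> pointwise; after multiplication by
    \<open>\<kappa> / 2\<close> this is the term with \<open>2 * \<kappa> * B\<close>.\<close>
  have "(\<integral>x. (if x \<in> \<Omega> then (v x)\<^sup>2 else 0) \<partial>lborel) \<le> (\<integral>x. (if x \<in> \<Omega> then (\<phi> (v x))\<^sup>2 else 0) + (if x \<in> \<Omega> then 4 * \<epsilon> * B else 0) \<partial>lborel)"
  proof (rule integral_mono')
    show "integrable lborel (\<lambda>x. (if x \<in> \<Omega> then (\<phi> (v x))\<^sup>2 else 0) + (if x \<in> \<Omega> then 4 * \<epsilon> * B else 0))"
      using it\<phi> itc by auto
    fix x
    show "(if x \<in> \<Omega> then (v x)\<^sup>2 else 0) \<le> (if x \<in> \<Omega> then (\<phi> (v x))\<^sup>2 else 0) + (if x \<in> \<Omega> then 4 * \<epsilon> * B else 0)"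
    proof (cases "x \<in> \<Omega>")
      case True
      have "(v x)\<^sup>2 - (\<phi> (v x))\<^sup>2 = (v x - \<phi> (v x)) * (v x + \<phi> (v x))" by (simp add: power2_eq_square algebra_simps)
      also have "\<dots> \<le> \<bar>v x - \<phi> (v x)\<bar> * \<bar>v x + \<phi> (v x)\<bar>" by (metis abs_ge_self abs_mult)
      also have "\<dots> \<le> (2 * \<epsilon>) * (2 * B)"
        using \<phi>(9,11)[of "v x"] B[OF True] \<epsilon> by (intro mult_mono) auto
      finally show ?thesis using True by simp
    qed auto
    show "0 \<le> (if x \<in> \<Omega> then (\<phi> (v x))\<^sup>2 else 0) + (if x \<in> \<Omega> then 4 * \<epsilon> * B else 0)"
      using B[of x] \<epsilon> by (auto intro!: add_nonneg_nonneg mult_nonneg_nonneg)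
  qed
  also have "\<dots> = (\<integral>x. (if x \<in> \<Omega> then (\<phi> (v x))\<^sup>2 else 0) \<partial>lborel) + 4 * \<epsilon> * B * measure lborel \<Omega>"
    using it\<phi> itc by simp
  finally have "\<kappa> / 2 * (\<integral>x. (if x \<in> \<Omega> then (v x)\<^sup>2 else 0) \<partial>lborel) \<le>
    \<kappa> / 2 * ((\<integral>x. (if x \<in> \<Omega> then (\<phi> (v x))\<^sup>2 else 0) \<partial>lborel) + 4 * \<epsilon> * B * measure lborel \<Omega>)"
    using \<kappa> by (intro mult_left_mono) auto
  with main show ?thesis unfolding g_def[symmetric] by (simp add: algebra_simps)
qed

text \<open>The bounds \<open>B\<close> and \<open>Cm\<close> exist by compactness of the closure.
  They depend on \<open>v\<close> and the data but occur only together with \<epsilon>, and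
  disappear in the limit.\<close>

theorem energy_estimate:
  assumes v: "continuous_on (closure \<Omega>) v" "Ck_on 2 \<Omega> v" "\<And>x. x \<in> frontier \<Omega> \<Longrightarrow> v x = 0"
    and \<kappa>: "0 < \<kappa>" and b: "\<And>k. Ck_on 1 \<Omega> (\<lambda>x. b k x t)"
    and cb: "\<And>x. x \<in> \<Omega> \<Longrightarrow> 0 \<le> c x t - 1 / 2 * (\<Sum>k\<in>UNIV. pd k (\<lambda>y. b k y t) x)"
    and C: "(\<integral>\<^sup>+x. ennreal ((\<kappa> * v x + ell_op a b c t v x)\<^sup>2) * indicator \<Omega> x \<partial>lborel) \<le> ennreal (C\<^sup>2)"
  shows "(\<integral>\<^sup>+x. ennreal ((v x)\<^sup>2) * indicator \<Omega> x \<partial>lborel) \<le> ennreal ((C / \<kappa>)\<^sup>2)"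
proof -
  define g where "g x = \<kappa> * v x + ell_op a b c t v x" for x
  have cg: "continuous_on \<Omega> g" unfolding g_def
    using Ck_on_2D(1)[OF v(2)] continuous_ell_op[OF v(2)] by (intro continuous_intros)
  have comp: "compact (closure \<Omega>)" using bounded_dom by simp
  have bd: "\<exists>B. \<forall>x\<in>\<Omega>. \<bar>f x\<bar> \<le> B" if "continuous_on (closure \<Omega>) f" for f :: "real ^ 'd \<Rightarrow> real"
    using compact_imp_bounded[OF compact_continuous_image[OF that comp]] closure_subset[of \<Omega>]
    by (fastforce simp: bounded_iff)
  obtain B where B: "\<And>x. x \<in> \<Omega> \<Longrightarrow> \<bar>v x\<bar> \<le> B" using bd[OF v(1)] by blast
  obtain Cm where Cm: "\<And>x. x \<in> \<Omega> \<Longrightarrow> \<bar>c x t\<bar> \<le> Cm" using bd[OF c_cont] by blast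
  have ext_meas: "(\<lambda>x. if x \<in> \<Omega> then (f x)\<^sup>2 else 0) \<in> borel_measurable lborel" if "continuous_on \<Omega> f" for f :: "real ^ 'd \<Rightarrow> real"
  proof -
    have "(\<lambda>x. indicator \<Omega> x *\<^sub>R (f x)\<^sup>2) \<in> borel_measurable borel"
      using that open_dom by (intro borel_measurable_continuous_on_indicator) (auto intro!: continuous_intros)
    moreover have "(\<lambda>x. indicator \<Omega> x *\<^sub>R (f x)\<^sup>2) = (\<lambda>x. if x \<in> \<Omega> then (f x)\<^sup>2 else 0)" by (auto simp: indicator_def)
    ultimately show ?thesis by simp
  qed
  have nn: "(\<integral>\<^sup>+x. ennreal ((f x)\<^sup>2) * indicator \<Omega> x \<partial>lborel) = (\<integral>\<^sup>+x. ennreal (if x \<in> \<Omega> then (f x)\<^sup>2 else 0) \<partial>lborel)" for f :: "real ^ 'd \<Rightarrow> real"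
    by (intro nn_integral_cong) (auto simp: indicator_def)
  have fin: "(\<integral>\<^sup>+x. ennreal (if x \<in> \<Omega> then (g x)\<^sup>2 else 0) \<partial>lborel) \<le> ennreal (C\<^sup>2)"
    using C unfolding g_def[symmetric] nn .
  then have "(\<integral>\<^sup>+x. ennreal (if x \<in> \<Omega> then (g x)\<^sup>2 else 0) \<partial>lborel) < \<infinity>"
    by (rule le_less_trans) simp
  then have ig: "integrable lborel (\<lambda>x. if x \<in> \<Omega> then (g x)\<^sup>2 else 0)"
    by (intro integrableI_nonneg ext_meas cg) auto
  have "ennreal (\<integral>x. (if x \<in> \<Omega> then (g x)\<^sup>2 else 0) \<partial>lborel) \<le> ennreal (C\<^sup>2)"
    using fin nn_integral_eq_integral[OF ig] by simp
  then have Ig: "(\<integral>x. (if x \<in> \<Omega> then (g x)\<^sup>2 else 0) \<partial>lborel) \<le> C\<^sup>2" by (subst (asm) ennreal_le_iff) auto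
  define Z where "Z = (6 * Cm * B + 2 * \<kappa> * B) * measure lborel \<Omega>"
  define I where "I = (\<integral>x. (if x \<in> \<Omega> then (v x)\<^sup>2 else 0) \<partial>lborel)"
  \<comment> \<open>The inequality for every positive \<epsilon>; its right-hand side is affine in
    \<epsilon>, and the limit from the right at 0 is taken next.\<close>
  have "\<kappa> / 2 * I \<le> C\<^sup>2 / (2 * \<kappa>) + \<epsilon> * Z" if \<epsilon>: "0 < \<epsilon>" for \<epsilon>
  proof -
    have "\<kappa> / 2 * I \<le> (\<integral>x. (if x \<in> \<Omega> then (g x)\<^sup>2 else 0) \<partial>lborel) / (2 * \<kappa>) + \<epsilon> * Z"
      unfolding I_def Z_def g_def
      by (rule energy_inequality[OF v \<kappa> b cb B Cm \<epsilon>]) (use ig[unfolded g_def] in auto)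
    moreover have "(\<integral>x. (if x \<in> \<Omega> then (g x)\<^sup>2 else 0) \<partial>lborel) / (2 * \<kappa>) \<le> C\<^sup>2 / (2 * \<kappa>)"
      using Ig \<kappa> by (intro divide_right_mono) auto
    ultimately show ?thesis by simp
  qed
  moreover have "((\<lambda>\<epsilon>. C\<^sup>2 / (2 * \<kappa>) + \<epsilon> * Z) \<longlongrightarrow> C\<^sup>2 / (2 * \<kappa>) + 0 * Z) (at_right 0)"
    by (intro tendsto_intros)
  ultimately have "\<kappa> / 2 * I \<le> C\<^sup>2 / (2 * \<kappa>) + 0 * Z"
    by (intro tendsto_lowerbound[where F = "at_right (0::real)"]) (auto simp: eventually_at_right_less intro!: eventually_at_rightI[of 0 1])
  then have I_le: "I \<le> (C / \<kappa>)\<^sup>2" using \<kappa> by (simp add: field_simps power2_eq_square)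
  have "integrable lborel (\<lambda>x. if x \<in> \<Omega> then (v x)\<^sup>2 else 0)"
  proof (rule Bochner_Integration.integrable_bound)
    show "integrable lborel (\<lambda>x. indicator \<Omega> x * B\<^sup>2)"
      using emeasure_bounded_finite[OF bounded_dom] open_dom by auto
    show "(\<lambda>x. if x \<in> \<Omega> then (v x)\<^sup>2 else 0) \<in> borel_measurable lborel"
      using Ck_on_2D(1)[OF v(2)] by (rule ext_meas)
    show "AE x in lborel. norm (if x \<in> \<Omega> then (v x)\<^sup>2 else 0) \<le> norm (indicator \<Omega> x * B\<^sup>2)"
      using B by (intro AE_I2) (auto simp: abs_le_square_iff[symmetric] dest!: B)
  qed
  then have "(\<integral>\<^sup>+x. ennreal (if x \<in> \<Omega> then (v x)\<^sup>2 else 0) \<partial>lborel) = ennreal I"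
    unfolding I_def by (intro nn_integral_eq_integral) auto
  then show ?thesis unfolding nn using I_le by (simp only:) (rule ennreal_leI)
qed

end

section \<open>Truncation error in \<open>L\<^sub>p\<close> and convergence\<close>

text \<open>The pointwise error is dominated by a measurable \<open>F\<close>, a combination of time
  integrals of the first two derivatives, to which Minkowski's inequality applies. The condition
  \<theta> < \<alpha> + 1 comes from the first interval and from the weighted sum at \<mu> =
  \<alpha>; the bound \<open>(2 - \<alpha>) / r\<close> comes from the steps near
  \<open>t m\<close>.\<close>

theorem truncation_error_Lp:
  fixes \<Omega> :: "(real ^ 'd::finite) set" and u :: "real ^ 'd \<Rightarrow> real \<Rightarrow> real" and \<alpha> r c T \<theta> :: real
  assumes \<alpha>: "0 < \<alpha>" "\<alpha> < 1" and T: "0 < T" and r: "1 \<le> r" and c: "0 < c"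
    and \<theta>: "0 \<le> \<theta>" "\<theta> \<le> (2 - \<alpha>) / r" "\<theta> < \<alpha> + 1" and p: "p \<in> {2, \<infinity>}" and \<Omega>: "open \<Omega>"
    and cont: "continuous_on (closure \<Omega> \<times> {0..T}) (\<lambda>(x, t). u x t)"
    and int: "\<And>x t. x \<in> \<Omega> \<Longrightarrow> t \<in> {0<..T} \<Longrightarrow> set_integrable lborel {0<..<t} (\<lambda>s. (t - s) powr (-\<alpha>) * dt T (u x) s)"
    and bnd: "time_derivs_bounded p T \<alpha> \<Omega> u"
  shows "\<exists>C>0. \<forall>N t m. fine_mesh \<alpha> r c N t \<longrightarrow> t N = T \<longrightarrow> m \<in> {1..N} \<longrightarrow>
    (\<exists>F. F \<in> borel_measurable (restrict_space lborel \<Omega>) \<and>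
      (\<forall>x\<in>\<Omega>. ennreal \<bar>fine_mesh.L1_sum \<alpha> t m (\<lambda>j. u x (t j)) - (LINT s:{0<..<t m}|lborel. (t m - s) powr (-\<alpha>) * dt T (u x) s)\<bar> \<le> F x) \<and>
      Lp_le p (restrict_space lborel \<Omega>) F (C * (t 1 / t m) powr \<theta>))"
proof -
  define M where "M = restrict_space lborel \<Omega>"
  define N0 where "N0 = restrict_space lborel {0<..<T}"
  have \<Omega>b: "\<Omega> \<in> sets borel" using \<Omega> by simp
  have sp: "space M = \<Omega>" "space N0 = {0<..<T}" by (simp_all add: M_def N0_def)
  have sf: "sigma_finite_measure M" "sigma_finite_measure N0"
    using \<Omega>b by (auto simp: M_def N0_def intro: sigma_finite_lborel_on)
  define u1 where "u1 x = dt T (u x)" for x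
  define u2 where "u2 x = dt T (u1 x)" for x
  have dtl: "(dt T ^^ 1) (u x) = u1 x" "(dt T ^^ 2) (u x) = u2 x" for x
    by (simp_all add: u1_def u2_def numeral_2_eq_2)
  have diff: "u x differentiable (at s within {0..T})" "u1 x differentiable (at s within {0..T})" if "x \<in> \<Omega>" "s \<in> {0<..T}" for x s
    using bnd that by (auto simp: time_derivs_bounded_def u1_def)
  have der: "(u x has_real_derivative u1 x s) (at s)" "(u1 x has_real_derivative u2 x s) (at s)" if "x \<in> \<Omega>" "0 < s" "s < T" for x s
    using dt_has_real_derivative diff[of x s] that by (auto simp: u1_def u2_def)
  obtain C0 where C0: "\<And>l t. l \<in> {1, 2} \<Longrightarrow> t \<in> {0<..T} \<Longrightarrow> Lp_norm p \<Omega> (\<lambda>x. (dt T ^^ l) (u x) t) \<le> ennreal (C0 * (1 + t powr (\<alpha> - real l)))"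
    using bnd unfolding time_derivs_bounded_def by blast
  \<comment> \<open>On the bounded time interval the summand 1 is absorbed into
    \<open>s powr (\<alpha> - l)\<close>, whose exponent is negative.\<close>
  define D where "D = max 1 C0 * (T powr (1 - \<alpha>) + T powr (2 - \<alpha>) + 1)"
  have D: "0 < D" unfolding D_def by (intro mult_pos_pos add_nonneg_pos add_nonneg_nonneg) auto
  have Lp: "Lp_le p M (\<lambda>x. ennreal \<bar>(dt T ^^ l) (u x) s\<bar>) (D * s powr (\<alpha> - real l))" if l: "l \<in> {1, 2}" and s: "0 < s" "s < T" for l s
  proof -
    have "C0 * (1 + s powr (\<alpha> - real l)) \<le> max 1 C0 * (1 + s powr (\<alpha> - real l))"
      by (intro mult_right_mono) auto
    also have "\<dots> \<le> max 1 C0 * ((T powr (1 - \<alpha>) + T powr (2 - \<alpha>)) * s powr (\<alpha> - real l) + s powr (\<alpha> - real l))"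
    proof -
      have "1 = s powr (real l - \<alpha>) * s powr (\<alpha> - real l)" using s by (simp flip: powr_add)
      also have "\<dots> \<le> T powr (real l - \<alpha>) * s powr (\<alpha> - real l)"
        using s l \<alpha> by (intro mult_right_mono powr_mono2) auto
      also have "\<dots> \<le> (T powr (1 - \<alpha>) + T powr (2 - \<alpha>)) * s powr (\<alpha> - real l)"
        using l by (intro mult_right_mono) auto
      finally show ?thesis by (intro mult_left_mono) auto
    qed
    also have "\<dots> = D * s powr (\<alpha> - real l)" by (simp add: D_def algebra_simps)
    finally have "Lp_norm p \<Omega> (\<lambda>x. (dt T ^^ l) (u x) s) \<le> ennreal (D * s powr (\<alpha> - real l))"
      using C0[OF l, of s] s by (auto intro: order_trans ennreal_leI)
    then show ?thesis using D by (subst (asm) Lp_norm_le_iff[OF p \<Omega>b]) (auto simp: M_def)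
  qed
  have Lp1: "Lp_le p M (\<lambda>x. ennreal \<bar>u1 x s\<bar>) (D * s powr (\<alpha> - 1))"
    and Lp2: "Lp_le p M (\<lambda>x. ennreal \<bar>u2 x s\<bar>) (D * s powr (\<alpha> - 2))" if "0 < s" "s < T" for s
    using Lp[of 1 s] Lp[of 2 s] that by (auto simp only: dtl insert_iff of_nat_1 of_nat_numeral)
  have meas0: "(\<lambda>(x, s). u x s) \<in> borel_measurable (M \<Otimes>\<^sub>M N0)"
  proof -
    have "continuous_on (\<Omega> \<times> {0<..<T}) (\<lambda>(x, t). u x t)"
      using cont by (rule continuous_on_subset) (use closure_subset in fastforce)
    then have "(\<lambda>(x, t). u x t) \<in> borel_measurable (restrict_space borel (\<Omega> \<times> {0<..<T}))"
      by (rule borel_measurable_continuous_on_restrict)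
    moreover have "(\<lambda>z. z) \<in> measurable (M \<Otimes>\<^sub>M N0) (restrict_space borel (\<Omega> \<times> {0<..<T}))"
    proof (rule measurable_restrict_space2)
      show "(\<lambda>z. z) \<in> space (M \<Otimes>\<^sub>M N0) \<rightarrow> \<Omega> \<times> {0<..<T}" by (auto simp: space_pair_measure sp)
      have "fst \<in> borel_measurable (M \<Otimes>\<^sub>M N0)" "snd \<in> borel_measurable (M \<Otimes>\<^sub>M N0)"
        unfolding M_def N0_def by (intro measurable_compose[OF measurable_fst] measurable_compose[OF measurable_snd] measurable_restrict_space1; simp)+
      then have "(\<lambda>z. (fst z, snd z)) \<in> borel_measurable (M \<Otimes>\<^sub>M N0)" by (rule borel_measurable_Pair)
      then show "(\<lambda>z. z) \<in> borel_measurable (M \<Otimes>\<^sub>M N0)" by simp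
    qed
    ultimately show ?thesis by (rule measurable_compose[rotated])
  qed
  have meas1: "(\<lambda>(x, s). u1 x s) \<in> borel_measurable (M \<Otimes>\<^sub>M N0)"
    unfolding N0_def by (rule borel_measurable_time_derivative[OF meas0[unfolded N0_def]]) (use der sp in auto)
  have meas2: "(\<lambda>(x, s). u2 x s) \<in> borel_measurable (M \<Otimes>\<^sub>M N0)"
    unfolding N0_def by (rule borel_measurable_time_derivative[OF meas1[unfolded N0_def]]) (use der sp in auto)
  have G1: "(\<lambda>(x, s). ennreal \<bar>u1 x s\<bar>) \<in> borel_measurable (M \<Otimes>\<^sub>M N0)" "(\<lambda>(x, s). ennreal \<bar>u2 x s\<bar>) \<in> borel_measurable (M \<Otimes>\<^sub>M N0)"
    using meas1 meas2 by (simp_all add: case_prod_beta')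
  obtain CX where CX: "0 < CX" "\<And>N t m. fine_mesh \<alpha> r c N t \<Longrightarrow> m \<in> {1..N} \<Longrightarrow>
    (\<Sum>j\<in>{1..<m}. (t (Suc j) - t j) * t j powr (\<alpha> - 2) * fine_mesh.ker_osc \<alpha> t m j) \<le> CX * (t m powr (\<alpha> - \<alpha>) * (t 1 / t m) powr \<theta>)"
    using sum_ker_osc_weighted[of \<theta> \<alpha> r \<alpha> c] assms by auto
  define C1 where "C1 = 2 powr (\<alpha> + 1) + 2 powr \<theta> * ((2 / (1 - \<alpha>) + 2) / \<alpha> + 2 / (1 - \<alpha>))"
  have C1: "0 < C1" unfolding C1_def using \<alpha> by (intro add_pos_nonneg) auto
  have "\<exists>F. F \<in> borel_measurable M \<and>
      (\<forall>x\<in>\<Omega>. ennreal \<bar>fine_mesh.L1_sum \<alpha> t m (\<lambda>j. u x (t j)) - (LINT s:{0<..<t m}|lborel. (t m - s) powr (-\<alpha>) * u1 x s)\<bar> \<le> F x) \<and>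
      Lp_le p M F (D * (C1 + 2 * CX) * (t 1 / t m) powr \<theta>)"
    if fm: "fine_mesh \<alpha> r c N t" and tN: "t N = T" and m: "m \<in> {1..N}" for N t m
  proof -
    interpret fine_mesh \<alpha> r c N t by fact
    have t1: "0 < t 1" "t 1 \<le> t m" "0 < t m" "t m \<le> T" using t_1_pos t_1_le[of m] t_pos[of m] t_le[of m N] m tN by auto
    \<comment> \<open>Index 0 is the first interval, with the kernel error as weight and the first
      derivative; every later index has an indicator as weight and the second derivative.
      \<open>G j\<close> is the resulting time integral, \<open>v j\<close> its kernel factor in the
      truncation bound, and \<open>b j\<close> its norm bound.\<close>
    define w where "w j s = (if j = 0 then \<bar>ker_avg m 0 - (t m - s) powr (-\<alpha>)\<bar> * indicator {0<..<t 1} s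
       else indicator {t j<..<t (Suc j)} s)" for j and s :: real
    define G where "G j x = (\<integral>\<^sup>+s. ennreal (w j s) * ennreal \<bar>(if j = 0 then u1 x s else u2 x s)\<bar> \<partial>N0)" for j :: nat and x
    define v where "v j = (if j = 0 then 1 else 2 * ker_osc m j)" for j
    define b where "b j = D * (if j = 0 then C1 * (t 1 / t m) powr \<theta> else (t (Suc j) - t j) * t j powr (\<alpha> - 2))" for j
    have wm: "w j \<in> borel_measurable N0" for j
      unfolding N0_def w_def by (intro measurable_restrict_space1) (cases "j = 0"; simp)
    have w0: "0 \<le> w j s" for j s by (auto simp: w_def indicator_def)
    have v0: "0 \<le> v j" if "j < m" for j using ker_osc_pos[of j m] that m by (auto simp: v_def)
    have b0: "0 < b j" if "j < m" for j
      using D C1 t1 t_pos[of j] t_less_Suc[of j] that m by (auto simp: b_def intro!: mult_pos_pos)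
    have Gm: "G j \<in> borel_measurable M" for j
    proof -
      interpret N0: sigma_finite_measure N0 by (rule sf)
      have [measurable]: "w j \<in> borel_measurable N0" by (rule wm)
      have [measurable]: "(\<lambda>z. ennreal \<bar>u1 (fst z) (snd z)\<bar>) \<in> borel_measurable (M \<Otimes>\<^sub>M N0)" "(\<lambda>z. ennreal \<bar>u2 (fst z) (snd z)\<bar>) \<in> borel_measurable (M \<Otimes>\<^sub>M N0)"
        using G1 by (simp_all add: case_prod_beta')
      have "(\<lambda>(x, s). ennreal (w j s) * ennreal \<bar>(if j = 0 then u1 x s else u2 x s)\<bar>) \<in> borel_measurable (M \<Otimes>\<^sub>M N0)"
      proof -
        have "(\<lambda>z. ennreal (w j (snd z)) * ennreal \<bar>u1 (fst z) (snd z)\<bar>) \<in> borel_measurable (M \<Otimes>\<^sub>M N0)"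
          "(\<lambda>z. ennreal (w j (snd z)) * ennreal \<bar>u2 (fst z) (snd z)\<bar>) \<in> borel_measurable (M \<Otimes>\<^sub>M N0)"
          by measurable
        then show ?thesis by (cases "j = 0") (simp_all add: case_prod_beta')
      qed
      from N0.borel_measurable_nn_integral[OF this] show ?thesis unfolding G_def .
    qed
    have tj: "0 < t j" "t j < t (Suc j)" "t (Suc j) \<le> T" if "j \<in> {1..<m}" for j
      using t_pos[of j] t_less_Suc[of j] t_le[of "Suc j" N] that m tN by auto
    have GL: "Lp_le p M (G j) (b j)" if j: "j < m" for j
    proof (cases "j = 0")
      case True
      have "(\<integral>\<^sup>+s. ennreal (w j s * (D * s powr (\<alpha> - 1))) \<partial>N0) \<le> ennreal (b j)"
      proof -
        have "(\<integral>\<^sup>+s. ennreal (w j s * (D * s powr (\<alpha> - 1))) \<partial>N0) =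
          (\<integral>\<^sup>+s. ennreal D * ennreal (\<bar>ker_avg m 0 - (t m - s) powr (-\<alpha>)\<bar> * s powr (\<alpha> - 1) * indicator {0<..<t 1} s) \<partial>lborel)"
          unfolding N0_def using True D t1
          by (subst nn_integral_lborel_on(1)) (auto simp: w_def indicator_def ennreal_mult'[symmetric] mult_ac intro!: nn_integral_cong)
        also have "\<dots> = ennreal D * (\<integral>\<^sup>+s. ennreal (\<bar>ker_avg m 0 - (t m - s) powr (-\<alpha>)\<bar> * s powr (\<alpha> - 1) * indicator {0<..<t 1} s) \<partial>lborel)"
          by (intro nn_integral_cmult) auto
        also have "\<dots> \<le> ennreal D * ennreal (C1 * (t 1 / t m) powr \<theta>)"
          unfolding C1_def using first_interval_kernel[of m \<theta>] m \<theta> by (intro mult_left_mono) auto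
        also have "\<dots> = ennreal (b j)" using True D C1 by (simp add: b_def flip: ennreal_mult)
        finally show ?thesis .
      qed
      then have "Lp_le p M (\<lambda>x. \<integral>\<^sup>+s. ennreal (w j s) * ennreal \<bar>u1 x s\<bar> \<partial>N0) (b j)"
        using b0[OF j] D by (intro Lp_le_integral[OF sf G1(1) wm w0, where \<rho> = "\<lambda>s. D * s powr (\<alpha> - 1)"])
          (auto simp: sp N0_def Lp1 intro!: measurable_restrict_space1)
      then show ?thesis using True by (simp add: G_def[abs_def])
    next
      case False
      then have j': "j \<in> {1..<m}" using j by auto
      have "(\<integral>\<^sup>+s. ennreal (w j s * (D * s powr (\<alpha> - 2))) \<partial>N0) \<le> ennreal (b j)"
      proof -
        have "(\<integral>\<^sup>+s. ennreal (w j s * (D * s powr (\<alpha> - 2))) \<partial>N0) \<le> (\<integral>\<^sup>+s. ennreal (D * t j powr (\<alpha> - 2)) * indicator {t j<..<t (Suc j)} s \<partial>lborel)"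
          unfolding N0_def
        proof (subst nn_integral_lborel_on(1), simp, rule nn_integral_mono)
          fix s
          have "D * s powr (\<alpha> - 2) \<le> D * t j powr (\<alpha> - 2)" if "t j < s"
            using that tj[OF j'] D \<alpha> by (intro mult_left_mono powr_mono2') auto
          then show "ennreal (w j s * (D * s powr (\<alpha> - 2))) * indicator {0<..<T} s \<le> ennreal (D * t j powr (\<alpha> - 2)) * indicator {t j<..<t (Suc j)} s"
            using False by (auto simp: w_def indicator_def intro!: ennreal_leI)
        qed
        also have "\<dots> = ennreal (D * t j powr (\<alpha> - 2)) * ennreal (t (Suc j) - t j)"
          using tj[OF j'] by (simp add: nn_integral_cmult_indicator)
        also have "\<dots> = ennreal (b j)" using False D tj[OF j'] by (simp add: b_def mult_ac flip: ennreal_mult)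
        finally show ?thesis .
      qed
      then have "Lp_le p M (\<lambda>x. \<integral>\<^sup>+s. ennreal (w j s) * ennreal \<bar>u2 x s\<bar> \<partial>N0) (b j)"
        using b0[OF j] D by (intro Lp_le_integral[OF sf G1(2) wm w0, where \<rho> = "\<lambda>s. D * s powr (\<alpha> - 2)"])
          (auto simp: sp N0_def Lp2 intro!: measurable_restrict_space1)
      then show ?thesis using False by (simp add: G_def[abs_def])
    qed
    define F where "F x = (\<Sum>j<m. ennreal (v j) * G j x)" for x
    have split: "{..<m} = insert 0 {1..<m}" using m by auto
    have "Lp_le p M F (\<Sum>j<m. v j * b j)"
      unfolding F_def using Gm v0 b0 GL by (intro Lp_le_sum[OF sf(1)]) auto
    moreover have "(\<Sum>j<m. v j * b j) \<le> D * (C1 + 2 * CX) * (t 1 / t m) powr \<theta>"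
    proof -
      have "(\<Sum>j<m. v j * b j) = D * (C1 * (t 1 / t m) powr \<theta>) + 2 * D * (\<Sum>j\<in>{1..<m}. (t (Suc j) - t j) * t j powr (\<alpha> - 2) * ker_osc m j)"
        unfolding split by (simp add: v_def b_def sum_distrib_left mult_ac)
      also have "\<dots> \<le> D * (C1 * (t 1 / t m) powr \<theta>) + 2 * D * (CX * (t 1 / t m) powr \<theta>)"
        using CX(2)[OF fm m] C1 D t1 by (intro add_mono mult_left_mono) auto
      finally show ?thesis by (simp add: algebra_simps)
    qed
    moreover have "0 \<le> (\<Sum>j<m. v j * b j)" using v0 b0 by (auto intro!: sum_nonneg simp: less_imp_le)
    ultimately have L: "Lp_le p M F (D * (C1 + 2 * CX) * (t 1 / t m) powr \<theta>)"
      using Lp_le_mono[of p M F _ F] by auto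
    have bound: "ennreal \<bar>L1_sum m (\<lambda>j. u x (t j)) - (LINT s:{0<..<t m}|lborel. (t m - s) powr (-\<alpha>) * u1 x s)\<bar> \<le> F x" if x: "x \<in> \<Omega>" for x
    proof -
      have "continuous_on {0..T} (\<lambda>s. (\<lambda>(x, t). u x t) (x, s))"
        using cont by (rule continuous_on_compose2) (use x closure_subset in \<open>auto intro!: continuous_intros\<close>)
      then have cu: "continuous_on {0..t m} (u x)" using t1 by (auto intro: continuous_on_subset)
      have cu1: "continuous_on {0<..t m} (u1 x)"
      proof -
        have "continuous (at s within {0<..T}) (u1 x)" if "s \<in> {0<..T}" for s
          using differentiable_imp_continuous_within[OF diff(2)[OF x that]] by (rule continuous_within_subset) auto
        then have "continuous_on {0<..T} (u1 x)" by (simp add: continuous_on_eq_continuous_within)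
        then show ?thesis using t1 by (auto intro: continuous_on_subset)
      qed
      have "u2 x \<in> borel_measurable N0" using measurable_Pair2[OF meas2, of x] x sp by simp
      then have "set_borel_measurable borel {0<..<T} (u2 x)"
        unfolding N0_def set_borel_measurable_def by (subst (asm) borel_measurable_restrict_space_iff) auto
      then have mu2: "set_borel_measurable borel {0<..<t m} (u2 x)"
        by (rule set_borel_measurable_subset) (use t1 in auto)
      have "ennreal \<bar>L1_sum m (\<lambda>j. u x (t j)) - (LINT s:{0<..<t m}|lborel. (t m - s) powr (-\<alpha>) * u1 x s)\<bar> \<le>
        (\<integral>\<^sup>+s. ennreal (\<bar>ker_avg m 0 - (t m - s) powr (-\<alpha>)\<bar> * indicator {0<..<t 1} s) * ennreal \<bar>u1 x s\<bar> \<partial>lborel)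
        + (\<Sum>j\<in>{1..<m}. ennreal (2 * ker_osc m j) * (\<integral>\<^sup>+s. ennreal \<bar>u2 x s\<bar> * indicator {t j<..<t (Suc j)} s \<partial>lborel))"
        using m t1 der[OF x] cu cu1 mu2 int[OF x, of "t m"] by (intro truncation_pointwise) (auto simp: u1_def)
      also have "(\<integral>\<^sup>+s. ennreal (\<bar>ker_avg m 0 - (t m - s) powr (-\<alpha>)\<bar> * indicator {0<..<t 1} s) * ennreal \<bar>u1 x s\<bar> \<partial>lborel) = G 0 x"
        unfolding G_def N0_def using t1
        by (subst nn_integral_lborel_on(1)) (auto simp: w_def indicator_def intro!: nn_integral_cong)
      also have "(\<Sum>j\<in>{1..<m}. ennreal (2 * ker_osc m j) * (\<integral>\<^sup>+s. ennreal \<bar>u2 x s\<bar> * indicator {t j<..<t (Suc j)} s \<partial>lborel))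
        = (\<Sum>j\<in>{1..<m}. ennreal (v j) * G j x)"
      proof (intro sum.cong refl)
        fix j assume j: "j \<in> {1..<m}"
        have "(\<integral>\<^sup>+s. ennreal \<bar>u2 x s\<bar> * indicator {t j<..<t (Suc j)} s \<partial>lborel) = G j x"
          unfolding G_def N0_def using tj[OF j] j
          by (subst nn_integral_lborel_on(1)) (auto simp: w_def indicator_def intro!: nn_integral_cong)
        then show "ennreal (2 * ker_osc m j) * (\<integral>\<^sup>+s. ennreal \<bar>u2 x s\<bar> * indicator {t j<..<t (Suc j)} s \<partial>lborel) = ennreal (v j) * G j x"
          using j by (simp add: v_def)
      qed
      also have "G 0 x + (\<Sum>j\<in>{1..<m}. ennreal (v j) * G j x) = F x"
        unfolding F_def split by (simp add: v_def)
      finally show ?thesis .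
    qed
    have "F \<in> borel_measurable M" unfolding F_def using Gm by (intro borel_measurable_sum borel_measurable_times) auto
    then show ?thesis using L bound by blast
  qed
  moreover have "0 < D * (C1 + 2 * CX)" using D C1 CX by simp
  ultimately show ?thesis unfolding M_def u1_def by blast
qed

text \<open>Points of the submesh are mesh points, so no mesh interval straddles one, and each step
  is at most the coarse step around it. In the constant, \<open>2 powr r\<close> bounds the growth
  of \<open>i powr r\<close> from \<open>i\<close> to \<open>Suc i\<close>, and the square of
  \<open>K\<close> stems from comparing both coarse end points with the graded ones.\<close>

lemma fine_mesh_of_quasi_graded:
  fixes \<alpha> r T K :: real
  assumes \<alpha>: "0 < \<alpha>" "\<alpha> < 1" and r: "1 \<le> r" and mesh: "temporal_mesh T N t"
    and qg: "quasi_graded K r T M t'" and sub: "t' ` {..M} \<subseteq> t ` {..N}" and t1: "t' 1 = t 1"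
  shows "fine_mesh \<alpha> r (K * (K\<^sup>2 * 2 powr r) powr (1 - 1 / r)) N t" "t 1 \<le> K * real M powr (-r)" "0 < K"
proof -
  have N: "1 \<le> N" "t 0 = 0" "t N = T" "\<And>j. j < N \<Longrightarrow> t j < t (Suc j)" using mesh by (auto simp: temporal_mesh_def)
  have M: "1 \<le> M" "t' 0 = 0" "t' M = T" "\<And>j. j < M \<Longrightarrow> t' j < t' (Suc j)"
    using qg by (auto simp: quasi_graded_def temporal_mesh_def)
  have q: "t' j \<le> K * (t' 1 * real j powr r)" "t' 1 * real j powr r \<le> K * t' j"
    "t' j - t' (j - 1) \<le> K * (t' 1 powr (1 / r) * t' j powr (1 - 1 / r))" if "j \<in> {1..M}" for j
    using qg that by (auto simp: quasi_graded_def equiv_up_to_def)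
  show le: "t 1 \<le> K * real M powr (-r)" using qg t1 by (simp add: quasi_graded_def equiv_up_to_def)
  have pos1: "0 < t 1" using N(4)[of 0] N by simp
  then have "0 < K * real M powr (-r)" using le by linarith
  then show K: "0 < K" by (simp add: zero_less_mult_iff)
  have mono_t: "t i \<le> t j" if "i \<le> j" "j \<le> N" for i j
    using that by (induction j rule: dec_induct) (auto simp: Suc_le_eq intro: order_trans less_imp_le N(4))
  have mono_t': "t' i \<le> t' j" if "i \<le> j" "j \<le> M" for i j
    using that by (induction j rule: dec_induct) (auto simp: Suc_le_eq intro: order_trans less_imp_le M(4))
  show "fine_mesh \<alpha> r (K * (K\<^sup>2 * 2 powr r) powr (1 - 1 / r)) N t"
  proof
    show "0 < K * (K\<^sup>2 * 2 powr r) powr (1 - 1 / r)" using K by simp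
    fix j assume j: "1 \<le> j" "j < N"
    \<comment> \<open>The coarse interval that contains \<open>t j\<close> starts at index
      \<open>Max I\<close>. That index is at least 1 because both meshes share their first point, so
      the factor-2 bound on \<open>Suc i\<close> is available.\<close>
    define I where "I = {i. i \<le> M \<and> t' i \<le> t j}"
    have fin: "finite I" by (simp add: I_def)
    have "1 \<in> I" using M t1 mono_t[of 1 j] j by (auto simp: I_def)
    define i where "i = Max I"
    have iI: "i \<in> I" unfolding i_def using fin \<open>1 \<in> I\<close> by (intro Max_in) auto
    have i1: "1 \<le> i" unfolding i_def using fin \<open>1 \<in> I\<close> by (intro Max_ge)
    have tjN: "t j < T" using N(4)[OF j(2)] mono_t[OF Suc_leI[OF j(2)] order_refl] N(3) by linarith
    have iM: "i < M" using iI tjN M by (cases "i = M") (auto simp: I_def)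
    have "Suc i \<notin> I"
    proof
      assume "Suc i \<in> I"
      with fin have "Suc i \<le> Max I" by (rule Max_ge)
      then show False by (simp add: i_def)
    qed
    then have gt: "t j < t' (Suc i)" using iM by (auto simp: I_def)
    have "t' (Suc i) \<in> t ` {..N}" using sub iM by auto
    then obtain l where l: "l \<le> N" "t' (Suc i) = t l" by auto
    have "Suc j \<le> l" using gt l mono_t[of l j] j by (cases "l \<le> j") auto
    then have "t (Suc j) \<le> t' (Suc i)" using l mono_t by auto
    moreover have "t' i \<le> t j" using iI by (simp add: I_def)
    ultimately have "t (Suc j) - t j \<le> t' (Suc i) - t' i" by simp
    also have "\<dots> \<le> K * (t 1 powr (1 / r) * t' (Suc i) powr (1 - 1 / r))" using q(3)[of "Suc i"] iM t1 by simp
    also have "\<dots> \<le> K * (t 1 powr (1 / r) * (K\<^sup>2 * 2 powr r * t j) powr (1 - 1 / r))"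
    proof -
      have "t' (Suc i) \<le> K * (t 1 * real (Suc i) powr r)" using q(1)[of "Suc i"] iM t1 by simp
      also have "real (Suc i) powr r \<le> (2 * real i) powr r" using i1 r by (intro powr_mono2) auto
      also have "\<dots> = 2 powr r * real i powr r" by (simp add: powr_mult)
      also have "K * (t 1 * (2 powr r * real i powr r)) = K * 2 powr r * (t' 1 * real i powr r)" using t1 by simp
      also have "\<dots> \<le> K * 2 powr r * (K * t j)"
      proof -
        have "t' 1 * real i powr r \<le> K * t' i" using q(2)[of i] i1 iM by simp
        also have "\<dots> \<le> K * t j" using \<open>t' i \<le> t j\<close> K by (intro mult_left_mono) auto
        finally show ?thesis using K by (intro mult_left_mono) auto
      qed
      finally have "t' (Suc i) \<le> K\<^sup>2 * 2 powr r * t j" using K pos1 by (simp add: power2_eq_square mult_ac)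
      moreover have "0 \<le> t' (Suc i)" using mono_t'[of 0 "Suc i"] iM M by simp
      ultimately show ?thesis using K r by (intro mult_left_mono powr_mono2) auto
    qed
    also have "\<dots> = K * (K\<^sup>2 * 2 powr r) powr (1 - 1 / r) * (t j * (t 1 / t j) powr (1 / r))"
    proof -
      have tj: "0 < t j" using mono_t[of 1 j] pos1 j by simp
      have "(K\<^sup>2 * 2 powr r * t j) powr (1 - 1 / r) = (K\<^sup>2 * 2 powr r) powr (1 - 1 / r) * t j powr (1 - 1 / r)"
        using tj by (intro powr_mult)
      moreover have "t 1 powr (1 / r) * t j powr (1 - 1 / r) = t j * (t 1 / t j) powr (1 / r)"
        using tj pos1 by (simp add: powr_divide powr_diff)
      ultimately show ?thesis by (simp add: mult_ac)
    qed
    finally show "t (Suc j) - t j \<le> K * (K\<^sup>2 * 2 powr r) powr (1 - 1 / r) * (t j * (t 1 / t j) powr (1 / r))" .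
  qed (use \<alpha> r N in auto)
qed

text \<open>The exponent \<open>(2 - \<alpha>) / r\<close> is above, at or below 1 in the three
  regimes, and the cap \<open>1 + \<nu> / 2\<close> preserves this. Below 1 the power of
  \<open>t 1\<close> becomes \<open>real M powr (\<alpha> - 2)\<close>; otherwise \<open>t 1\<close>
  itself is bounded by \<open>K * real M powr (-r)\<close>.\<close>

lemma log_power_le_error_bound:
  fixes \<alpha> r K :: real
  assumes r: "1 \<le> r" and K: "0 < K" and \<alpha>: "\<alpha> < 1" and \<nu>: "0 < \<nu>" and t: "0 < t 1" "t 1 \<le> t m"
    and t1: "t 1 \<le> K * real M powr (-r)"
  defines "\<theta> \<equiv> min ((2 - \<alpha>) / r) (1 + \<nu> / 2)"
  shows "t 1 * t m powr (\<alpha> - 1) * log_power \<theta> (t 1 / t m) \<le> (K + K powr \<theta>) * error_bound \<alpha> r M t m"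
proof -
  have tm: "0 < t m" using t by simp
  have eb: "0 \<le> error_bound \<alpha> r M t m" using t tm by (auto simp: error_bound_def intro!: mult_nonneg_nonneg add_nonneg_nonneg)
  consider "r < 2 - \<alpha>" | "r = 2 - \<alpha>" | "r > 2 - \<alpha>" by linarith
  then show ?thesis
  proof cases
    case 1
    then have "1 < (2 - \<alpha>) / r" using r by (simp add: pos_less_divide_eq)
    then have "1 < \<theta>" using \<nu> by (simp add: \<theta>_def)
    then have "t 1 * t m powr (\<alpha> - 1) * log_power \<theta> (t 1 / t m) = t 1 * t m powr (\<alpha> - 1)" by (simp add: log_power_def)
    also have "\<dots> \<le> (K * real M powr (-r)) * t m powr (\<alpha> - 1)" using t1 by (intro mult_right_mono) auto
    also have "\<dots> = K * error_bound \<alpha> r M t m" using 1 by (simp add: error_bound_def)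
    also have "\<dots> \<le> (K + K powr \<theta>) * error_bound \<alpha> r M t m" using eb by (intro mult_right_mono) auto
    finally show ?thesis .
  next
    case 2
    then have \<theta>1: "\<theta> = 1" using \<nu> \<alpha> by (simp add: \<theta>_def)
    have ln: "0 \<le> ln (t m / t 1)" using t by simp
    have "t 1 * t m powr (\<alpha> - 1) * log_power \<theta> (t 1 / t m) = t 1 * (t m powr (\<alpha> - 1) * (1 + ln (t m / t 1)))"
      using t tm by (simp add: \<theta>1 log_power_def ln_div)
    also have "\<dots> \<le> (K * real M powr (-r)) * (t m powr (\<alpha> - 1) * (1 + ln (t m / t 1)))"
      using t1 ln by (intro mult_right_mono mult_nonneg_nonneg) auto
    also have "\<dots> = K * error_bound \<alpha> r M t m" using 2 by (simp add: error_bound_def)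
    also have "\<dots> \<le> (K + K powr \<theta>) * error_bound \<alpha> r M t m" using eb by (intro mult_right_mono) auto
    finally show ?thesis .
  next
    case 3
    then have lt: "(2 - \<alpha>) / r < 1" using r by (simp add: pos_divide_less_eq)
    have "(2 - \<alpha>) / r \<le> 1 + \<nu> / 2" using lt \<nu> by linarith
    then have "\<theta> = (2 - \<alpha>) / r" unfolding \<theta>_def by (rule min_absorb1)
    moreover have "0 < (2 - \<alpha>) / r" using \<alpha> r by simp
    ultimately have \<theta>: "\<theta> = (2 - \<alpha>) / r" "\<theta> < 1" "0 < \<theta>" using lt by simp_all
    have "t 1 * t m powr (\<alpha> - 1) * log_power \<theta> (t 1 / t m) = t 1 powr \<theta> * t m powr (\<alpha> - \<theta>)"
      using \<theta>(2) t tm by (simp add: log_power_def powr_divide powr_diff)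
    also have "\<dots> \<le> (K * real M powr (-r)) powr \<theta> * t m powr (\<alpha> - \<theta>)"
      using t t1 \<theta> by (intro mult_right_mono powr_mono2) auto
    also have "(K * real M powr (-r)) powr \<theta> = K powr \<theta> * real M powr (\<alpha> - 2)"
      using K r by (simp add: powr_mult powr_powr \<theta>(1))
    also have "K powr \<theta> * real M powr (\<alpha> - 2) * t m powr (\<alpha> - \<theta>) = K powr \<theta> * error_bound \<alpha> r M t m"
      using 3 by (simp add: error_bound_def \<theta>(1))
    also have "\<dots> \<le> (K + K powr \<theta>) * error_bound \<alpha> r M t m" using eb K by (intro mult_right_mono) auto
    finally show ?thesis .
  qed
qed

text \<open>The set where the bound fails is open, and a nonempty open set is not null. The maximum
  principle needs this pointwise form.\<close>

lemma AE_bounded_imp_bounded: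
  fixes g :: "'a::euclidean_space \<Rightarrow> real"
  assumes \<Omega>: "open \<Omega>" and g: "continuous_on \<Omega> g" and ae: "AE x in lborel. x \<in> \<Omega> \<longrightarrow> \<bar>g x\<bar> \<le> C" and x: "x \<in> \<Omega>"
  shows "\<bar>g x\<bar> \<le> C"
proof (rule ccontr)
  assume "\<not> \<bar>g x\<bar> \<le> C"
  define S where "S = \<Omega> \<inter> (\<lambda>x. \<bar>g x\<bar>) -` {C<..}"
  have "open S" unfolding S_def using g \<Omega> by (intro continuous_open_preimage continuous_intros) auto
  moreover have "x \<in> S" using x \<open>\<not> \<bar>g x\<bar> \<le> C\<close> by (simp add: S_def)
  ultimately have "\<not> negligible S" using open_not_negligible by auto
  moreover have "S \<in> null_sets lebesgue"
  proof -
    have "AE x in lborel. x \<notin> S" using ae by eventually_elim (auto simp: S_def)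
    then have "AE x in lebesgue. x \<notin> S" by (simp add: AE_completion_iff)
    then show ?thesis using \<open>open S\<close> by (simp add: AE_iff_null_sets)
  qed
  ultimately show False by (simp add: negligible_iff_null_sets)
qed

lemma elliptic_domain_of_admissible:
  assumes "open \<Omega>" "bounded \<Omega>" "admissible_coeffs p T \<Omega> a b c" "t \<in> {0<..T}"
  shows "elliptic_domain \<Omega> a b c t"
proof
  fix k x
  show "open \<Omega>" "bounded \<Omega>" by fact+
  show "Ck_on 1 \<Omega> (\<lambda>x. a k x t)" "continuous_on (closure \<Omega>) (\<lambda>x. b k x t)" "continuous_on (closure \<Omega>) (\<lambda>x. c x t)"
    using assms(3,4) unfolding admissible_coeffs_def by blast+
  assume "x \<in> \<Omega>"
  then show "0 < a k x t" using assms(3,4) closure_subset[of \<Omega>] unfolding admissible_coeffs_def by blast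
qed

theorem elliptic_stability_Lp:
  fixes \<Omega> :: "(real ^ 'd::finite) set"
  assumes \<Omega>: "open \<Omega>" "bounded \<Omega>" and p: "p \<in> {2, \<infinity>}" and adm: "admissible_coeffs p T \<Omega> a b c" and t: "t \<in> {0<..T}"
    and v: "continuous_on (closure \<Omega>) v" "Ck_on 2 \<Omega> v" "\<And>x. x \<in> frontier \<Omega> \<Longrightarrow> v x = 0"
    and \<kappa>: "0 < \<kappa>" and C: "0 \<le> C"
    and le: "Lp_le p (restrict_space lborel \<Omega>) (\<lambda>x. ennreal \<bar>\<kappa> * v x + ell_op a b c t v x\<bar>) C"
  shows "Lp_le p (restrict_space lborel \<Omega>) (\<lambda>x. ennreal \<bar>v x\<bar>) (C / \<kappa>)"
proof -
  have \<Omega>b: "\<Omega> \<in> sets borel" using \<Omega> by simp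
  have adm': "continuous_on (closure \<Omega>) (\<lambda>x. a k x t)" "Ck_on 1 \<Omega> (\<lambda>x. a k x t)" "x \<in> closure \<Omega> \<Longrightarrow> a k x t > 0"
    "continuous_on (closure \<Omega>) (\<lambda>x. b k x t)" "p \<noteq> \<infinity> \<Longrightarrow> Ck_on 1 \<Omega> (\<lambda>x. b k x t)"
    "continuous_on (closure \<Omega>) (\<lambda>x. c x t)"
    "x \<in> \<Omega> \<Longrightarrow> c x t - enn2real (1 / p) * (\<Sum>k\<in>UNIV. pd k (\<lambda>y. b k y t) x) \<ge> 0" for k x
    using adm t unfolding admissible_coeffs_def by blast+
  interpret elliptic_domain \<Omega> a b c t
    by (rule elliptic_domain_of_admissible[OF \<Omega> adm t])
  define g where "g x = \<kappa> * v x + ell_op a b c t v x" for x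
  have cg: "continuous_on \<Omega> g" unfolding g_def
    using Ck_on_2D(1)[OF v(2)] continuous_ell_op[OF v(2)] by (intro continuous_intros)
  show ?thesis
  proof (cases "p = \<infinity>")
    case True
    have "AE x in lborel. x \<in> \<Omega> \<longrightarrow> \<bar>g x\<bar> \<le> C"
      using le True \<Omega>b C by (simp add: Lp_le_def AE_lborel_on g_def)
    then have "\<bar>g x\<bar> \<le> C" if "x \<in> \<Omega>" for x
      using AE_bounded_imp_bounded[OF \<Omega>(1) cg _ that] by simp
    \<comment> \<open>Since \<open>1 / \<infinity>\<close> is 0, the coefficient condition reduces
      to the sign condition on \<open>c\<close> for the maximum principle; for \<open>p = 2\<close>
      it is the energy condition with factor 1/2.\<close>
    moreover have "0 \<le> c x t" if "x \<in> \<Omega>" for x using adm'(7)[OF that] True by simp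
    ultimately have "\<bar>v x\<bar> \<le> C / \<kappa>" if "x \<in> \<Omega>" for x
      using that C by (intro max_principle[OF v \<kappa>]) (auto simp: g_def)
    then show ?thesis using True \<Omega>b \<kappa> C by (auto simp: Lp_le_def AE_lborel_on)
  next
    case False
    then have p2: "p = 2" using p by simp
    have half: "enn2real (1 / 2) = 1 / 2"
      by (metis divide_ennreal enn2real_ennreal ennreal_1 ennreal_numeral zero_le_numeral zero_less_numeral zero_le_one zero_le_divide_iff)
    have "(\<integral>\<^sup>+x. ennreal ((v x)\<^sup>2) * indicator \<Omega> x \<partial>lborel) \<le> ennreal ((C / \<kappa>)\<^sup>2)"
    proof (rule energy_estimate[OF v \<kappa>])
      show "Ck_on 1 \<Omega> (\<lambda>x. b k x t)" for k using adm'(5) False by simp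
      show "0 \<le> c x t - 1 / 2 * (\<Sum>k\<in>UNIV. pd k (\<lambda>y. b k y t) x)" if "x \<in> \<Omega>" for x
        using adm'(7)[OF that] unfolding p2 half .
      show "(\<integral>\<^sup>+x. ennreal ((\<kappa> * v x + ell_op a b c t v x)\<^sup>2) * indicator \<Omega> x \<partial>lborel) \<le> ennreal (C\<^sup>2)"
        using le False \<Omega>b by (simp add: Lp_le_def nn_integral_lborel_on ennreal_power)
    qed
    then show ?thesis using False \<Omega>b by (simp add: Lp_le_def nn_integral_lborel_on ennreal_power)
  qed
qed

section \<open>The L1 operator as an M-matrix\<close>

context fine_mesh
begin

lemma L1_op_eq_L1_sum:
  assumes "m \<le> N"
  shows "L1_op \<alpha> t V m = 1 / Gamma (1 - \<alpha>) * L1_sum m V"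
proof -
  have "(\<Sum>j = 1..m. (V j - V (j - 1)) / (t j - t (j - 1)) * (LINT s:{t (j - 1)<..<t j}|lborel. (t m - s) powr (-\<alpha>)))
     = (\<Sum>j<m. (V (Suc j) - V j) / (t (Suc j) - t j) * (LINT s:{t j<..<t (Suc j)}|lborel. (t m - s) powr (-\<alpha>)))"
    by (rule sum.reindex_bij_witness[of _ Suc "\<lambda>j. j - 1"]) auto
  also have "\<dots> = L1_sum m V"
    unfolding L1_sum_def
  proof (intro sum.cong refl)
    fix j assume j: "j \<in> {..<m}"
    have "t j < t (Suc j)" "t (Suc j) \<le> t m" using t_less_Suc[of j] t_le[of "Suc j" m] j assms by auto
    then have "(LINT s:{t j<..<t (Suc j)}|lborel. (t m - s) powr (-\<alpha>)) = ker_int m j"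
      using kernel_integral(2)[of \<alpha> "t j" "t (Suc j)" "t m"] \<alpha> by (simp add: ker_int_def)
    then show "(V (Suc j) - V j) / (t (Suc j) - t j) * (LINT s:{t j<..<t (Suc j)}|lborel. (t m - s) powr (-\<alpha>)) = (V (Suc j) - V j) * ker_avg m j"
      by (simp add: ker_avg_def)
  qed
  finally show ?thesis by (simp add: L1_op_def)
qed

text \<open>This displays the sign pattern: a positive coefficient at the current value and, by
  \<open>ker_avg_mono\<close>, nonpositive ones at all earlier values.\<close>

lemma L1_sum_summation_by_parts:
  assumes "1 \<le> m"
  shows "L1_sum m V = ker_avg m (m - 1) * V m - (\<Sum>j\<in>{1..<m}. (ker_avg m j - ker_avg m (j - 1)) * V j) - ker_avg m 0 * V 0"
proof -
  have "(\<Sum>j<n. (V (Suc j) - V j) * k j) = k (n - 1) * V n - (\<Sum>j\<in>{1..<n}. (k j - k (j - 1)) * V j) - k 0 * V 0"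
    if "1 \<le> n" for n and k :: "nat \<Rightarrow> real"
    using that
  proof (induction n rule: dec_induct)
    case base
    then show ?case by (simp add: algebra_simps)
  next
    case (step n)
    then have "{1..<Suc n} = insert n {1..<n}" by auto
    then show ?case using step by (simp add: algebra_simps)
  qed
  from this[OF assms] show ?thesis unfolding L1_sum_def .
qed

text \<open>The value of the increasing kernel at the common mesh point \<open>t j\<close> separates
  the two averages.\<close>

lemma ker_avg_mono:
  assumes "1 \<le> j" "j < m" "m \<le> N"
  shows "ker_avg m (j - 1) \<le> ker_avg m j"
  using ker_avg_le[of "j - 1" m] ker_avg_ge[of j m] assms by simp

end

theorem theorem3p6:
  fixes \<Omega> :: "(real ^ 'd::finite) set"
    and a b :: "'d \<Rightarrow> real ^ 'd \<Rightarrow> real \<Rightarrow> real"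
    and c f u :: "real ^ 'd \<Rightarrow> real \<Rightarrow> real"
    and u0 :: "real ^ 'd \<Rightarrow> real"
    and \<alpha> T r K :: real
    and p :: ennreal
  assumes "CARD('d) \<in> {1, 2, 3}"
    and "bounded \<Omega>" and "lipschitz_domain \<Omega>"
    and "0 < \<alpha>" and "\<alpha> < 1" and "T > 0" and "r \<ge> 1"
    and "p \<in> {2, \<infinity>}"
    and "admissible_coeffs p T \<Omega> a b c"
    and "unique_classical_solution T \<alpha> \<Omega> a b c f u0 u"
    and "time_derivs_bounded p T \<alpha> \<Omega> u"
  shows "\<exists>C>0. \<forall>M N t U.
    temporal_mesh T N t \<longrightarrow>
    (N = M \<and> quasi_graded K r T M t \<or>
      (\<exists>t'. quasi_graded K r T M t' \<and> t' ` {..M} \<subseteq> t ` {..N} \<and> t' 1 = t 1)) \<longrightarrow>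
    L1_semidiscrete_solution \<alpha> \<Omega> a b c f u0 N t U \<longrightarrow>
    (\<forall>m\<in>{1..N}. Lp_norm p \<Omega> (\<lambda>x. u x (t m) - U m x) \<le> ennreal (C * error_bound \<alpha> r M t m))"
proof (cases "0 < K")
  \<comment> \<open>A quasi-graded mesh forces \<open>K\<close> to be positive, so the claim is
    vacuous here.\<close>
  case False
  have nq: "\<not> quasi_graded K r T M t'" if "temporal_mesh T N t" "quasi_graded K r T M t' \<and> t' ` {..M} \<subseteq> t ` {..N} \<and> t' 1 = t 1" for M N t t'
    using fine_mesh_of_quasi_graded(3)[OF assms(4,5,7) that(1), of K M t'] that False by blast
  show ?thesis
  proof (intro exI[of _ 1] conjI allI impI)
    fix M N t U
    assume "temporal_mesh T N t" "N = M \<and> quasi_graded K r T M t \<or>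
      (\<exists>t'. quasi_graded K r T M t' \<and> t' ` {..M} \<subseteq> t ` {..N} \<and> t' 1 = t 1)"
    then have False using nq by blast
    then show "\<forall>m\<in>{1..N}. Lp_norm p \<Omega> (\<lambda>x. u x (t m) - U m x) \<le> ennreal (1 * error_bound \<alpha> r M t m)" ..
  qed simp
next
  case K: True
  note \<alpha> = assms(4,5) and T = assms(6) and r = assms(7) and p = assms(8)
  have \<Omega>: "open \<Omega>" using assms(3) by (simp add: lipschitz_domain_def)
  then have \<Omega>b: "\<Omega> \<in> sets borel" by simp
  define MO where "MO = restrict_space lborel \<Omega>"
  have sfM: "sigma_finite_measure MO" unfolding MO_def using \<Omega>b by (rule sigma_finite_lborel_on)
  have sol: "classical_solution T \<alpha> \<Omega> a b c f u0 u" using assms(10) by (simp add: unique_classical_solution_def)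
  have u: "continuous_on (closure \<Omega> \<times> {0..T}) (\<lambda>(x, t). u x t)"
    "\<And>t. t \<in> {0<..T} \<Longrightarrow> Ck_on 2 \<Omega> (\<lambda>x. u x t)"
    "\<And>x t. x \<in> \<Omega> \<Longrightarrow> t \<in> {0<..T} \<Longrightarrow> set_integrable lborel {0<..<t} (\<lambda>s. (t - s) powr (-\<alpha>) * dt T (u x) s)"
    "\<And>x t. x \<in> \<Omega> \<Longrightarrow> t \<in> {0<..T} \<Longrightarrow> caputo T \<alpha> (u x) t + ell_op a b c t (\<lambda>y. u y t) x = f x t"
    "\<And>x t. x \<in> frontier \<Omega> \<Longrightarrow> t \<in> {0<..T} \<Longrightarrow> u x t = 0" "\<And>x. x \<in> \<Omega> \<Longrightarrow> u x 0 = u0 x"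
    using sol unfolding classical_solution_def by blast+
  \<comment> \<open>Halving gives strict inequality below \<alpha>, while keeping \<nu>
    positive.\<close>
  define \<nu> where "\<nu> = min \<alpha> ((2 - \<alpha>) / r) / 2"
  define \<theta> where "\<theta> = min ((2 - \<alpha>) / r) (1 + \<nu> / 2)"
  have pos: "0 < (2 - \<alpha>) / r" using \<alpha> r by simp
  have half: "0 < x / 2 \<and> x / 2 < x" if "0 < x" for x :: real using that by simp
  have "0 < \<nu>" "\<nu> < min \<alpha> ((2 - \<alpha>) / r)"
    using half[of "min \<alpha> ((2 - \<alpha>) / r)"] pos \<alpha>(1) unfolding \<nu>_def min_less_iff_conj by blast+
  then have \<nu>: "0 < \<nu>" "\<nu> < \<alpha>" "\<nu> \<le> (2 - \<alpha>) / r" by (simp_all add: less_imp_le)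
  have \<theta>: "0 < \<theta>" "\<theta> \<le> (2 - \<alpha>) / r" "\<theta> < \<nu> + 1" "\<theta> < \<alpha> + 1" using pos \<nu> \<alpha> by (auto simp: \<theta>_def)
  define c0 where "c0 = K * (K\<^sup>2 * 2 powr r) powr (1 - 1 / r)"
  have c0: "0 < c0" using K by (simp add: c0_def)
  obtain CB where CB: "0 < CB" "\<And>N t. fine_mesh \<alpha> r c0 N t \<Longrightarrow> (\<exists>S. S 0 = 0 \<and> (\<forall>m\<in>{1..N}. 0 < S m \<and>
     S m \<le> CB * (t 1 * t m powr (\<alpha> - 1) * log_power \<theta> (t 1 / t m)) \<and> (t 1 / t m) powr \<theta> \<le> fine_mesh.L1_sum \<alpha> t m S))"
    using discrete_barrier[OF \<alpha> r c0 \<nu> \<theta>(1,3)] by blast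
  have "\<exists>C>0. \<forall>N t m. fine_mesh \<alpha> r c0 N t \<longrightarrow> t N = T \<longrightarrow> m \<in> {1..N} \<longrightarrow>
    (\<exists>F. F \<in> borel_measurable MO \<and>
      (\<forall>x\<in>\<Omega>. ennreal \<bar>fine_mesh.L1_sum \<alpha> t m (\<lambda>j. u x (t j)) - (LINT s:{0<..<t m}|lborel. (t m - s) powr (-\<alpha>) * dt T (u x) s)\<bar> \<le> F x) \<and>
      Lp_le p MO F (C * (t 1 / t m) powr \<theta>))"
    unfolding MO_def using \<theta> by (intro truncation_error_Lp[OF \<alpha> T r c0 _ _ _ p \<Omega> u(1,3) assms(11)]) auto
  then obtain CT where CT: "0 < CT" "\<And>N t m. fine_mesh \<alpha> r c0 N t \<Longrightarrow> t N = T \<Longrightarrow> m \<in> {1..N} \<Longrightarrow>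
    (\<exists>F. F \<in> borel_measurable MO \<and>
      (\<forall>x\<in>\<Omega>. ennreal \<bar>fine_mesh.L1_sum \<alpha> t m (\<lambda>j. u x (t j)) - (LINT s:{0<..<t m}|lborel. (t m - s) powr (-\<alpha>) * dt T (u x) s)\<bar> \<le> F x) \<and>
      Lp_le p MO F (CT * (t 1 / t m) powr \<theta>))"
    by blast
  define g where "g = Gamma (1 - \<alpha>)"
  have g: "0 < g" using \<alpha> by (simp add: g_def)
  have main: "Lp_norm p \<Omega> (\<lambda>x. u x (t m) - U m x) \<le> ennreal (CT * CB * (K + K powr \<theta>) * error_bound \<alpha> r M t m)"
    if mesh: "temporal_mesh T N t" and qg: "quasi_graded K r T M t'" "t' ` {..M} \<subseteq> t ` {..N}" "t' 1 = t 1"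
      and U: "L1_semidiscrete_solution \<alpha> \<Omega> a b c f u0 N t U" and m: "m \<in> {1..N}" for M N t t' U m
  proof -
    have fm: "fine_mesh \<alpha> r c0 N t" and t1: "t 1 \<le> K * real M powr (-r)"
      using fine_mesh_of_quasi_graded[OF \<alpha> r mesh qg] by (auto simp: c0_def)
    interpret fine_mesh \<alpha> r c0 N t by fact
    have tN: "t N = T" using mesh by (simp add: temporal_mesh_def)
    have tm: "t k \<in> {0<..T}" if "k \<in> {1..N}" for k using t_pos[of k] t_le[of k N] that tN by auto
    have Um: "continuous_on (closure \<Omega>) (U k)" "Ck_on 2 \<Omega> (U k)"
      "\<And>x. x \<in> \<Omega> \<Longrightarrow> L1_op \<alpha> t (\<lambda>j. U j x) k + ell_op a b c (t k) (U k) x = f x (t k)"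
      "\<And>x. x \<in> frontier \<Omega> \<Longrightarrow> U k x = 0" if "k \<in> {1..N}" for k
      using U that unfolding L1_semidiscrete_solution_def by blast+
    have U0: "U 0 x = u0 x" if "x \<in> \<Omega>" for x using U that by (simp add: L1_semidiscrete_solution_def)
    define e where "e k x = u x (t k) - U k x" for k x
    have e0: "e 0 x = 0" if "x \<in> \<Omega>" for x using U0[OF that] u(6)[OF that] by (simp add: e_def t_0)
    have e: "continuous_on (closure \<Omega>) (e k)" "Ck_on 2 \<Omega> (e k)" "\<And>x. x \<in> frontier \<Omega> \<Longrightarrow> e k x = 0" if k: "k \<in> {1..N}" for k
    proof -
      have "continuous_on (closure \<Omega>) (\<lambda>x. (\<lambda>(x, t). u x t) (x, t k))"
        using u(1) by (rule continuous_on_compose2) (use tm[OF k] in \<open>auto intro!: continuous_intros\<close>)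
      then show "continuous_on (closure \<Omega>) (e k)" unfolding e_def using Um(1)[OF k] by (auto intro: continuous_intros)
      show "Ck_on 2 \<Omega> (e k)" by (rule Ck_on_diff[OF \<Omega> u(2)[OF tm[OF k]] Um(2)[OF k]]) (simp add: e_def)
      show "e k x = 0" if "x \<in> frontier \<Omega>" for x using Um(4)[OF k that] u(5)[OF that tm[OF k]] by (simp add: e_def)
    qed
    have e_meas: "(\<lambda>x. ennreal \<bar>e k x\<bar>) \<in> borel_measurable MO" "e k \<in> borel_measurable (lebesgue_on \<Omega>)" if k: "k \<in> {1..N}" for k
    proof -
      have ce: "continuous_on \<Omega> (e k)" using Ck_on_2D(1)[OF e(2)[OF k]] .
      then have "e k \<in> borel_measurable (restrict_space borel \<Omega>)" by (rule borel_measurable_continuous_on_restrict)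
      moreover have "measurable (restrict_space lborel \<Omega>) borel = measurable (restrict_space borel \<Omega>) (borel :: real measure)"
        by (intro measurable_cong_sets sets_restrict_space_cong) auto
      ultimately have "e k \<in> borel_measurable MO" by (simp add: MO_def)
      then show "(\<lambda>x. ennreal \<bar>e k x\<bar>) \<in> borel_measurable MO" by simp
      show "e k \<in> borel_measurable (lebesgue_on \<Omega>)" using ce \<Omega> by (intro continuous_imp_measurable_on_sets_lebesgue) auto
    qed
    obtain S where S: "S 0 = 0" "\<And>m. m \<in> {1..N} \<Longrightarrow> 0 < S m"
      "\<And>m. m \<in> {1..N} \<Longrightarrow> S m \<le> CB * (t 1 * t m powr (\<alpha> - 1) * log_power \<theta> (t 1 / t m))"
      "\<And>m. m \<in> {1..N} \<Longrightarrow> (t 1 / t m) powr \<theta> \<le> L1_sum m S"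
      using CB(2)[OF fm] by blast
    \<comment> \<open>Discrete comparison in norm: \<open>CT * S\<close> dominates the error norms
      by strong induction on the time level, because \<kappa> is the diagonal coefficient of the
      scaled L1 operator and all earlier errors enter the residual with nonnegative weights
      \<open>d j / g\<close>.\<close>
    have err: "Lp_le p MO (\<lambda>x. ennreal \<bar>e k x\<bar>) (CT * S k)" if "k \<in> {1..N}" for k
      using that
    proof (induction k rule: less_induct)
      case (less k)
      note k = less.prems
      obtain F where F: "F \<in> borel_measurable MO"
        "\<And>x. x \<in> \<Omega> \<Longrightarrow> ennreal \<bar>L1_sum k (\<lambda>j. u x (t j)) - (LINT s:{0<..<t k}|lborel. (t k - s) powr (-\<alpha>) * dt T (u x) s)\<bar> \<le> F x"
        "Lp_le p MO F (CT * (t 1 / t k) powr \<theta>)"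
        using CT(2)[OF fm tN k] by blast
      define \<kappa> where "\<kappa> = ker_avg k (k - 1) / g"
      have \<kappa>: "0 < \<kappa>" using ker_avg_pos[of "k - 1" k] k g by (simp add: \<kappa>_def)
      define d where "d j = ker_avg k j - ker_avg k (j - 1)" for j
      have d: "0 \<le> d j" if "j \<in> {1..<k}" for j using ker_avg_mono[of j k] that k by (simp add: d_def)
      \<comment> \<open>The initial error vanishes, which frees index 0 for the truncation error;
        indices from 1 on carry the earlier errors. Thus a single application of
        \<open>Lp_le_sum\<close> bounds the residual.\<close>
      define w where "w j = (if j = 0 then 1 / g else d j / g)" for j
      define G where "G j x = (if j = 0 then F x else ennreal \<bar>e j x\<bar>)" for j x
      define \<rho> where "\<rho> j = (if j = 0 then CT * (t 1 / t k) powr \<theta> else CT * S j)" for j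
      have w: "0 \<le> w j" if "j < k" for j using d[of j] g that by (auto simp: w_def)
      have split: "{..<k} = insert 0 {1..<k}" using k by auto
      have t1k: "0 < t 1 / t k" using t_1_pos t_pos[of k] k by simp
      have \<rho>: "0 < \<rho> j" if "j < k" for j
        using S(2)[of j] that k CT t1k by (auto simp: \<rho>_def intro!: mult_pos_pos)
      have residual: "ennreal \<bar>\<kappa> * e k x + ell_op a b c (t k) (e k) x\<bar> \<le> (\<Sum>j<k. ennreal (w j) * G j x)" if x: "x \<in> \<Omega>" for x
      proof -
        interpret elliptic_domain \<Omega> a b c "t k"
          by (rule elliptic_domain_of_admissible[OF \<Omega> assms(2,9) tm[OF k]])
        define \<sigma> where "\<sigma> = L1_sum k (\<lambda>j. u x (t j)) - (LINT s:{0<..<t k}|lborel. (t k - s) powr (-\<alpha>) * dt T (u x) s)"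
        have "ell_op a b c (t k) (e k) x = ell_op a b c (t k) (\<lambda>x. u x (t k)) x - ell_op a b c (t k) (U k) x"
          by (rule ell_op_diff[OF u(2)[OF tm[OF k]] Um(2)[OF k] _ x]) (simp add: e_def)
        also have "\<dots> = L1_op \<alpha> t (\<lambda>j. U j x) k - caputo T \<alpha> (u x) (t k)"
          using u(4)[OF x tm[OF k]] Um(3)[OF k x] by simp
        also have "\<dots> = 1 / g * (L1_sum k (\<lambda>j. U j x) - (LINT s:{0<..<t k}|lborel. (t k - s) powr (-\<alpha>) * dt T (u x) s))"
          using L1_op_eq_L1_sum[of k] k by (simp add: caputo_def g_def right_diff_distrib diff_divide_distrib)
        also have "L1_sum k (\<lambda>j. U j x) = L1_sum k (\<lambda>j. u x (t j)) - L1_sum k (\<lambda>j. e j x)"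
          by (simp add: L1_sum_def e_def algebra_simps sum_subtractf sum.distrib)
        also have "L1_sum k (\<lambda>j. e j x) = ker_avg k (k - 1) * e k x - (\<Sum>j\<in>{1..<k}. d j * e j x)"
          using L1_sum_summation_by_parts[of k "\<lambda>j. e j x"] e0[OF x] k by (simp add: d_def)
        finally have "\<kappa> * e k x + ell_op a b c (t k) (e k) x = 1 / g * \<sigma> + (\<Sum>j\<in>{1..<k}. d j / g * e j x)"
          by (simp add: \<kappa>_def \<sigma>_def algebra_simps add_divide_distrib diff_divide_distrib sum_divide_distrib)
        then have "\<bar>\<kappa> * e k x + ell_op a b c (t k) (e k) x\<bar> \<le> \<bar>1 / g * \<sigma>\<bar> + \<bar>\<Sum>j\<in>{1..<k}. d j / g * e j x\<bar>"
          by (simp only: abs_triangle_ineq)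
        also have "\<bar>\<Sum>j\<in>{1..<k}. d j / g * e j x\<bar> \<le> (\<Sum>j\<in>{1..<k}. w j * \<bar>e j x\<bar>)"
          using d g by (intro order_trans[OF sum_abs] sum_mono) (auto simp: abs_mult w_def)
        also have "\<bar>1 / g * \<sigma>\<bar> = w 0 * \<bar>\<sigma>\<bar>" using g by (simp add: w_def abs_mult)
        finally have "ennreal \<bar>\<kappa> * e k x + ell_op a b c (t k) (e k) x\<bar> \<le> ennreal (w 0 * \<bar>\<sigma>\<bar> + (\<Sum>j\<in>{1..<k}. w j * \<bar>e j x\<bar>))"
          by (auto intro: ennreal_leI)
        also have "\<dots> = ennreal (w 0) * ennreal \<bar>\<sigma>\<bar> + (\<Sum>j\<in>{1..<k}. ennreal (w j) * ennreal \<bar>e j x\<bar>)"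
        proof -
          have "ennreal (\<Sum>j\<in>{1..<k}. w j * \<bar>e j x\<bar>) = (\<Sum>j\<in>{1..<k}. ennreal (w j) * ennreal \<bar>e j x\<bar>)"
            using w by (subst sum_ennreal[symmetric]) (auto simp: ennreal_mult)
          moreover have "0 \<le> (\<Sum>j\<in>{1..<k}. w j * \<bar>e j x\<bar>)" using w by (intro sum_nonneg) auto
          moreover have "0 \<le> w 0" using w[of 0] k by simp
          ultimately show ?thesis by (simp add: ennreal_plus ennreal_mult)
        qed
        also have "\<dots> \<le> (\<Sum>j<k. ennreal (w j) * G j x)"
          unfolding split using F(2)[OF x] by (auto simp: G_def \<sigma>_def intro!: add_mono mult_left_mono)
        finally show ?thesis .
      qed
      have sum_Lp: "Lp_le p MO (\<lambda>x. \<Sum>j<k. ennreal (w j) * G j x) (\<Sum>j<k. w j * \<rho> j)"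
      proof (rule Lp_le_sum[OF sfM])
        fix j assume j: "j \<in> {..<k}"
        show "G j \<in> borel_measurable MO" using F(1) e_meas(1)[of j] j k by (cases "j = 0") (auto simp: G_def[abs_def])
        show "Lp_le p MO (G j) (\<rho> j)" using F(3) less.IH[of j] j k by (cases "j = 0") (auto simp: G_def[abs_def] \<rho>_def)
      qed (use w \<rho> in auto)
      \<comment> \<open>The barrier inequality, rewritten by summation by parts with
        \<open>S 0 = 0\<close>: the truncation bound plus the weighted earlier barrier values is at
        most the diagonal coefficient times \<open>S k\<close>.\<close>
      have sum_le: "(\<Sum>j<k. w j * \<rho> j) \<le> CT * S k * \<kappa>"
      proof -
        have "(\<Sum>j<k. w j * \<rho> j) = CT / g * ((t 1 / t k) powr \<theta> + (\<Sum>j\<in>{1..<k}. d j * S j))"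
          unfolding split by (simp add: w_def \<rho>_def sum_distrib_left distrib_left mult_ac)
        also have "\<dots> \<le> CT / g * (ker_avg k (k - 1) * S k)"
          using S(4)[OF k] L1_sum_summation_by_parts[of k S] k S(1) CT g
          by (intro mult_left_mono) (auto simp: d_def)
        finally show ?thesis by (simp add: \<kappa>_def mult_ac)
      qed
      have sum_nonneg: "0 \<le> (\<Sum>j<k. w j * \<rho> j)" using w \<rho> by (auto intro!: sum_nonneg simp: less_imp_le)
      have res_Lp: "Lp_le p MO (\<lambda>x. ennreal \<bar>\<kappa> * e k x + ell_op a b c (t k) (e k) x\<bar>) (CT * S k * \<kappa>)"
        by (rule Lp_le_mono[OF sum_Lp _ sum_nonneg sum_le]) (rule residual, simp add: MO_def)
      have "0 \<le> CT * S k * \<kappa>" using S(2)[OF k] CT(1) \<kappa> by simp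
      from elliptic_stability_Lp[OF \<Omega> assms(2) p assms(9) tm[OF k] e[OF k] \<kappa> this res_Lp[unfolded MO_def]]
      have "Lp_le p MO (\<lambda>x. ennreal \<bar>e k x\<bar>) (CT * S k * \<kappa> / \<kappa>)" unfolding MO_def .
      then show ?case using \<kappa> by simp
    qed
    have "S m \<le> CB * ((K + K powr \<theta>) * error_bound \<alpha> r M t m)"
    proof -
      have "t 1 * t m powr (\<alpha> - 1) * log_power \<theta> (t 1 / t m) \<le> (K + K powr \<theta>) * error_bound \<alpha> r M t m"
        unfolding \<theta>_def using r K \<alpha> \<nu> t_1_pos t_1_le[of m] m t1 by (intro log_power_le_error_bound) auto
      then have "CB * (t 1 * t m powr (\<alpha> - 1) * log_power \<theta> (t 1 / t m)) \<le> CB * ((K + K powr \<theta>) * error_bound \<alpha> r M t m)"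
        using CB(1) by (intro mult_left_mono) auto
      then show ?thesis using S(3)[OF m] by linarith
    qed
    then have bound: "CT * S m \<le> CT * CB * (K + K powr \<theta>) * error_bound \<alpha> r M t m"
      using CT(1) by (simp add: mult.assoc)
    have Sm: "0 \<le> CT * S m" using CT S(2)[OF m] by simp
    have "Lp_norm p \<Omega> (e m) \<le> ennreal (CT * S m)"
      using err[OF m] e_meas(2)[OF m] unfolding MO_def by (subst Lp_norm_le_iff[OF p \<Omega>b Sm]) auto
    also have "\<dots> \<le> ennreal (CT * CB * (K + K powr \<theta>) * error_bound \<alpha> r M t m)" using bound by (rule ennreal_leI)
    finally show ?thesis by (simp add: e_def[abs_def])
  qed
  have C: "0 < CT * CB * (K + K powr \<theta>)" using CT(1) CB(1) K by (simp add: add_pos_nonneg)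
  show ?thesis
  proof (rule exI, intro conjI allI impI ballI)
    show "0 < CT * CB * (K + K powr \<theta>)" by (rule C)
    fix M N t U m
    assume mesh: "temporal_mesh T N t" and qg: "N = M \<and> quasi_graded K r T M t \<or>
      (\<exists>t'. quasi_graded K r T M t' \<and> t' ` {..M} \<subseteq> t ` {..N} \<and> t' 1 = t 1)"
      and U: "L1_semidiscrete_solution \<alpha> \<Omega> a b c f u0 N t U" and m: "m \<in> {1..N}"
    \<comment> \<open>In the case \<open>N = M\<close> the mesh is its own submesh.\<close>
    from qg obtain t' where "quasi_graded K r T M t'" "t' ` {..M} \<subseteq> t ` {..N}" "t' 1 = t 1" by blast
    from main[OF mesh this U m]
    show "Lp_norm p \<Omega> (\<lambda>x. u x (t m) - U m x) \<le> ennreal (CT * CB * (K + K powr \<theta>) * error_bound \<alpha> r M t m)" .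
  qed
qed

end
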